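(* Assume Assumptions 1, 2, 4 and 5, and let $\hat\delta$ be the cross-fitted estimator defined below. Suppose $\rho_{N,e},\rho_{N,r},\rho_{N,\mu},\rho_{N,\tilde\mu}=o(1)$, that almost surely $(\tilde\mu_0-\tilde\mu^* )(r_0-r^* )=0$ and $(\mu_0-\mu^* )(e_0-e^* )=0$, and that $\|\tilde\mu_0-\tilde\mu^*\|_\infty\le C$ and $\|\mu_0-\mu^*\|_\infty\le C$ with $C$ the constant of Assumption 5. Then $\hat\delta\to\delta^*$ in probability as $N\to\infty$.
   Context: Setting: $(X,T,S(0),S(1),Y(0),Y(1),R)$ has law $\mathbb P$, $T\in\{0,1\}$ treatment, $X$ covariates, $S(t)$ potential surrogates, $Y(t)\in\mathbb R$ potential primary outcomes, $R\in\{0,1\}$ labelling indicator; $S=S(T)$, $Y=Y(T)$; observation $W=(X,T,S,Y,R)$ with $Y$ recorded only if $R=1$; data $W_1,\dots,W_N$ i.i.d. Target $\delta^*=\mathbb E[Y(1)]-\mathbb E[Y(0)]$. Nuisances: $e^*(x)=\mathbb P(T=1\mid X=x)$, $r^*(t,x,s)=\mathbb P(R=1\mid T=t,X=x,S=s)$, $\tilde\mu^*(t,x,s)=\mathbb E[Y\mid T=t,R=1,X=x,S=s]$, $\mu^*(t,x)=\mathbb E[\tilde\mu^*(t,X,S)\mid T=t,X=x]$ (the paper writes $\mathbb E[Y\mid T=t,R=1,X=x]$). Norms: $\|f\|_p=(\mathbb E|f(W)|^p)^{1/p}$, $\|f\|_\infty$ the essential sup under $\mathbb P$. Assumption 1: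 for $t=0,1$, $(Y(t),S(t))\perp T\mid X$ and $R\perp Y(t)\mid(X,T=t,S(t))$. Assumption 2: there is $\epsilon\in(0,1/2)$ with $\epsilon\le e^*(X)\le 1-\epsilon$ and $\epsilon\le r^*(t,X,S(t))\le1$ a.s., $t=0,1$. Estimator: fix an integer $K$ not depending on $N$. Randomly partition the labelled indices $\{i:R_i=1\}$ and unlabelled indices $\{i:R_i=0\}$ each into $K$ folds and let $\mathcal I_k$ be the union of the $k$th folds, with $n=|\mathcal I_k|=N/K$. For each $k$, nuisance estimators $\hat\eta_k=(\hat e_k,\hat r_k,\hat\mu_k,\hat{\tilde\mu}_k)$ are computed from data outside $\mathcal I_k$ only ($\hat e_k,\hat r_k$ from all such data, $\hat\mu_k,\hat{\tilde\mu}_k$ from labelled such data). With $\hat{\mathbb E}_{n,k}f=n^{-1}\sum_{i\in\mathcal I_k}f(W_i)$, $$\hat\delta=\frac1K\sum_{k=1}^K\hat{\mathbb E}_{n,k}\Big\{\hat\mu_k(1,X)-\hat\mu_k(0,X)+\frac{TR}{\hat e_k(X)\hat r_k(1,X,S)}(Y-\hat{\tilde\mu}_k(1,X,S))-\frac{(1-T)R}{(1-\hat e_k(X))\hat r_k(0,X,S)}(Y-\hat{\tilde\mu}_k(0,X,S))$$ $$+\frac{T}{\hat e_k(X)}(\hat{\tilde\mu}_k(1,X,S)-\hat\mu_k(1,X))-\frac{1-T}{1-\hat e_k(X)}(\hat{\tilde\mu}_k(0,X,S)-\hat\mu_k(0,X))\Big\}.$$ Assumption 4 (nuisance rates): there are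 limits $\eta_0=(e_0,r_0,\mu_0,\tilde\mu_0)$ such that for each $k$, $\|\hat e_k-e_0\|_2=O_p(\rho_{N,e})$, $\|\hat r_k-r_0\|_2=O_p(\rho_{N,r})$, $\|\hat\mu_k-\mu_0\|_2=O_p(\rho_{N,\mu})$, $\|\hat{\tilde\mu}_k-\tilde\mu_0\|_2=O_p(\rho_{N,\tilde\mu})$ (norms taken with the estimator held fixed), and with probability one $\hat e_k(X),e_0(X)\in[\epsilon,1-\epsilon]$ and $\hat r_k,r_0\in[\epsilon,1]$. Assumption 5 (moments): there are constants $C>0$, $q>2$ with $\|\operatorname{Var}\{Y\mid X,S,T\}\|_\infty\le C$, $\|\operatorname{Var}\{Y\mid X,T\}\|_\infty\le C$, $\|\operatorname{Var}\{\tilde\mu^*(T,X,S)\mid T,X\}\|_\infty\le C$, and $\|Y(1)\|_q\vee\|Y(0)\|_q\le C$. *)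

theory Defs
  imports "HOL-Probability.Probability"
begin

text \<open>Observations W = (X, T, S, Y, R); Y is recorded only if R, so the observed Y-slot is
  set to 0 when R is False.\<close>

type_synonym ('x, 's) obs = "'x \<times> bool \<times> 's \<times> real \<times> bool"

definition obs_meas :: "'x measure \<Rightarrow> 's measure \<Rightarrow> ('x, 's) obs measure" where
  "obs_meas MX MSg = MX \<Otimes>\<^sub>M count_space UNIV \<Otimes>\<^sub>M MSg \<Otimes>\<^sub>M borel \<Otimes>\<^sub>M count_space UNIV"

definition obs_R :: "('x, 's) obs \<Rightarrow> bool" where
  "obs_R w = snd (snd (snd (snd w)))"

definition pot :: "bool \<Rightarrow> ('a \<Rightarrow> 'c) \<Rightarrow> ('a \<Rightarrow> 'c) \<Rightarrow> 'a \<Rightarrow> 'c" where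
  "pot t A0 A1 = (if t then A1 else A0)"

definition realised :: "('a \<Rightarrow> bool) \<Rightarrow> ('a \<Rightarrow> 'c) \<Rightarrow> ('a \<Rightarrow> 'c) \<Rightarrow> 'a \<Rightarrow> 'c" where
  "realised T A0 A1 a = (if T a then A1 a else A0 a)"

definition obs_of :: "('a \<Rightarrow> 'x) \<Rightarrow> ('a \<Rightarrow> bool) \<Rightarrow> ('a \<Rightarrow> 's) \<Rightarrow> ('a \<Rightarrow> 's)
    \<Rightarrow> ('a \<Rightarrow> real) \<Rightarrow> ('a \<Rightarrow> real) \<Rightarrow> ('a \<Rightarrow> bool) \<Rightarrow> 'a \<Rightarrow> ('x, 's) obs" where
  "obs_of X T S0 S1 Y0 Y1 R a =
     (X a, T a, realised T S0 S1 a, (if R a then realised T Y0 Y1 a else 0), R a)"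

definition gen_alg :: "'a measure \<Rightarrow> ('a \<Rightarrow> 'c) \<Rightarrow> 'c measure \<Rightarrow> 'a measure" where
  "gen_alg M f N = vimage_algebra (space M) f N"

text \<open>Conditional independence of A and B given the sigma-algebra G, on the event E
  (E = space M gives ordinary conditional independence; E = {T = t} with G generated by
  (X, T, S(t)) gives conditional independence given (X, T = t, S(t))).\<close>
definition cond_indep :: "'a measure \<Rightarrow> 'a measure \<Rightarrow> 'a set \<Rightarrow> ('a \<Rightarrow> 'c) \<Rightarrow> 'c measure
    \<Rightarrow> ('a \<Rightarrow> 'd) \<Rightarrow> 'd measure \<Rightarrow> bool" where
  "cond_indep M G E A MA B MB \<longleftrightarrow>
     (\<forall>EA\<in>sets MA. \<forall>EB\<in>sets MB. AE a in M. a \<in> E \<longrightarrow>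
        real_cond_exp M G (indicator (A -` EA \<inter> B -` EB \<inter> space M)) a =
        real_cond_exp M G (indicator (A -` EA \<inter> space M)) a *
        real_cond_exp M G (indicator (B -` EB \<inter> space M)) a)"

definition cond_var :: "'a measure \<Rightarrow> 'a measure \<Rightarrow> ('a \<Rightarrow> real) \<Rightarrow> 'a \<Rightarrow> real" where
  "cond_var M G f = real_cond_exp M G (\<lambda>a. (f a - real_cond_exp M G f a)\<^sup>2)"

definition Lp_norm :: "'a measure \<Rightarrow> real \<Rightarrow> ('a \<Rightarrow> real) \<Rightarrow> ereal" where
  "Lp_norm M p f = (if integrable M (\<lambda>a. \<bar>f a\<bar> powr p)
                    then ereal ((\<integral>a. \<bar>f a\<bar> powr p \<partial>M) powr (1 / p)) else \<infinity>)"

definition bigOp :: "'b measure \<Rightarrow> (nat \<Rightarrow> 'b \<Rightarrow> ereal) \<Rightarrow> (nat \<Rightarrow> real) \<Rightarrow> bool" where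
  "bigOp \<Omega> Z \<rho> \<longleftrightarrow> (\<forall>\<epsilon>>0. \<exists>B>0. \<exists>N0. \<forall>N\<ge>N0.
      measure \<Omega> {\<omega>\<in>space \<Omega>. \<bar>Z N \<omega>\<bar> > ereal (B * \<bar>\<rho> N\<bar>)} < \<epsilon>)"

definition conv_in_prob :: "'b measure \<Rightarrow> (nat \<Rightarrow> 'b \<Rightarrow> real) \<Rightarrow> real \<Rightarrow> bool" where
  "conv_in_prob \<Omega> Z c \<longleftrightarrow> (\<forall>\<epsilon>>0. (\<lambda>N. measure \<Omega> {\<omega>\<in>space \<Omega>. \<bar>Z N \<omega> - c\<bar> > \<epsilon>}) \<longlonglongrightarrow> 0)"

text \<open>The (uncentred) efficient-influence-function score evaluated at w = (x,t,s,y,r).\<close>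
definition score :: "('x \<Rightarrow> real) \<Rightarrow> (bool \<Rightarrow> 'x \<Rightarrow> 's \<Rightarrow> real) \<Rightarrow> (bool \<Rightarrow> 'x \<Rightarrow> real)
    \<Rightarrow> (bool \<Rightarrow> 'x \<Rightarrow> 's \<Rightarrow> real) \<Rightarrow> ('x, 's) obs \<Rightarrow> real" where
  "score e r mu mut w = (case w of (x, t, s, y, rr) \<Rightarrow>
     mu True x - mu False x
     + of_bool t * of_bool rr / (e x * r True x s) * (y - mut True x s)
     - (1 - of_bool t) * of_bool rr / ((1 - e x) * r False x s) * (y - mut False x s)
     + of_bool t / e x * (mut True x s - mu True x)
     - (1 - of_bool t) / (1 - e x) * (mut False x s - mu False x))"

definition fold_assign :: "(nat \<Rightarrow> (nat \<Rightarrow> bool) \<Rightarrow> 'u \<Rightarrow> nat \<Rightarrow> nat) \<Rightarrow> (nat \<Rightarrow> 'b \<Rightarrow> ('x, 's) obs)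
    \<Rightarrow> ('b \<Rightarrow> 'u) \<Rightarrow> nat \<Rightarrow> 'b \<Rightarrow> nat \<Rightarrow> nat" where
  "fold_assign F W U N \<omega> = F N (\<lambda>i. obs_R (W i \<omega>)) (U \<omega>)"

definition oof_mask :: "nat \<Rightarrow> (nat \<Rightarrow> nat) \<Rightarrow> nat \<Rightarrow> nat \<Rightarrow> bool" where
  "oof_mask N fld k = (\<lambda>i. i < N \<and> fld i \<noteq> k)"

definition crossfit_est :: "nat \<Rightarrow> nat \<Rightarrow> (nat \<Rightarrow> nat) \<Rightarrow> (nat \<Rightarrow> ('x, 's) obs)
    \<Rightarrow> (nat \<Rightarrow> 'x \<Rightarrow> real) \<Rightarrow> (nat \<Rightarrow> bool \<Rightarrow> 'x \<Rightarrow> 's \<Rightarrow> real) \<Rightarrow> (nat \<Rightarrow> bool \<Rightarrow> 'x \<Rightarrow> real)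
    \<Rightarrow> (nat \<Rightarrow> bool \<Rightarrow> 'x \<Rightarrow> 's \<Rightarrow> real) \<Rightarrow> real" where
  "crossfit_est K N fld D eh rh muh muth =
     (1 / real K) * (\<Sum>k<K. (1 / real (card {i. i < N \<and> fld i = k})) *
        (\<Sum>i\<in>{i. i < N \<and> fld i = k}. score (eh k) (rh k) (muh k) (muth k) (D i)))"

end

theory Submission
  imports Defs
begin

text \<open>Given the labels, the fold randomisation and the out-of-fold data, the observations in a fold are
  still independent, so redrawing observation \<open>i\<close> from the law of the data leaves everything
  unchanged except for the folds, which see the redrawn observation only through its label. Splitting on
  that label bounds the expected in-fold \<open>L\<^sup>1\<close> error of the estimated score by its population
  \<open>L\<^sup>1\<close> error, which is of the order of the \<open>L\<^sup>2\<close> nuisance errors. For the limiting score, the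
  part centred given the label is orthogonal across a fold, and the remaining part depends only on the
  fraction of labelled units, which balance of the folds ties to the overall fraction. Finally, double
  robustness gives the limiting score expectation \<open>\<delta>\<close>*, overlap turning facts about \<open>(T, X)\<close>
  into facts about \<open>(t, X)\<close>.\<close>

text \<open>Since the folds are stratified, membership in a fold depends on all labels, also on that
  of the observation being replaced, so conditioning on a fold is more than conditioning on the data
  outside it. Freezing the label of the redrawn point at \<open>b\<close> fixes everything out of
  fold; the point is then integrated over \<open>{L = b}\<close> only. Extending that integral to
  the whole space loses the factor \<open>lab b\<close>, which \<open>lab_const\<close> puts back: a
  constant of the law, harmless for consistency. The nuisance errors are small only with high
  probability and may have no moments, so the error of the score is cut off wherever its population
  size is large. The cut-off reads out-of-fold data only and therefore survives the redrawing. On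
  the population side, nuisances are pinned down only along \<open>(T, X, S)\<close>, and
  \<open>mutstar\<close> only where \<open>R\<close> holds. Second moments beyond these sets come
  from the lower bounds on the propensity and on the labelling probability.\<close>

text \<open>Nuisances are curried, but their measurability is stated for the uncurried function.
  These rules turn it into measurability at arbitrary measurable arguments, which the prover can
  use.\<close>

lemma measurable_app2:
  assumes "(\<lambda>(a, b). g a b) \<in> measurable (A \<Otimes>\<^sub>M B) Q"
    and [measurable]: "a \<in> measurable N A" "b \<in> measurable N B"
  shows "(\<lambda>z. g (a z) (b z)) \<in> measurable N Q"
  using measurable_compose[OF _ assms(1), of "\<lambda>z. (a z, b z)" N] by simp

lemma measurable_app3:
  assumes "(\<lambda>(a, b, c). g a b c) \<in> measurable (A \<Otimes>\<^sub>M B \<Otimes>\<^sub>M C) Q"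
    and [measurable]: "a \<in> measurable N A" "b \<in> measurable N B" "c \<in> measurable N C"
  shows "(\<lambda>z. g (a z) (b z) (c z)) \<in> measurable N Q"
  using measurable_compose[OF _ assms(1), of "\<lambda>z. (a z, b z, c z)" N] by simp

lemma measurable_app4:
  assumes "(\<lambda>(a, b, c, d). g a b c d) \<in> measurable (A \<Otimes>\<^sub>M B \<Otimes>\<^sub>M C \<Otimes>\<^sub>M D) Q"
    and [measurable]: "a \<in> measurable N A" "b \<in> measurable N B" "c \<in> measurable N C" "d \<in> measurable N D"
  shows "(\<lambda>z. g (a z) (b z) (c z) (d z)) \<in> measurable N Q"
  using measurable_compose[OF _ assms(1), of "\<lambda>z. (a z, b z, c z, d z)" N] by simp

lemma measurable_app5:
  assumes "(\<lambda>(a, b, c, d, e). g a b c d e) \<in> measurable (A \<Otimes>\<^sub>M B \<Otimes>\<^sub>M C \<Otimes>\<^sub>M D \<Otimes>\<^sub>M E) Q"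
    and [measurable]: "a \<in> measurable N A" "b \<in> measurable N B" "c \<in> measurable N C" "d \<in> measurable N D"
      "e \<in> measurable N E"
  shows "(\<lambda>z. g (a z) (b z) (c z) (d z) (e z)) \<in> measurable N Q"
  using measurable_compose[OF _ assms(1), of "\<lambda>z. (a z, b z, c z, d z, e z)" N] by simp

section \<open>Conditional expectation given a random variable\<close>

context prob_space
begin

lemma subalgebra_gen_alg:
  assumes "f \<in> measurable M N"
  shows "subalgebra M (gen_alg M f N)"
  using assms measurable_iff_sets[of f M N] measurable_space[OF assms]
  by (auto simp: subalgebra_def gen_alg_def)

lemma sigma_finite_gen_alg:
  assumes "f \<in> measurable M N"
  shows "sigma_finite_subalgebra M (gen_alg M f N)"
  by (intro finite_measure_subalgebra_is_sigma_finite finite_measure_subalgebra.intro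
      finite_measure_subalgebra_axioms.intro subalgebra_gen_alg assms finite_measure_axioms)

lemma measurable_gen_alg:
  assumes "f \<in> measurable M N" "h \<in> measurable N L"
  shows "(\<lambda>a. h (f a)) \<in> measurable (gen_alg M f N) L"
  unfolding gen_alg_def
  by (rule measurable_compose[OF measurable_vimage_algebra1 assms(2)]) (use measurable_space[OF assms(1)] in auto)

text \<open>A nuisance is a function \<open>g\<close> on the value space that agrees with a
  conditional expectation almost surely along \<open>f\<close>. Pulling out \<open>h (f a)\<close>
  needs only integrability of the product with \<open>y\<close>, so unbounded weights such as
  regressions are allowed.\<close>

lemma cond_exp_gen_alg_intg:
  fixes g h :: "_ \<Rightarrow> real"
  assumes f [measurable]: "f \<in> measurable M N" and g [measurable]: "g \<in> borel_measurable N"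
    and h [measurable]: "h \<in> borel_measurable N" and y [measurable]: "y \<in> borel_measurable M"
    and eq: "AE a in M. g (f a) = real_cond_exp M (gen_alg M f N) y a"
    and int: "integrable M (\<lambda>a. h (f a) * y a)"
  shows "integrable M (\<lambda>a. h (f a) * g (f a))"
    and "(\<integral>a. h (f a) * g (f a) \<partial>M) = (\<integral>a. h (f a) * y a \<partial>M)"
proof -
  interpret G: sigma_finite_subalgebra M "gen_alg M f N" by (rule sigma_finite_gen_alg[OF f])
  note hm = measurable_gen_alg[OF f h]
  have [measurable]: "real_cond_exp M (gen_alg M f N) y \<in> borel_measurable M" by simp
  have ae: "AE a in M. h (f a) * real_cond_exp M (gen_alg M f N) y a = h (f a) * g (f a)"
    using eq by eventually_elim simp
  show "integrable M (\<lambda>a. h (f a) * g (f a))"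
    using G.real_cond_exp_intg(1)[OF int hm y] ae
    by (subst (asm) integrable_cong_AE[where g="\<lambda>a. h (f a) * g (f a)"]) auto
  have "(\<integral>a. h (f a) * g (f a) \<partial>M) = (\<integral>a. h (f a) * real_cond_exp M (gen_alg M f N) y a \<partial>M)"
  proof (rule integral_cong_AE)
    show "AE a in M. h (f a) * g (f a) = h (f a) * real_cond_exp M (gen_alg M f N) y a"
      using eq by eventually_elim simp
  qed measurable
  then show "(\<integral>a. h (f a) * g (f a) \<partial>M) = (\<integral>a. h (f a) * y a \<partial>M)"
    using G.real_cond_exp_intg(2)[OF int hm y] by simp
qed

text \<open>The form used where finiteness is itself the goal: no integrability of \<open>h\<close>
  is asked for. Every set of \<open>gen_alg M f N\<close> is a preimage under \<open>f\<close>, so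
  testing on indicators identifies \<open>g (f a)\<close> with the nonnegative conditional
  expectation.\<close>

lemma cond_exp_gen_alg_nn_intg:
  assumes f [measurable]: "f \<in> measurable M N" and g [measurable]: "g \<in> borel_measurable N"
    and h [measurable]: "h \<in> borel_measurable N" and y: "integrable M y" and y0: "\<And>a. 0 \<le> y a"
    and eq: "AE a in M. g (f a) = real_cond_exp M (gen_alg M f N) y a"
  shows "(\<integral>\<^sup>+a. h (f a) * ennreal (g (f a)) \<partial>M) = (\<integral>\<^sup>+a. h (f a) * ennreal (y a) \<partial>M)"
proof -
  interpret G: sigma_finite_subalgebra M "gen_alg M f N" by (rule sigma_finite_gen_alg[OF f])
  have fs: "f \<in> space M \<rightarrow> space N" using measurable_space[OF f] by blast
  have ym [measurable]: "y \<in> borel_measurable M" using y by simp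
  have g0: "AE a in M. 0 \<le> g (f a)"
  proof -
    have "AE a in M. 0 \<le> real_cond_exp M (gen_alg M f N) y a" by (rule G.real_cond_exp_pos) (simp_all add: y0)
    with eq show ?thesis by eventually_elim simp
  qed
  have "AE a in M. ennreal (g (f a)) = nn_cond_exp M (gen_alg M f N) (\<lambda>a. ennreal (y a)) a"
  proof (rule G.nn_cond_exp_charact)
    show "(\<lambda>a. ennreal (g (f a))) \<in> borel_measurable (gen_alg M f N)"
      by (rule measurable_gen_alg[OF f]) simp
    fix A assume "A \<in> sets (gen_alg M f N)"
    then obtain B where B [measurable]: "B \<in> sets N" and A: "A = f -` B \<inter> space M"
      unfolding gen_alg_def sets_vimage_algebra2[OF fs] by blast
    have inty: "integrable M (\<lambda>a. indicator B (f a) * y a)"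
      by (rule Bochner_Integration.integrable_bound[OF y]) (auto simp: indicator_def)
    note E = cond_exp_gen_alg_intg[OF f g _ ym eq inty, simplified]
    have "(\<integral>\<^sup>+a\<in>A. ennreal (y a) \<partial>M) = (\<integral>\<^sup>+a. ennreal (indicator B (f a) * y a) \<partial>M)"
      by (intro nn_integral_cong) (auto simp: A indicator_def)
    also have "\<dots> = ennreal (\<integral>a. indicator B (f a) * y a \<partial>M)"
      using inty y0 by (intro nn_integral_eq_integral) auto
    also have "\<dots> = ennreal (\<integral>a. indicator B (f a) * g (f a) \<partial>M)" using E by simp
    also have "\<dots> = (\<integral>\<^sup>+a. ennreal (indicator B (f a) * g (f a)) \<partial>M)"
      using E g0 by (intro nn_integral_eq_integral[symmetric]) auto
    also have "\<dots> = (\<integral>\<^sup>+a\<in>A. ennreal (g (f a)) \<partial>M)"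
      by (intro nn_integral_cong) (auto simp: A indicator_def)
    finally show "(\<integral>\<^sup>+a\<in>A. ennreal (y a) \<partial>M) = (\<integral>\<^sup>+a\<in>A. ennreal (g (f a)) \<partial>M)" .
  qed simp
  then have "AE a in M. h (f a) * ennreal (g (f a)) = h (f a) * nn_cond_exp M (gen_alg M f N) (\<lambda>a. ennreal (y a)) a"
    by eventually_elim simp
  then have "(\<integral>\<^sup>+a. h (f a) * ennreal (g (f a)) \<partial>M) = (\<integral>\<^sup>+a. h (f a) * nn_cond_exp M (gen_alg M f N) (\<lambda>a. ennreal (y a)) a \<partial>M)"
    by (rule nn_integral_cong_AE)
  also have "\<dots> = (\<integral>\<^sup>+a. h (f a) * ennreal (y a) \<partial>M)"
    by (rule G.nn_cond_exp_intg[OF measurable_gen_alg[OF f h]]) simp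
  finally show ?thesis .
qed

text \<open>The densities \<open>q\<close> and \<open>p\<close> push forward under \<open>Y\<close>
  to the same measure on the line, and both sides are the integral of the identity against it.
  Nothing is assumed about integrability of \<open>Y\<close>: if it fails, both integrals are 0
  together.\<close>

lemma integral_eq_by_events:
  fixes q p Y :: "_ \<Rightarrow> real"
  assumes q: "integrable M q" "AE a in M. 0 \<le> q a" and p: "integrable M p" "AE a in M. 0 \<le> p a"
    and Y [measurable]: "Y \<in> borel_measurable M"
    and eq: "\<And>A. A \<in> sets borel \<Longrightarrow> (\<integral>a. q a * indicator A (Y a) \<partial>M) = (\<integral>a. p a * indicator A (Y a) \<partial>M)"
  shows "(\<integral>a. q a * Y a \<partial>M) = (\<integral>a. p a * Y a \<partial>M)"
proof -
  have [measurable]: "q \<in> borel_measurable M" "p \<in> borel_measurable M" using q p by auto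
  have em: "emeasure (distr (density M (\<lambda>a. ennreal (r a))) borel Y) A = ennreal (\<integral>a. r a * indicator A (Y a) \<partial>M)"
    if r: "integrable M r" "AE a in M. 0 \<le> r a" and [measurable]: "A \<in> sets borel" for r A
  proof -
    have [measurable]: "r \<in> borel_measurable M" using r by auto
    have "emeasure (distr (density M (\<lambda>a. ennreal (r a))) borel Y) A = (\<integral>\<^sup>+a. ennreal (r a) * indicator (Y -` A \<inter> space M) a \<partial>M)"
      by (simp add: emeasure_distr emeasure_density)
    also have "\<dots> = (\<integral>\<^sup>+a. ennreal (r a * indicator A (Y a)) \<partial>M)"
      by (intro nn_integral_cong) (auto simp: indicator_def)
    also have "\<dots> = ennreal (\<integral>a. r a * indicator A (Y a) \<partial>M)"
    proof (rule nn_integral_eq_integral)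
      show "integrable M (\<lambda>a. r a * indicator A (Y a))"
        by (rule Bochner_Integration.integrable_bound[OF r(1)]) (auto simp: indicator_def)
      show "AE a in M. 0 \<le> r a * indicator A (Y a)" using r(2) by eventually_elim (simp add: indicator_def)
    qed
    finally show ?thesis .
  qed
  have D: "distr (density M (\<lambda>a. ennreal (q a))) borel Y = distr (density M (\<lambda>a. ennreal (p a))) borel Y"
  proof (rule measure_eqI)
    fix A assume "A \<in> sets (distr (density M (\<lambda>a. ennreal (q a))) borel Y)"
    then have A: "A \<in> sets borel" by simp
    show "emeasure (distr (density M (\<lambda>a. ennreal (q a))) borel Y) A = emeasure (distr (density M (\<lambda>a. ennreal (p a))) borel Y) A"
      unfolding em[OF q A] em[OF p A] eq[OF A] ..
  qed simp
  have I: "(\<integral>y. y \<partial>distr (density M (\<lambda>a. ennreal (r a))) borel Y) = (\<integral>a. r a * Y a \<partial>M)"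
    if [measurable]: "r \<in> borel_measurable M" and "AE a in M. 0 \<le> r a" for r
  proof -
    have "(\<integral>y. y \<partial>distr (density M (\<lambda>a. ennreal (r a))) borel Y) = (\<integral>a. Y a \<partial>density M (\<lambda>a. ennreal (r a)))"
      by (rule integral_distr) simp_all
    also have "\<dots> = (\<integral>a. r a *\<^sub>R Y a \<partial>M)"
      by (rule integral_density) (use that in simp_all)
    finally show ?thesis by simp
  qed
  show ?thesis
    using I[OF \<open>q \<in> borel_measurable M\<close> q(2)] I[OF \<open>p \<in> borel_measurable M\<close> p(2)] unfolding D by (rule trans[OF sym])
qed

lemma integrable_mult_bounded:
  fixes f h :: "_ \<Rightarrow> real"
  assumes f: "integrable M f" and [measurable]: "h \<in> borel_measurable M" and b: "AE a in M. \<bar>h a\<bar> \<le> B"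
  shows "integrable M (\<lambda>a. h a * f a)"
proof (rule Bochner_Integration.integrable_bound)
  show "integrable M (\<lambda>a. B * f a)" using f by simp
  show "(\<lambda>a. h a * f a) \<in> borel_measurable M" using f by simp
  show "AE a in M. norm (h a * f a) \<le> norm (B * f a)"
    using b by eventually_elim (auto simp: abs_mult intro!: mult_right_mono)
qed

text \<open>The events \<open>Y \<in> A\<close> determine the mean, so unbounded \<open>Y\<close> need no truncation.\<close>
lemma cond_indep_weighted_mean:
  fixes w p Y :: "'a \<Rightarrow> real"
  assumes f: "f \<in> measurable M N" and J [measurable]: "J \<in> sets M" and Y [measurable]: "Y \<in> borel_measurable M"
    and wG: "w \<in> borel_measurable (gen_alg M f N)" and pG: "p \<in> borel_measurable (gen_alg M f N)"
    and w: "AE a in M. \<bar>w a\<bar> \<le> B" "AE a in M. 0 \<le> w a" and p: "AE a in M. \<bar>p a\<bar> \<le> B'" "AE a in M. 0 \<le> p a"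
    and indep: "\<And>A. A \<in> sets borel \<Longrightarrow> AE a in M. w a \<noteq> 0 \<longrightarrow>
        real_cond_exp M (gen_alg M f N) (indicator (Y -` A \<inter> J)) a =
        real_cond_exp M (gen_alg M f N) (indicator (Y -` A \<inter> space M)) a * real_cond_exp M (gen_alg M f N) (indicator J) a"
    and wp: "AE a in M. w a * real_cond_exp M (gen_alg M f N) (indicator J) a = p a"
  shows "(\<integral>a. w a * indicator J a * Y a \<partial>M) = (\<integral>a. p a * Y a \<partial>M)"
proof (rule integral_eq_by_events)
  let ?G = "gen_alg M f N"
  interpret G: sigma_finite_subalgebra M ?G by (rule sigma_finite_gen_alg[OF f])
  have [measurable]: "w \<in> borel_measurable M" "p \<in> borel_measurable M"
    by (rule measurable_from_subalg[OF subalgebra_gen_alg[OF f]], fact)+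
  have ind: "integrable M (indicator C :: 'a \<Rightarrow> real)" if "C \<in> sets M" for C
    using that by (simp add: emeasure_eq_measure)
  show "integrable M (\<lambda>a. w a * indicator J a)" by (rule integrable_mult_bounded[OF ind _ w(1)]) measurable
  show "AE a in M. 0 \<le> w a * indicator J a" using w(2) by eventually_elim (simp add: indicator_def)
  show "integrable M p" by (rule integrable_const_bound[of _ B']) (use p in auto)
  show "AE a in M. 0 \<le> p a" by fact
  fix A :: "real set" assume A: "A \<in> sets borel"
  have YA [measurable]: "Y -` A \<inter> space M \<in> sets M" by (rule measurable_sets[OF Y A])
  have "Y -` A \<inter> J = (Y -` A \<inter> space M) \<inter> J" using sets.sets_into_space[OF J] by blast
  then have YJ [measurable]: "Y -` A \<inter> J \<in> sets M" using YA by simp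
  have "(\<integral>a. w a * indicator J a * indicator A (Y a) \<partial>M) = (\<integral>a. w a * indicator (Y -` A \<inter> J) a \<partial>M)"
    by (intro Bochner_Integration.integral_cong) (auto simp: indicator_def)
  also have "\<dots> = (\<integral>a. w a * real_cond_exp M ?G (indicator (Y -` A \<inter> J)) a \<partial>M)"
    by (rule G.real_cond_exp_intg(2)[symmetric, OF integrable_mult_bounded[OF ind _ w(1)] wG]) measurable
  also have "\<dots> = (\<integral>a. p a * real_cond_exp M ?G (indicator (Y -` A \<inter> space M)) a \<partial>M)"
  proof (rule integral_cong_AE)
    show "AE a in M. w a * real_cond_exp M ?G (indicator (Y -` A \<inter> J)) a
      = p a * real_cond_exp M ?G (indicator (Y -` A \<inter> space M)) a"
      using indep[OF A] wp
    proof eventually_elim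
      case (elim a)
      \<comment> \<open>Independence is at hand only where \<open>w\<close> is nonzero; where
        \<open>w\<close> vanishes, \<open>wp\<close> forces \<open>p\<close> to vanish too.\<close>
      show ?case using elim by (cases "w a = 0") auto
    qed
  qed (simp_all add: borel_measurable_cond_exp2)
  also have "\<dots> = (\<integral>a. p a * indicator (Y -` A \<inter> space M) a \<partial>M)"
    by (rule G.real_cond_exp_intg(2)[OF integrable_mult_bounded[OF ind _ p(1)] pG]) measurable
  also have "\<dots> = (\<integral>a. p a * indicator A (Y a) \<partial>M)"
    by (intro Bochner_Integration.integral_cong) (auto simp: indicator_def)
  finally show "(\<integral>a. w a * indicator J a * indicator A (Y a) \<partial>M) = (\<integral>a. p a * indicator A (Y a) \<partial>M)" .
qed measurable

section \<open>Square-integrable random variables\<close>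

text \<open>Closure under sums, bounded multipliers and conditional expectation is what carries the
  second moment of the outcomes over to the regressions and the limiting score.\<close>

definition sq_integrable :: "('a \<Rightarrow> real) \<Rightarrow> bool" where
  "sq_integrable f \<longleftrightarrow> f \<in> borel_measurable M \<and> integrable M (\<lambda>a. (f a)\<^sup>2)"

lemma sq_integrable_measurable: "sq_integrable f \<Longrightarrow> f \<in> borel_measurable M"
  by (simp add: sq_integrable_def)

lemma sq_integrable_integrable: "sq_integrable f \<Longrightarrow> integrable M f"
  unfolding sq_integrable_def by (blast intro: square_integrable_imp_integrable)

lemma sq_integrableI_bound:
  assumes [measurable]: "f \<in> borel_measurable M" and g: "integrable M g" and le: "AE a in M. (f a)\<^sup>2 \<le> g a"
  shows "sq_integrable f"
proof -
  have "integrable M (\<lambda>a. (f a)\<^sup>2)"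
  proof (rule Bochner_Integration.integrable_bound[OF g])
    show "AE a in M. norm ((f a)\<^sup>2) \<le> norm (g a)"
      using le
    proof eventually_elim
      case (elim a)
      then have "(f a)\<^sup>2 \<le> \<bar>g a\<bar>" by linarith
      then show ?case by simp
    qed
  qed measurable
  then show ?thesis by (simp add: sq_integrable_def)
qed

lemma sq_integrable_bound:
  assumes g: "sq_integrable g" and [measurable]: "f \<in> borel_measurable M"
    and le: "AE a in M. \<bar>f a\<bar> \<le> c * \<bar>g a\<bar>"
  shows "sq_integrable f"
proof (rule sq_integrableI_bound)
  show "integrable M (\<lambda>a. c\<^sup>2 * (g a)\<^sup>2)" using g by (simp add: sq_integrable_def)
  show "AE a in M. (f a)\<^sup>2 \<le> c\<^sup>2 * (g a)\<^sup>2"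
    using le
  proof eventually_elim
    case (elim a)
    have "\<bar>f a\<bar>\<^sup>2 \<le> (c * \<bar>g a\<bar>)\<^sup>2" using elim by (intro power_mono) auto
    then show ?case by (simp add: power_mult_distrib)
  qed
qed fact

lemma sq_integrable_add:
  assumes "sq_integrable f" "sq_integrable g"
  shows "sq_integrable (\<lambda>a. f a + g a)"
proof (rule sq_integrableI_bound)
  have [measurable]: "f \<in> borel_measurable M" "g \<in> borel_measurable M"
    using assms by (auto simp: sq_integrable_def)
  show "(\<lambda>a. f a + g a) \<in> borel_measurable M" by measurable
  show "integrable M (\<lambda>a. 2 * (f a)\<^sup>2 + 2 * (g a)\<^sup>2)" using assms by (simp add: sq_integrable_def)
  have "(x + y)\<^sup>2 \<le> 2 * x\<^sup>2 + 2 * y\<^sup>2" for x y :: real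
    using zero_le_power2[of "x - y"] by (simp add: power2_sum power2_diff)
  then show "AE a in M. (f a + g a)\<^sup>2 \<le> 2 * (f a)\<^sup>2 + 2 * (g a)\<^sup>2" by simp
qed

lemma sq_integrable_mult_bounded:
  assumes f: "sq_integrable f" and h [measurable]: "h \<in> borel_measurable M" and b: "AE a in M. \<bar>h a\<bar> \<le> B"
  shows "sq_integrable (\<lambda>a. h a * f a)"
proof (rule sq_integrable_bound[OF f])
  have [measurable]: "f \<in> borel_measurable M" using f by (rule sq_integrable_measurable)
  show "(\<lambda>a. h a * f a) \<in> borel_measurable M" by measurable
  show "AE a in M. \<bar>h a * f a\<bar> \<le> B * \<bar>f a\<bar>"
    using b by eventually_elim (auto simp: abs_mult intro!: mult_right_mono)
qed

lemma sq_integrable_diff: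
  assumes "sq_integrable f" "sq_integrable g"
  shows "sq_integrable (\<lambda>a. f a - g a)"
proof -
  have "sq_integrable (\<lambda>a. -1 * g a)"
    by (rule sq_integrable_mult_bounded[OF assms(2), of _ 1]) auto
  from sq_integrable_add[OF assms(1) this] show ?thesis by simp
qed

lemma sq_integrable_bounded:
  assumes "f \<in> borel_measurable M" "AE a in M. \<bar>f a\<bar> \<le> B"
  shows "sq_integrable f"
proof (rule sq_integrable_bound[where c=B and g="\<lambda>_. 1"])
  show "sq_integrable (\<lambda>_. 1)" by (simp add: sq_integrable_def)
qed (use assms in simp_all)

text \<open>Conditional Jensen for the convex function \<open>x\<^sup>2\<close>.\<close>

lemma sq_integrable_cond_exp:
  assumes "subalgebra M G" "sq_integrable f"
  shows "sq_integrable (real_cond_exp M G f)"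
proof -
  interpret G: finite_measure_subalgebra M G
    by (intro finite_measure_subalgebra.intro finite_measure_subalgebra_axioms.intro assms(1) finite_measure_axioms)
  have "integrable M (\<lambda>a. (real_cond_exp M G f a)\<^sup>2)"
  proof (rule G.integrable_convex_cond_exp[where q="\<lambda>x. x\<^sup>2" and I=UNIV])
    show "integrable M f" by (rule sq_integrable_integrable[OF assms(2)])
    show "integrable M (\<lambda>a. (f a)\<^sup>2)" using assms(2) by (simp only: sq_integrable_def)
  next show "convex_on UNIV (\<lambda>x::real. x\<^sup>2)" by (rule convex_power2)
  qed simp_all
  then show ?thesis unfolding sq_integrable_def by (simp add: borel_measurable_cond_exp2)
qed

text \<open>A finite bound excludes the branch in which \<open>Lp_norm\<close> is infinite, so the
  \<open>q\<close>-th moment exists; it dominates the square because \<bar>x\<bar> powr 2 is at most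
  1 inside the unit interval and at most \<bar>x\<bar> powr q outside.\<close>

lemma sq_integrable_Lp_norm:
  assumes [measurable]: "f \<in> borel_measurable M" and q: "2 < q" and le: "Lp_norm M q f \<le> ereal C"
  shows "sq_integrable f"
proof (rule sq_integrableI_bound)
  have "integrable M (\<lambda>a. \<bar>f a\<bar> powr q)"
    using le by (auto simp: Lp_norm_def split: if_splits)
  then show "integrable M (\<lambda>a. 1 + \<bar>f a\<bar> powr q)" by simp
  have "x\<^sup>2 \<le> 1 + \<bar>x\<bar> powr q" for x :: real
  proof (cases "\<bar>x\<bar> \<le> 1")
    case True
    then have "x\<^sup>2 \<le> 1" by (simp add: abs_square_le_1)
    then show ?thesis using powr_ge_zero[of "\<bar>x\<bar>" q] by linarith
  next
    case False
    then have "\<bar>x\<bar> powr 2 \<le> \<bar>x\<bar> powr q" using q by (intro powr_mono) linarith+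
    moreover have "\<bar>x\<bar> powr 2 = x\<^sup>2" by simp
    ultimately show ?thesis by linarith
  qed
  then show "AE a in M. (f a)\<^sup>2 \<le> 1 + \<bar>f a\<bar> powr q" by simp
qed fact

end

section \<open>Convergence to zero in probability\<close>

text \<open>An outer-probability bound, so that nothing has to be measurable in \<open>x\<close>.\<close>
definition whp :: "'b measure \<Rightarrow> real \<Rightarrow> ('b \<Rightarrow> bool) \<Rightarrow> bool" where
  "whp M \<gamma> Q \<longleftrightarrow> (\<exists>A\<in>sets M. measure M A \<le> \<gamma> \<and> (\<forall>x\<in>space M - A. Q x))"

definition vanishes :: "'b measure \<Rightarrow> (nat \<Rightarrow> 'b \<Rightarrow> real) \<Rightarrow> bool" where
  "vanishes M Z \<longleftrightarrow> (\<forall>e>0. \<forall>\<gamma>>0. \<forall>\<^sub>F N in sequentially. whp M \<gamma> (\<lambda>x. \<bar>Z N x\<bar> \<le> e))"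

lemma whp_mono:
  assumes "whp M \<gamma> Q" "\<gamma> \<le> \<gamma>'" "\<And>x. x \<in> space M \<Longrightarrow> Q x \<Longrightarrow> Q' x"
  shows "whp M \<gamma>' Q'"
  using assms unfolding whp_def by (meson DiffD1 order_trans)

lemma vanishesI:
  assumes "\<And>e \<gamma>. 0 < e \<Longrightarrow> 0 < \<gamma> \<Longrightarrow> \<forall>\<^sub>F N in sequentially. whp M \<gamma> (\<lambda>x. \<bar>Z N x\<bar> \<le> e)"
  shows "vanishes M Z"
  using assms unfolding vanishes_def by blast

lemma vanishesD:
  assumes "vanishes M Z" "0 < e" "0 < \<gamma>"
  shows "\<forall>\<^sub>F N in sequentially. whp M \<gamma> (\<lambda>x. \<bar>Z N x\<bar> \<le> e)"
  using assms unfolding vanishes_def by blast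

context finite_measure
begin

lemma whp_conj:
  assumes "whp M \<gamma> P" "whp M \<gamma>' Q"
  shows "whp M (\<gamma> + \<gamma>') (\<lambda>x. P x \<and> Q x)"
proof -
  obtain A where A: "A \<in> sets M" "measure M A \<le> \<gamma>" "\<forall>x\<in>space M - A. P x"
    using assms(1) unfolding whp_def by blast
  obtain B where B: "B \<in> sets M" "measure M B \<le> \<gamma>'" "\<forall>x\<in>space M - B. Q x"
    using assms(2) unfolding whp_def by blast
  have "measure M (A \<union> B) \<le> \<gamma> + \<gamma>'" using A B measure_Un_le[of A M B] by simp
  moreover have "A \<union> B \<in> sets M" using A B by auto
  ultimately show ?thesis using A(3) B(3) unfolding whp_def by blast
qed

text \<open>The set where \<open>Q\<close> fails may be non-measurable; the almost-everywhere filter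
  supplies a measurable null set around it.\<close>

lemma whp_AE:
  assumes "AE x in M. Q x"
  shows "whp M 0 Q"
proof -
  obtain B where "{x\<in>space M. \<not> Q x} \<subseteq> B" "B \<in> null_sets M"
    using assms unfolding eventually_ae_filter by blast
  then show ?thesis unfolding whp_def by (intro bexI[of _ B]) (auto simp: measure_eq_0_null_sets)
qed

text \<open>Scaling by \<open>c\<close> and comparing with 1 avoids dividing by a threshold in the
  extended reals.\<close>

lemma whp_Markov:
  assumes [measurable]: "f \<in> borel_measurable M" and c: "0 \<le> c" and le: "ennreal c * (\<integral>\<^sup>+x. f x \<partial>M) \<le> ennreal \<gamma>" and "0 \<le> \<gamma>"
  shows "whp M \<gamma> (\<lambda>x. ennreal c * f x < 1)"
proof -
  let ?A = "{x\<in>space M. 1 \<le> ennreal c * f x}"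
  have "emeasure M ?A \<le> ennreal c * (\<integral>\<^sup>+x. f x * indicator (space M) x \<partial>M)"
    by (rule nn_integral_Markov_inequality) measurable
  also have "(\<integral>\<^sup>+x. f x * indicator (space M) x \<partial>M) = (\<integral>\<^sup>+x. f x \<partial>M)"
    by (intro nn_integral_cong) simp
  also note le
  finally have "measure M ?A \<le> \<gamma>" using assms(4) by (simp add: emeasure_eq_measure)
  then show ?thesis unfolding whp_def by (intro bexI[of _ ?A]) (auto simp: not_le)
qed

lemma vanishes_conv_in_prob:
  assumes "vanishes M (\<lambda>N x. Z N x - c)"
  shows "conv_in_prob M Z c"
  unfolding conv_in_prob_def
proof (intro allI impI)
  fix e :: real assume e: "0 < e"
  show "(\<lambda>N. measure M {x\<in>space M. \<bar>Z N x - c\<bar> > e}) \<longlonglongrightarrow> 0"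
  proof (rule tendstoI)
    fix \<gamma> :: real assume g: "0 < \<gamma>"
    show "\<forall>\<^sub>F N in sequentially. dist (measure M {x\<in>space M. \<bar>Z N x - c\<bar> > e}) 0 < \<gamma>"
      using vanishesD[OF assms e half_gt_zero[OF g]] unfolding whp_def
    proof (eventually_elim, safe)
      fix N A assume A: "A \<in> sets M" "measure M A \<le> \<gamma>/2" "\<forall>x\<in>space M - A. \<bar>Z N x - c\<bar> \<le> e"
      \<comment> \<open>Monotonicity needs only the larger set to be measurable: the measure of a
        non-measurable set is 0 by convention.\<close>
      have "measure M {x\<in>space M. \<bar>Z N x - c\<bar> > e} \<le> measure M A"
        using A by (intro finite_measure_mono) (auto simp: not_le[symmetric])
      then show "dist (measure M {x\<in>space M. \<bar>Z N x - c\<bar> > e}) 0 < \<gamma>"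
        using A g by simp
    qed
  qed
qed

lemma vanishes_add:
  assumes "vanishes M Z1" "vanishes M Z2"
  shows "vanishes M (\<lambda>N x. Z1 N x + Z2 N x)"
proof (rule vanishesI)
  fix e \<gamma> :: real assume pos: "0 < e" "0 < \<gamma>"
  show "\<forall>\<^sub>F N in sequentially. whp M \<gamma> (\<lambda>x. \<bar>Z1 N x + Z2 N x\<bar> \<le> e)"
    using vanishesD[OF assms(1) half_gt_zero half_gt_zero, OF pos] vanishesD[OF assms(2) half_gt_zero half_gt_zero, OF pos]
  proof eventually_elim
    case (elim N)
    show ?case by (rule whp_mono[OF whp_conj[OF elim]]) linarith+
  qed
qed

lemma vanishes_mono:
  assumes Z: "vanishes M Z" and le: "\<forall>\<^sub>F N in sequentially. \<forall>x\<in>space M. \<bar>Z' N x\<bar> \<le> \<bar>Z N x\<bar>"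
  shows "vanishes M Z'"
proof (rule vanishesI)
  fix e \<gamma> :: real assume "0 < e" "0 < \<gamma>"
  from vanishesD[OF Z this] le show "\<forall>\<^sub>F N in sequentially. whp M \<gamma> (\<lambda>x. \<bar>Z' N x\<bar> \<le> e)"
    by eventually_elim (erule whp_mono; force)
qed

lemma vanishes_cmult:
  assumes "vanishes M Z"
  shows "vanishes M (\<lambda>N x. c * Z N x)"
proof (rule vanishesI)
  fix e \<gamma> :: real assume pos: "0 < e" "0 < \<gamma>"
  \<comment> \<open>The added 1 keeps the denominator positive when \<open>c\<close> is 0.\<close>
  have e': "0 < e / (\<bar>c\<bar> + 1)" using pos by (auto intro: divide_pos_pos)
  have le: "\<bar>c * z\<bar> \<le> e" if "\<bar>z\<bar> \<le> e / (\<bar>c\<bar> + 1)" for z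
  proof -
    have "\<bar>c * z\<bar> \<le> (\<bar>c\<bar> + 1) * \<bar>z\<bar>" unfolding abs_mult by (intro mult_right_mono) auto
    also have "\<dots> \<le> e" using that by (simp add: field_simps)
    finally show ?thesis .
  qed
  show "\<forall>\<^sub>F N in sequentially. whp M \<gamma> (\<lambda>x. \<bar>c * Z N x\<bar> \<le> e)"
    using vanishesD[OF assms e' pos(2)] by eventually_elim (erule whp_mono; simp add: le)
qed

lemma vanishes_const:
  assumes "a \<longlonglongrightarrow> 0"
  shows "vanishes M (\<lambda>N x. a N)"
proof (rule vanishesI)
  fix e \<gamma> :: real assume pos: "0 < e" "0 < \<gamma>"
  show "\<forall>\<^sub>F N in sequentially. whp M \<gamma> (\<lambda>x. \<bar>a N\<bar> \<le> e)"
    using tendstoD[OF assms pos(1)]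
    by eventually_elim (use pos in \<open>auto simp: whp_def intro!: bexI[of _ "{}"]\<close>)
qed

lemma vanishes_sum:
  assumes "finite I" "\<And>k. k \<in> I \<Longrightarrow> vanishes M (Z k)"
  shows "vanishes M (\<lambda>N x. \<Sum>k\<in>I. Z k N x)"
  using assms
proof (induction I rule: finite_induct)
  case empty
  show ?case using vanishes_const[OF tendsto_const] by simp
next
  case (insert k I)
  then show ?case using vanishes_add[of "Z k"] by simp
qed

text \<open>Chebyshev's inequality, with the second moment as a nonnegative integral so that no
  integrability has to be carried along.\<close>

lemma vanishes_square_integral:
  assumes meas: "\<And>N. Z N \<in> borel_measurable M"
    and le: "\<And>N. (\<integral>\<^sup>+x. ennreal ((Z N x)\<^sup>2) \<partial>M) \<le> ennreal (b N)" and b: "b \<longlonglongrightarrow> 0"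
  shows "vanishes M Z"
proof (rule vanishesI)
  fix e \<gamma> :: real assume pos: "0 < e" "0 < \<gamma>"
  have [measurable]: "Z N \<in> borel_measurable M" for N by (rule meas)
  have "0 < \<gamma> * e\<^sup>2" using pos by simp
  from tendstoD[OF b this]
  show "\<forall>\<^sub>F N in sequentially. whp M \<gamma> (\<lambda>x. \<bar>Z N x\<bar> \<le> e)"
  proof eventually_elim
    case (elim N)
    have "ennreal (1/e\<^sup>2) * (\<integral>\<^sup>+x. ennreal ((Z N x)\<^sup>2) \<partial>M) \<le> ennreal (1/e\<^sup>2) * ennreal (\<gamma> * e\<^sup>2)"
      using elim by (intro mult_left_mono order_trans[OF le] ennreal_leI) auto
    also have "\<dots> = ennreal \<gamma>" using pos by (simp flip: ennreal_mult')
    finally have "whp M \<gamma> (\<lambda>x. ennreal (1/e\<^sup>2) * ennreal ((Z N x)\<^sup>2) < 1)"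
      using pos by (intro whp_Markov) simp_all
    then show ?case
    proof (rule whp_mono)
      fix x assume "ennreal (1/e\<^sup>2) * ennreal ((Z N x)\<^sup>2) < 1"
      then have "ennreal (1/e\<^sup>2 * (Z N x)\<^sup>2) < 1" by (subst ennreal_mult) auto
      then have "1/e\<^sup>2 * (Z N x)\<^sup>2 < 1" by (simp only: ennreal_less_one_iff)
      then have "(Z N x)\<^sup>2 < e\<^sup>2" using pos by (simp add: field_simps)
      then show "\<bar>Z N x\<bar> \<le> e" using pos abs_le_square_iff[of "Z N x" e] by simp
    qed simp
  qed
qed

end

section \<open>Resampling one coordinate of an i.i.d. sample\<close>

text \<open>Here \<open>M\<close> is the space carrying the whole sample, \<open>P\<close> is the
  law of a single observation, and \<open>U\<close> is the external randomness of the fold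
  split.\<close>

locale iid_sample = M: prob_space M for M :: "'b measure" +
  fixes S P :: "'w measure" and W :: "nat \<Rightarrow> 'b \<Rightarrow> 'w" and MU :: "'u measure" and U :: "'b \<Rightarrow> 'u"
  assumes W_meas [measurable]: "W i \<in> measurable M S"
    and U_meas [measurable]: "U \<in> measurable M MU"
    and W_indep: "prob_space.indep_vars M (\<lambda>_. S) W UNIV"
    and W_law: "distr M S (W i) = P"
    and WU_indep: "prob_space.indep_set M (sets (gen_alg M U MU))
          (sets (gen_alg M (\<lambda>x i. W i x) (PiM UNIV (\<lambda>_. S))))"
begin

abbreviation "DS \<equiv> PiM UNIV (\<lambda>_::nat. S)"
abbreviation "DM \<equiv> PiM UNIV (\<lambda>_::nat. count_space (UNIV :: bool set))"

lemma sets_P [measurable_cong]: "sets P = sets S"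
  using W_law[of 0] by (metis sets_distr)

sublocale P: prob_space P
  using M.prob_space_distr[OF W_meas] W_law by metis

definition sample :: "'b \<Rightarrow> nat \<Rightarrow> 'w" where "sample x = (\<lambda>i. W i x)"

lemma sample_meas [measurable]: "sample \<in> measurable M (DS)"
  unfolding sample_def by (intro measurable_PiM_single') (auto intro: measurable_space[OF W_meas])

lemma sample_apply: "sample x i = W i x"
  by (simp add: sample_def)

lemma distr_sample: "distr M DS sample = PiM UNIV (\<lambda>_. P)"
proof -
  have "distr M DS (\<lambda>x. \<lambda>i\<in>UNIV. W i x) = PiM UNIV (\<lambda>i. distr M S (W i))"
    using W_indep by (subst (asm) M.indep_vars_iff_distr_eq_PiM) auto
  then show ?thesis by (simp add: W_law sample_def[abs_def] restrict_UNIV)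
qed

text \<open>Independence is given for the two generated sigma-algebras. On rectangles it is the
  product formula, and rectangles determine a product of sigma-finite measures.\<close>

lemma distr_joint:
  "distr M (DS \<Otimes>\<^sub>M MU) (\<lambda>x. (sample x, U x)) = PiM UNIV (\<lambda>_. P) \<Otimes>\<^sub>M distr M MU U"
proof -
  let ?J = "distr M (DS \<Otimes>\<^sub>M MU) (\<lambda>x. (sample x, U x))"
  let ?D = "distr M DS sample" and ?Q = "distr M MU U"
  interpret D: prob_space ?D by (intro M.prob_space_distr) simp
  interpret Q: prob_space ?Q by (intro M.prob_space_distr) simp
  have "?D \<Otimes>\<^sub>M ?Q = ?J"
  proof (rule pair_measure_eqI)
    fix A B assume A: "A \<in> sets ?D" and B: "B \<in> sets ?Q"
    then have [measurable]: "A \<in> sets (DS)" "B \<in> sets MU" by auto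
    have "U -` B \<inter> space M \<in> sets (gen_alg M U MU)"
      "sample -` A \<inter> space M \<in> sets (gen_alg M (\<lambda>x i. W i x) (DS))"
      unfolding gen_alg_def sample_def[abs_def, symmetric] by (auto intro!: in_vimage_algebra)
    then have "M.prob ((U -` B \<inter> space M) \<inter> (sample -` A \<inter> space M))
      = M.prob (U -` B \<inter> space M) * M.prob (sample -` A \<inter> space M)"
      using WU_indep unfolding M.indep_sets2_eq by blast
    moreover have "(\<lambda>x. (sample x, U x)) -` (A \<times> B) \<inter> space M
      = (U -` B \<inter> space M) \<inter> (sample -` A \<inter> space M)" by auto
    ultimately show "emeasure ?D A * emeasure ?Q B = emeasure ?J (A \<times> B)"
      by (simp add: emeasure_distr M.emeasure_eq_measure mult.commute flip: ennreal_mult)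
  qed (auto intro: D.sigma_finite_measure_axioms Q.sigma_finite_measure_axioms intro!: sets_pair_measure_cong)
  then show ?thesis unfolding distr_sample by simp
qed

lemma measurable_resample [measurable]:
  "(\<lambda>(d, w). d(i := w)) \<in> measurable (DS \<Otimes>\<^sub>M S) (DS)"
proof -
  have "(\<lambda>z. (fst z)(i := snd z)) \<in> measurable (DS \<Otimes>\<^sub>M S) (DS)"
    by (rule measurable_fun_upd[where J=UNIV]) auto
  then show ?thesis by (simp add: case_prod_beta')
qed

lemma measurable_resample' [measurable (raw)]:
  assumes "f \<in> measurable N (DS)" "g \<in> measurable N S"
  shows "(\<lambda>x. (f x)(i := g x)) \<in> measurable N (DS)"
  using measurable_compose[OF measurable_Pair[OF assms] measurable_resample] by simp

text \<open>Overwriting coordinate \<open>i\<close> of an infinite product sample by an independent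
  draw from the same factor preserves the product law; \<open>U\<close> is an independent spectator
  and stays fixed.\<close>

lemma resample_nn_integral:
  assumes g [measurable]: "g \<in> borel_measurable (DS \<Otimes>\<^sub>M MU)"
  shows "(\<integral>\<^sup>+x. g (sample x, U x) \<partial>M)
    = (\<integral>\<^sup>+x. (\<integral>\<^sup>+w. g ((sample x)(i := w), U x) \<partial>P) \<partial>M)"
proof -
  let ?D = "PiM UNIV (\<lambda>_::nat. P)" and ?Q = "distr M MU U"
  interpret D: prob_space ?D by (intro prob_space_PiM P.prob_space_axioms)
  interpret Q: prob_space ?Q by (intro M.prob_space_distr) simp
  interpret DQ: pair_sigma_finite ?D ?Q ..
  interpret PD: pair_sigma_finite P ?D ..
  have sD [measurable_cong]: "sets ?D = sets DS" by (intro sets_PiM_cong) (auto simp: sets_P)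
  have g1: "g \<in> borel_measurable (?D \<Otimes>\<^sub>M ?Q)" by measurable
  have inner: "(\<integral>\<^sup>+d. (\<integral>\<^sup>+w. g (d(i := w), u) \<partial>P) \<partial>?D) = (\<integral>\<^sup>+d. g (d, u) \<partial>?D)"
    if [measurable]: "u \<in> space MU" for u
  proof -
    have m: "(\<lambda>(w, d). d(i := w)) \<in> measurable (P \<Otimes>\<^sub>M ?D) ?D" by measurable
    have "(\<integral>\<^sup>+d. (\<integral>\<^sup>+w. g (d(i := w), u) \<partial>P) \<partial>?D)
        = (\<integral>\<^sup>+z. (\<lambda>(w, d). g (d(i := w), u)) z \<partial>(P \<Otimes>\<^sub>M ?D))"
      by (subst PD.nn_integral_snd[symmetric]) auto
    also have "\<dots> = (\<integral>\<^sup>+z. (\<lambda>d. g (d, u)) ((\<lambda>(w, d). d(i := w)) z) \<partial>(P \<Otimes>\<^sub>M ?D))"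
      by (simp add: case_prod_beta')
    also have "\<dots> = (\<integral>\<^sup>+d. g (d, u) \<partial>(distr (P \<Otimes>\<^sub>M ?D) ?D (\<lambda>(w, d). d(i := w))))"
      using m by (subst nn_integral_distr) auto
    also have "distr (P \<Otimes>\<^sub>M ?D) ?D (\<lambda>(w, d). d(i := w)) = ?D"
      using distr_pair_PiM_eq_PiM[of UNIV "\<lambda>_. P" i] P.prob_space_axioms by simp
    finally show ?thesis .
  qed
  have "(\<integral>\<^sup>+x. g (sample x, U x) \<partial>M) = (\<integral>\<^sup>+z. g z \<partial>(?D \<Otimes>\<^sub>M ?Q))"
    unfolding distr_joint[symmetric] by (subst nn_integral_distr) auto
  also have "\<dots> = (\<integral>\<^sup>+u. (\<integral>\<^sup>+d. g (d, u) \<partial>?D) \<partial>?Q)"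
    using DQ.nn_integral_snd[of g] g1 by simp
  also have "\<dots> = (\<integral>\<^sup>+u. (\<integral>\<^sup>+d. (\<integral>\<^sup>+w. g (d(i := w), u) \<partial>P) \<partial>?D) \<partial>?Q)"
    by (rule nn_integral_cong) (simp add: inner)
  also have "\<dots> = (\<integral>\<^sup>+z. (\<integral>\<^sup>+w. g ((fst z)(i := w), snd z) \<partial>P) \<partial>(?D \<Otimes>\<^sub>M ?Q))"
    using DQ.nn_integral_snd[of "\<lambda>z. (\<integral>\<^sup>+w. g ((fst z)(i := w), snd z) \<partial>P)"]
    by (simp add: case_prod_beta')
  also have "\<dots> = (\<integral>\<^sup>+x. (\<integral>\<^sup>+w. g ((sample x)(i := w), U x) \<partial>P) \<partial>M)"
    unfolding distr_joint[symmetric] by (subst nn_integral_distr) auto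
  finally show ?thesis .
qed

text \<open>Equality of laws, read off from the nonnegative identity on indicators. It transports
  integrability to the product space, which the signed version needs for Fubini.\<close>

lemma resample_distr:
  "distr (M \<Otimes>\<^sub>M P) (DS \<Otimes>\<^sub>M MU) (\<lambda>(x, w). ((sample x)(i := w), U x))
     = distr M (DS \<Otimes>\<^sub>M MU) (\<lambda>x. (sample x, U x))" (is "?l = ?r")
proof (rule measure_eqI)
  interpret OP: pair_sigma_finite M P ..
  let ?N = "DS \<Otimes>\<^sub>M MU"
  fix A assume "A \<in> sets ?l"
  then have A [measurable]: "A \<in> sets ?N" by simp
  have "emeasure ?l A = (\<integral>\<^sup>+z. indicator A z \<partial>?l)" by simp
  also have "\<dots> = (\<integral>\<^sup>+z. indicator A ((sample (fst z))(i := snd z), U (fst z)) \<partial>(M \<Otimes>\<^sub>M P))"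
    by (subst nn_integral_distr) (auto simp: case_prod_beta')
  also have "\<dots> = (\<integral>\<^sup>+x. (\<integral>\<^sup>+w. indicator A ((sample x)(i := w), U x) \<partial>P) \<partial>M)"
    by (subst P.nn_integral_fst[symmetric]) auto
  also have "\<dots> = (\<integral>\<^sup>+x. indicator A (sample x, U x) \<partial>M)"
    by (rule resample_nn_integral[symmetric]) simp
  also have "\<dots> = (\<integral>\<^sup>+z. indicator A z \<partial>?r)"
    by (subst nn_integral_distr) auto
  finally show "emeasure ?l A = emeasure ?r A" by simp
qed simp

lemma resample_integral:
  fixes g :: "_ \<Rightarrow> real"
  assumes g [measurable]: "g \<in> borel_measurable (DS \<Otimes>\<^sub>M MU)"
    and int: "integrable M (\<lambda>x. g (sample x, U x))"
  shows "(\<integral>x. g (sample x, U x) \<partial>M)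
    = (\<integral>x. (\<integral>w. g ((sample x)(i := w), U x) \<partial>P) \<partial>M)"
proof -
  interpret OP: pair_sigma_finite M P ..
  let ?N = "DS \<Otimes>\<^sub>M MU"
  have "integrable (distr M ?N (\<lambda>x. (sample x, U x))) g"
    using int by (subst integrable_distr_eq) auto
  then have "integrable (M \<Otimes>\<^sub>M P) (\<lambda>(x, w). g ((sample x)(i := w), U x))"
    unfolding resample_distr[of i, symmetric]
    by (subst (asm) integrable_distr_eq) (auto simp: case_prod_beta')
  from OP.integral_fst[OF this]
  have "(\<integral>x. (\<integral>w. g ((sample x)(i := w), U x) \<partial>P) \<partial>M)
     = (\<integral>z. g ((sample (fst z))(i := snd z), U (fst z)) \<partial>(M \<Otimes>\<^sub>M P))"
    by (simp add: case_prod_beta')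
  also have "\<dots> = (\<integral>z. g z \<partial>distr (M \<Otimes>\<^sub>M P) ?N (\<lambda>(x, w). ((sample x)(i := w), U x)))"
    by (subst integral_distr) (auto simp: case_prod_beta')
  also have "\<dots> = (\<integral>x. g (sample x, U x) \<partial>M)"
    unfolding resample_distr by (subst integral_distr) auto
  finally show ?thesis by simp
qed

end

text \<open>The two integer quotients are the floor and the ceiling of \<open>a / K\<close>.\<close>

lemma abs_div_bound:
  fixes c a K :: nat
  assumes K: "1 \<le> K" and "a div K \<le> c" "c \<le> (a + K - 1) div K"
  shows "\<bar>real c - real a / real K\<bar> \<le> 1"
proof -
  have "a = K * (a div K) + a mod K" by simp
  moreover have "a mod K < K" using K by simp
  moreover have "K * (a div K) \<le> K * c" using assms by simp
  ultimately have "a \<le> K * c + K" by linarith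
  then have 1: "real a \<le> real K * real c + real K" by (metis of_nat_add of_nat_le_iff of_nat_mult)
  have "K * c \<le> K * ((a + K - 1) div K)" using assms by simp
  also have "\<dots> \<le> a + K - 1" by simp
  finally have "K * c \<le> a + K" by simp
  then have 2: "real K * real c \<le> real a + real K" by (metis of_nat_add of_nat_le_iff of_nat_mult)
  from 1 2 K show ?thesis by (simp add: abs_le_iff field_simps)
qed

lemma card_split:
  assumes "finite A"
  shows "card A = card {i\<in>A. Q i} + card {i\<in>A. \<not> Q i}"
proof -
  have "card ({i\<in>A. Q i} \<union> {i\<in>A. \<not> Q i}) = card {i\<in>A. Q i} + card {i\<in>A. \<not> Q i}"
    using assms by (intro card_Un_disjoint) auto
  moreover have "{i\<in>A. Q i} \<union> {i\<in>A. \<not> Q i} = A" by blast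
  ultimately show ?thesis by simp
qed

section \<open>Stratified folds and the effect of redrawing one observation\<close>

text \<open>The structure of an observation is forgotten except for its label \<open>L\<close>, the
  only part of the data that the fold rule \<open>F\<close> may read.\<close>

locale crossfit_sample = iid_sample M S P W MU U
  for M :: "'b measure" and S P :: "'w measure" and W :: "nat \<Rightarrow> 'b \<Rightarrow> 'w"
    and MU :: "'u measure" and U :: "'b \<Rightarrow> 'u" +
  fixes L :: "'w \<Rightarrow> bool" and F :: "nat \<Rightarrow> (nat \<Rightarrow> bool) \<Rightarrow> 'u \<Rightarrow> nat \<Rightarrow> nat" and K :: nat
  assumes L_meas [measurable]: "L \<in> measurable S (count_space UNIV)"
    and K_pos: "1 \<le> K"
    and F_local: "(\<forall>i<N. r i = r' i) \<Longrightarrow> F N r u = F N r' u"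
    and F_meas [measurable]: "(\<lambda>u. F N r u i) \<in> measurable MU (count_space UNIV)"
    and F_bal_lab: "k < K \<Longrightarrow>
          card {i. i < N \<and> r i} div K \<le> card {i. i < N \<and> r i \<and> F N r u i = k} \<and>
          card {i. i < N \<and> r i \<and> F N r u i = k} \<le> (card {i. i < N \<and> r i} + K - 1) div K"
    and F_bal_unlab: "k < K \<Longrightarrow>
          card {i. i < N \<and> \<not> r i} div K \<le> card {i. i < N \<and> \<not> r i \<and> F N r u i = k} \<and>
          card {i. i < N \<and> \<not> r i \<and> F N r u i = k} \<le> (card {i. i < N \<and> \<not> r i} + K - 1) div K"
begin

definition fld :: "nat \<Rightarrow> (nat \<Rightarrow> 'w) \<Rightarrow> 'u \<Rightarrow> nat \<Rightarrow> nat" where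
  "fld N d u = F N (\<lambda>i. L (d i)) u"

definition fold_set :: "nat \<Rightarrow> nat \<Rightarrow> (nat \<Rightarrow> 'w) \<Rightarrow> 'u \<Rightarrow> nat set" where
  "fold_set N k d u = {i. i < N \<and> fld N d u i = k}"

lemma finite_fold_set [simp]: "finite (fold_set N k d u)" by (simp add: fold_set_def)

text \<open>Trades the random index set for indicator weights over a fixed range, so that
  measurability and linearity of the integral apply.\<close>

lemma fold_set_sum: "(\<Sum>i\<in>fold_set N k d u. f i) = (\<Sum>i<N. of_bool (fld N d u i = k) * f i)"
  for f :: "nat \<Rightarrow> 'c :: semiring_1"
proof -
  have "(\<Sum>i<N. of_bool (fld N d u i = k) * f i) = (\<Sum>i\<in>{..<N}. if fld N d u i = k then f i else 0)"
    by (intro sum.cong) auto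
  also have "\<dots> = (\<Sum>i\<in>{i\<in>{..<N}. fld N d u i = k}. f i)"
    by (rule sum.inter_filter[symmetric]) simp
  finally show ?thesis by (simp add: fold_set_def)
qed

text \<open>The rule \<open>F\<close> is only known to be measurable for a fixed label sequence. By
  locality it depends on the labels below \<open>N\<close>, that is, on one of finitely many subsets
  of \<open>{..<N}\<close>, and a case split over these gives joint measurability.\<close>

lemma measurable_F_labels [measurable]:
  assumes [measurable]: "\<And>i. (\<lambda>z. l z i) \<in> measurable Q (count_space UNIV)" "u \<in> measurable Q MU"
  shows "(\<lambda>z. F N (l z) (u z) j) \<in> measurable Q (count_space UNIV)"
proof -
  define A where "A z = {i. i < N \<and> l z i}" for z
  have eq: "F N (l z) (u z) j = F N (\<lambda>i. i \<in> A z) (u z) j" for z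
    by (subst F_local[of N "l z" "\<lambda>i. i \<in> A z"]) (auto simp: A_def)
  have A: "A \<in> measurable Q (count_space (Pow {..<N}))"
  proof (subst measurable_count_space_eq2)
    show "finite (Pow {..<N})" by simp
    show "A \<in> space Q \<rightarrow> Pow {..<N} \<and> (\<forall>a\<in>Pow {..<N}. A -` {a} \<inter> space Q \<in> sets Q)"
    proof (intro conjI ballI)
      show "A \<in> space Q \<rightarrow> Pow {..<N}" by (auto simp: A_def)
      fix a assume "a \<in> Pow {..<N}"
      then have "A -` {a} \<inter> space Q = {z\<in>space Q. \<forall>i\<in>{..<N}. l z i = (i \<in> a)}"
        by (auto simp: A_def set_eq_iff subset_eq)
      also have "\<dots> \<in> sets Q" by measurable
      finally show "A -` {a} \<inter> space Q \<in> sets Q" .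
    qed
  qed
  show ?thesis unfolding eq
    by (rule measurable_compose_countable'[OF _ A]) (auto intro: countable_finite)
qed

lemma measurable_fld [measurable]:
  assumes [measurable]: "d \<in> measurable Q (DS)" "u \<in> measurable Q MU"
  shows "(\<lambda>z. fld N (d z) (u z) j) \<in> measurable Q (count_space UNIV)"
  unfolding fld_def by measurable

lemma measurable_mask [measurable]:
  assumes [measurable]: "d \<in> measurable Q (DS)" "u \<in> measurable Q MU"
  shows "(\<lambda>z. oof_mask N (fld N (d z) (u z)) k) \<in> measurable Q (DM)"
  unfolding oof_mask_def by (intro measurable_PiM_single') auto

text \<open>Each stratum is balanced up to a rounding error of 1, so the labelled count is off by at
  most 1 and the whole fold by at most 2.\<close>

lemma fold_sizes:
  assumes "k < K"
  shows "\<bar>real (card (fold_set N k d u)) - real N / real K\<bar> \<le> 2"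
    and "\<bar>real (card {i\<in>fold_set N k d u. L (d i)}) - real (card {i. i < N \<and> L (d i)}) / real K\<bar> \<le> 1"
proof -
  let ?r = "\<lambda>i. L (d i)"
  have lab: "{i\<in>fold_set N k d u. L (d i)} = {i. i < N \<and> ?r i \<and> F N ?r u i = k}"
    by (auto simp: fold_set_def fld_def)
  show 1: "\<bar>real (card {i\<in>fold_set N k d u. L (d i)}) - real (card {i. i < N \<and> L (d i)}) / real K\<bar> \<le> 1"
    unfolding lab using F_bal_lab[OF assms, of N ?r u] by (intro abs_div_bound K_pos) auto
  have unl: "{i\<in>fold_set N k d u. \<not> L (d i)} = {i. i < N \<and> \<not> ?r i \<and> F N ?r u i = k}"
    by (auto simp: fold_set_def fld_def)
  have 2: "\<bar>real (card {i\<in>fold_set N k d u. \<not> L (d i)}) - real (card {i. i < N \<and> \<not> L (d i)}) / real K\<bar> \<le> 1"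
    unfolding unl using F_bal_unlab[OF assms, of N ?r u] by (intro abs_div_bound K_pos) auto
  have 3: "card (fold_set N k d u) = card {i\<in>fold_set N k d u. L (d i)} + card {i\<in>fold_set N k d u. \<not> L (d i)}"
    by (rule card_split) simp
  have "card {..<N} = card {i\<in>{..<N}. L (d i)} + card {i\<in>{..<N}. \<not> L (d i)}"
    by (rule card_split) simp
  then have "real N = real (card {i. i < N \<and> L (d i)}) + real (card {i. i < N \<and> \<not> L (d i)})"
    by simp
  then have "real N / real K = real (card {i. i < N \<and> L (d i)}) / real K + real (card {i. i < N \<and> \<not> L (d i)}) / real K"
    by (simp only: add_divide_distrib)
  moreover from 3 have "real (card (fold_set N k d u))
      = real (card {i\<in>fold_set N k d u. L (d i)}) + real (card {i\<in>fold_set N k d u. \<not> L (d i)})"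
    by simp
  ultimately show "\<bar>real (card (fold_set N k d u)) - real N / real K\<bar> \<le> 2"
    using 1 2 by linarith
qed

text \<open>From \<open>4 * K\<close> observations on, the rounding error 2 is at most half of
  \<open>N / K\<close>.\<close>

lemma fold_size_lower:
  assumes "k < K" "4 * K \<le> N"
  shows "real N / (2 * real K) \<le> real (card (fold_set N k d u))" "0 < card (fold_set N k d u)"
proof -
  have "4 * real K \<le> real N" using assms(2) by (metis of_nat_le_iff of_nat_mult of_nat_numeral)
  then have h: "2 \<le> real N / (2 * real K)" using K_pos by (simp add: field_simps)
  have "real N / real K - 2 \<le> real (card (fold_set N k d u))"
    using fold_sizes(1)[OF assms(1), of N d u] by (simp add: abs_le_iff)
  moreover have "real N / real K = 2 * (real N / (2 * real K))" by simp
  ultimately show 1: "real N / (2 * real K) \<le> real (card (fold_set N k d u))" using h by linarith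
  then have "0 < real (card (fold_set N k d u))" using h by linarith
  then show "0 < card (fold_set N k d u)" by simp
qed

text \<open>Replacing observation \<open>i\<close> changes the folds only through the label of the new observation.\<close>
definition fldb :: "nat \<Rightarrow> nat \<Rightarrow> bool \<Rightarrow> (nat \<Rightarrow> 'w) \<Rightarrow> 'u \<Rightarrow> nat \<Rightarrow> nat" where
  "fldb N i b d u = F N ((\<lambda>j. L (d j))(i := b)) u"

lemma fld_upd: "fld N (d(i := w)) u = fldb N i (L w) d u"
proof -
  have "(\<lambda>j. L ((d(i := w)) j)) = (\<lambda>j. L (d j))(i := L w)" by auto
  then show ?thesis by (simp add: fld_def fldb_def)
qed

lemma measurable_fldb [measurable]:
  assumes [measurable]: "d \<in> measurable Q (DS)" "u \<in> measurable Q MU"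
  shows "(\<lambda>z. fldb N i b (d z) (u z) j) \<in> measurable Q (count_space UNIV)"
  unfolding fldb_def by (intro measurable_F_labels) (auto simp: fun_upd_def)

lemma measurable_maskb [measurable]:
  assumes [measurable]: "d \<in> measurable Q (DS)" "u \<in> measurable Q MU"
  shows "(\<lambda>z. oof_mask N (fldb N i b (d z) (u z)) k) \<in> measurable Q (DM)"
  unfolding oof_mask_def by (intro measurable_PiM_single') auto

lemma integrable_W: "integrable P f \<Longrightarrow> integrable M (\<lambda>x. f (W i x))" for f :: "'w \<Rightarrow> real"
  using integrable_distr[OF W_meas, of i f] by (simp add: W_law)

lemma integral_W: "f \<in> borel_measurable S \<Longrightarrow> (\<integral>x. f (W i x) \<partial>M) = (\<integral>w. f w \<partial>P)" for f :: "'w \<Rightarrow> real"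
  unfolding W_law[of i, symmetric] by (subst integral_distr) auto

definition lab :: "bool \<Rightarrow> real" where
  "lab b = P.prob {w\<in>space P. L w = b}"

text \<open>By \<open>1 / 0 = 0\<close> only label values of positive probability contribute.\<close>
definition lab_const :: real where
  "lab_const = 1 / lab True + 1 / lab False"

lemma lab_nonneg [simp]: "0 \<le> lab b" by (simp add: lab_def)

lemma lab_const_nonneg [simp]: "0 \<le> lab_const" by (simp add: lab_const_def)

lemma lab_const: "lab b \<noteq> 0 \<Longrightarrow> 1 \<le> lab_const * lab b"
proof -
  assume "lab b \<noteq> 0"
  then have "1 = 1 / lab b * lab b" by simp
  also have "\<dots> \<le> lab_const * lab b"
    by (intro mult_right_mono) (cases b; auto simp: lab_const_def)+
  finally show ?thesis .
qed

lemma label_integrable: "integrable P (\<lambda>w. of_bool (L w = b) :: real)"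
  by (rule P.integrable_const_bound[of _ 1]) auto

lemma integral_label: "(\<integral>w. of_bool (L w = b) \<partial>P) = lab b"
proof -
  have "(\<integral>w. of_bool (L w = b) \<partial>P) = (\<integral>w. indicator {w\<in>space P. L w = b} w \<partial>P)"
    by (intro Bochner_Integration.integral_cong) (auto simp: indicator_def)
  also have "\<dots> = P.prob ({w\<in>space P. L w = b} \<inter> space P)"
    by (rule Bochner_Integration.integral_indicator)
  also have "{w\<in>space P. L w = b} \<inter> space P = {w\<in>space P. L w = b}" by blast
  finally show ?thesis by (simp only: lab_def)
qed

lemma nn_integral_label: "(\<integral>\<^sup>+w. of_bool (L w = b) \<partial>P) = ennreal (lab b)"
proof -
  have "(\<integral>\<^sup>+w. ennreal (of_bool (L w = b)) \<partial>P) = ennreal (lab b)"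
    unfolding integral_label[symmetric] by (rule nn_integral_eq_integral[OF label_integrable]) simp
  moreover have "ennreal (of_bool Q) = of_bool Q" for Q by (cases Q) auto
  ultimately show ?thesis by simp
qed

text \<open>The restriction to \<open>{L = b}\<close> is dropped and the factor \<open>lab b\<close>
  is reinserted at the price \<open>lab_const\<close>; if \<open>lab b\<close> is 0, both sides are
  0. The reinserted factor will serve as the probability that another independent draw has label
  \<open>b\<close>.\<close>

lemma label_part_le:
  assumes [measurable]: "f \<in> borel_measurable S"
  shows "(\<integral>\<^sup>+w. of_bool (L w = b) * f w \<partial>P) \<le> ennreal lab_const * (ennreal (lab b) * (\<integral>\<^sup>+w. f w \<partial>P))"
proof (cases "lab b = 0")
  case True
  then have "AE w in P. (of_bool (L w = b) :: ennreal) = 0"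
    using nn_integral_label[of b] nn_integral_0_iff_AE[of "\<lambda>w. of_bool (L w = b)" P] by simp
  then have "AE w in P. of_bool (L w = b) * f w = 0" by eventually_elim simp
  then have "(\<integral>\<^sup>+w. of_bool (L w = b) * f w \<partial>P) = 0" by (subst nn_integral_0_iff_AE) auto
  then show ?thesis by simp
next
  case False
  have "(\<integral>\<^sup>+w. of_bool (L w = b) * f w \<partial>P) \<le> 1 * (\<integral>\<^sup>+w. f w \<partial>P)"
    by (simp, intro nn_integral_mono) auto
  also have "\<dots> \<le> ennreal (lab_const * lab b) * (\<integral>\<^sup>+w. f w \<partial>P)"
    using lab_const[OF False] by (intro mult_right_mono) auto
  finally show ?thesis by (simp add: ennreal_mult mult.assoc)
qed

text \<open>On the right the two roles of the draw are separated: \<open>w\<close> only supplies the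
  label that selects the function, and an independent \<open>v\<close> is the point of
  evaluation.\<close>

lemma label_decoupling:
  assumes [measurable]: "\<And>b. B b \<in> borel_measurable S"
  shows "(\<integral>\<^sup>+w. B (L w) w \<partial>P) \<le> ennreal lab_const * (\<integral>\<^sup>+w. (\<integral>\<^sup>+v. B (L w) v \<partial>P) \<partial>P)"
proof -
  have "(\<integral>\<^sup>+w. B (L w) w \<partial>P) = (\<integral>\<^sup>+w. (\<Sum>b\<in>UNIV. of_bool (L w = b) * B b w) \<partial>P)"
    by (intro nn_integral_cong) (auto simp: UNIV_bool)
  also have "\<dots> = (\<Sum>b\<in>UNIV. \<integral>\<^sup>+w. of_bool (L w = b) * B b w \<partial>P)"
    by (rule nn_integral_sum) measurable
  also have "\<dots> \<le> (\<Sum>b\<in>UNIV. ennreal lab_const * ((\<integral>\<^sup>+w. of_bool (L w = b) \<partial>P) * (\<integral>\<^sup>+v. B b v \<partial>P)))"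
    unfolding nn_integral_label by (intro sum_mono label_part_le) measurable
  also have "\<dots> = ennreal lab_const * (\<integral>\<^sup>+w. (\<Sum>b\<in>UNIV. of_bool (L w = b) * (\<integral>\<^sup>+v. B b v \<partial>P)) \<partial>P)"
    by (subst nn_integral_sum) (auto simp: nn_integral_multc sum_distrib_left)
  also have "(\<integral>\<^sup>+w. (\<Sum>b\<in>UNIV. of_bool (L w = b) * (\<integral>\<^sup>+v. B b v \<partial>P)) \<partial>P) = (\<integral>\<^sup>+w. (\<integral>\<^sup>+v. B (L w) v \<partial>P) \<partial>P)"
    by (intro nn_integral_cong) (auto simp: UNIV_bool)
  finally show ?thesis .
qed

text \<open>On the event that \<open>i\<close> lies in fold \<open>k\<close> the mask excludes \<open>i\<close>, so the function \<open>h\<close> does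
  not see the observation at which it is evaluated.\<close>
lemma decoupling:
  fixes h :: "(nat \<Rightarrow> bool) \<Rightarrow> (nat \<Rightarrow> 'w) \<Rightarrow> 'w \<Rightarrow> ennreal" and N k i :: nat
  assumes h_meas: "(\<lambda>(m, d, w). h m d w) \<in> borel_measurable (DM \<Otimes>\<^sub>M DS \<Otimes>\<^sub>M S)"
    and h_oof: "\<And>m d d'. (\<forall>i. m i \<longrightarrow> d i = d' i) \<Longrightarrow> h m d = h m d'"
  defines "I \<equiv> \<lambda>d u. of_bool (fld N d u i = k)" and "mk \<equiv> \<lambda>d u. oof_mask N (fld N d u) k"
  shows "(\<integral>\<^sup>+x. I (sample x) (U x) * h (mk (sample x) (U x)) (sample x) (W i x) \<partial>M)
    \<le> ennreal lab_const * (\<integral>\<^sup>+x. I (sample x) (U x) * (\<integral>\<^sup>+w. h (mk (sample x) (U x)) (sample x) w \<partial>P) \<partial>M)"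
proof -
  note [measurable] = measurable_app3[OF h_meas]
  define \<Phi> where "\<Phi> d u v = I d u * h (mk d u) d v" for d u v
  \<comment> \<open>This is the integrand after observation \<open>i\<close> has received label
    \<open>b\<close>, evaluated at \<open>v\<close>. The data argument may stay the original one,
    since \<open>h\<close> ignores coordinate \<open>i\<close> whenever the indicator is
    nonzero.\<close>
  define B where "B x b v = of_bool (fldb N i b (sample x) (U x) i = k) *
    h (oof_mask N (fldb N i b (sample x) (U x)) k) (sample x) v" for x b v
  have upd: "B x (L w) v = \<Phi> ((sample x)(i := w)) (U x) v" for x w v
  proof (cases "fldb N i (L w) (sample x) (U x) i = k")
    case True
    then have "h (oof_mask N (fldb N i (L w) (sample x) (U x)) k) ((sample x)(i := w))
      = h (oof_mask N (fldb N i (L w) (sample x) (U x)) k) (sample x)"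
      by (intro h_oof) (auto simp: oof_mask_def)
    then show ?thesis using True by (simp add: B_def \<Phi>_def I_def mk_def fld_upd)
  qed (simp add: B_def \<Phi>_def I_def fld_upd)
  have \<Phi> [measurable]: "(\<lambda>z. \<Phi> (d z) (u z) (v z)) \<in> borel_measurable Q"
    if [measurable]: "d \<in> measurable Q DS" "u \<in> measurable Q MU" "v \<in> measurable Q S" for Q :: "'q measure" and d u v
    unfolding \<Phi>_def I_def mk_def by measurable
  have "(\<integral>\<^sup>+x. \<Phi> (sample x) (U x) (W i x) \<partial>M) = (\<integral>\<^sup>+x. (\<integral>\<^sup>+w. B x (L w) w \<partial>P) \<partial>M)"
    using resample_nn_integral[of "\<lambda>(d, u). \<Phi> d u (d i)" i] by (simp add: upd sample_apply)
  also have "\<dots> \<le> (\<integral>\<^sup>+x. ennreal lab_const * (\<integral>\<^sup>+w. (\<integral>\<^sup>+v. B x (L w) v \<partial>P) \<partial>P) \<partial>M)"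
  proof (intro nn_integral_mono label_decoupling)
    fix x b assume "x \<in> space M"
    then have "(\<lambda>v. sample x) \<in> measurable S DS" "(\<lambda>v. U x) \<in> measurable S MU"
      using measurable_space[OF sample_meas] measurable_space[OF U_meas] by auto
    then show "B x b \<in> borel_measurable S" unfolding B_def[abs_def] by measurable
  qed
  also have "\<dots> = ennreal lab_const * (\<integral>\<^sup>+x. (\<integral>\<^sup>+w. (\<integral>\<^sup>+v. B x (L w) v \<partial>P) \<partial>P) \<partial>M)"
    unfolding upd by (rule nn_integral_cmult) measurable
  \<comment> \<open>The redrawing is now undone: \<open>w\<close> is absorbed back into the sample,
    while the fresh \<open>v\<close> remains.\<close>
  also have "(\<integral>\<^sup>+x. (\<integral>\<^sup>+w. (\<integral>\<^sup>+v. B x (L w) v \<partial>P) \<partial>P) \<partial>M) = (\<integral>\<^sup>+x. (\<integral>\<^sup>+v. \<Phi> (sample x) (U x) v \<partial>P) \<partial>M)"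
    using resample_nn_integral[of "\<lambda>(d, u). \<integral>\<^sup>+v. \<Phi> d u v \<partial>P" i] by (simp add: upd)
  finally have le: "(\<integral>\<^sup>+x. \<Phi> (sample x) (U x) (W i x) \<partial>M)
    \<le> ennreal lab_const * (\<integral>\<^sup>+x. (\<integral>\<^sup>+v. \<Phi> (sample x) (U x) v \<partial>P) \<partial>M)" .
  have "(\<integral>\<^sup>+v. \<Phi> d u v \<partial>P) = I d u * (\<integral>\<^sup>+v. h (mk d u) d v \<partial>P)" for d u
    by (cases "fld N d u i = k") (simp_all add: \<Phi>_def I_def)
  from le[unfolded this] show ?thesis unfolding \<Phi>_def .
qed

text \<open>With the cross terms gone, the second moment grows linearly in \<open>N\<close> instead
  of quadratically. Square integrability makes all products integrable, so \<open>orth\<close> may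
  take that as a premise.\<close>

lemma orthogonal_sum:
  fixes v :: "nat \<Rightarrow> 'b \<Rightarrow> real"
  assumes [measurable]: "\<And>i. v i \<in> borel_measurable M"
    and sq: "\<And>i. integrable M (\<lambda>x. (v i x)\<^sup>2)" and le: "\<And>i. (\<integral>x. (v i x)\<^sup>2 \<partial>M) \<le> B"
    and orth: "\<And>i j. i \<noteq> j \<Longrightarrow> integrable M (\<lambda>x. v i x * v j x) \<Longrightarrow> (\<integral>x. v i x * v j x \<partial>M) = 0"
  shows "(\<integral>\<^sup>+x. ennreal ((\<Sum>i<N. v i x)\<^sup>2) \<partial>M) \<le> ennreal (real N * B)"
proof -
  have int: "integrable M (\<lambda>x. v i x * v j x)" for i j
  proof (rule Bochner_Integration.integrable_bound)
    show "integrable M (\<lambda>x. (v i x)\<^sup>2 + (v j x)\<^sup>2)" using sq by simp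
    have "\<bar>a * b\<bar> \<le> a\<^sup>2 + b\<^sup>2" for a b :: real
    proof -
      have "2 * (\<bar>a\<bar> * \<bar>b\<bar>) \<le> a\<^sup>2 + b\<^sup>2" using sum_squares_bound[of "\<bar>a\<bar>" "\<bar>b\<bar>"] by simp
      moreover have "0 \<le> \<bar>a\<bar> * \<bar>b\<bar>" by simp
      ultimately show ?thesis unfolding abs_mult by linarith
    qed
    then show "AE x in M. norm (v i x * v j x) \<le> norm ((v i x)\<^sup>2 + (v j x)\<^sup>2)" by simp
  qed simp
  have eq: "(\<Sum>i<N. v i x)\<^sup>2 = (\<Sum>i<N. \<Sum>j<N. v i x * v j x)" for x
    by (simp add: power2_eq_square sum_product)
  have int2: "integrable M (\<lambda>x. (\<Sum>i<N. v i x)\<^sup>2)" unfolding eq using int by auto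
  have "(\<integral>x. (\<Sum>i<N. v i x)\<^sup>2 \<partial>M) = (\<Sum>i<N. \<Sum>j<N. (\<integral>x. v i x * v j x \<partial>M))"
    unfolding eq using int by (simp add: Bochner_Integration.integral_sum)
  also have "\<dots> = (\<Sum>i<N. \<Sum>j<N. if i = j then (\<integral>x. (v i x)\<^sup>2 \<partial>M) else 0)"
    using orth int by (intro sum.cong refl) (auto simp: power2_eq_square)
  also have "\<dots> = (\<Sum>i<N. (\<integral>x. (v i x)\<^sup>2 \<partial>M))" by simp
  also have "\<dots> \<le> real N * B" using sum_mono[of "{..<N}" "\<lambda>i. (\<integral>x. (v i x)\<^sup>2 \<partial>M)" "\<lambda>_. B"] le by simp
  finally show ?thesis
    using int2 by (subst nn_integral_eq_integral) (auto intro: ennreal_leI)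
qed

text \<open>When observation \<open>i\<close> is redrawn, the fold indicators and the other factor
  of a cross term react only to its label. For each label they form a constant in front of the
  integral of \<open>g\<close> over that label, which is 0. Overall mean zero would not suffice,
  because membership is correlated with the label.\<close>

lemma fold_sum_second_moment:
  fixes g :: "'w \<Rightarrow> real"
  assumes [measurable]: "g \<in> borel_measurable S" and sq: "integrable P (\<lambda>w. (g w)\<^sup>2)"
    and centred: "\<And>b. (\<integral>w. of_bool (L w = b) * g w \<partial>P) = 0"
  shows "(\<integral>\<^sup>+x. ennreal ((\<Sum>i\<in>fold_set N k (sample x) (U x). g (W i x))\<^sup>2) \<partial>M)
    \<le> ennreal (real N * (\<integral>w. (g w)\<^sup>2 \<partial>P))"
proof -
  let ?a = "\<lambda>i x. of_bool (fld N (sample x) (U x) i = k) :: real"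
  define v where "v i x = ?a i x * g (W i x)" for i x
  have eq: "(\<Sum>i\<in>fold_set N k (sample x) (U x). g (W i x)) = (\<Sum>i<N. v i x)" for x
    by (simp add: fold_set_sum v_def)
  have vm [measurable]: "v i \<in> borel_measurable M" for i unfolding v_def by measurable
  have sqW: "integrable M (\<lambda>x. (g (W i x))\<^sup>2)" for i using integrable_W[OF sq] .
  have vle: "(v i x)\<^sup>2 \<le> (g (W i x))\<^sup>2" for i x by (simp add: v_def)
  have vsq: "integrable M (\<lambda>x. (v i x)\<^sup>2)" for i
    by (rule Bochner_Integration.integrable_bound[OF sqW[of i]]) (auto simp: vle)
  show ?thesis unfolding eq
  proof (rule orthogonal_sum)
    show "(\<integral>x. (v i x)\<^sup>2 \<partial>M) \<le> (\<integral>w. (g w)\<^sup>2 \<partial>P)" for i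
      unfolding integral_W[of "\<lambda>w. (g w)\<^sup>2" i, symmetric, simplified]
      by (intro integral_mono vsq sqW vle)
    fix i j :: nat assume ij: "i \<noteq> j" and int: "integrable M (\<lambda>x. v i x * v j x)"
    let ?G = "\<lambda>(d, u). of_bool (fld N d u i = k) * g (d i) * (of_bool (fld N d u j = k) * g (d j))"
    have "(\<integral>x. v i x * v j x \<partial>M) = (\<integral>x. ?G (sample x, U x) \<partial>M)"
      by (simp add: v_def sample_apply)
    also have "\<dots> = (\<integral>x. (\<integral>w. ?G ((sample x)(i := w), U x) \<partial>P) \<partial>M)"
      by (rule resample_integral) (use int in \<open>auto simp: v_def sample_apply\<close>)
    also have "\<dots> = (\<integral>x. 0 \<partial>M)"
    proof (rule Bochner_Integration.integral_cong[OF refl])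
      fix x assume "x \<in> space M"
      define c where "c b = (of_bool (fldb N i b (sample x) (U x) i = k) *
        (of_bool (fldb N i b (sample x) (U x) j = k) * g (W j x)) :: real)" for b
      have gi: "integrable P (\<lambda>w. of_bool (L w = b) * g w)" for b
        by (rule P.integrable_mult_bounded[of _ _ 1, OF P.square_integrable_imp_integrable[OF _ sq]]) auto
      have "(\<integral>w. ?G ((sample x)(i := w), U x) \<partial>P)
        = (\<integral>w. (\<Sum>b\<in>UNIV. c b * (of_bool (L w = b) * g w)) \<partial>P)"
        using ij by (intro Bochner_Integration.integral_cong) (auto simp: fld_upd c_def UNIV_bool sample_apply)
      also have "\<dots> = (\<Sum>b\<in>UNIV. c b * (\<integral>w. of_bool (L w = b) * g w \<partial>P))"
        using gi by (subst Bochner_Integration.integral_sum) auto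
      also have "\<dots> = 0" using centred by simp
      finally show "(\<integral>w. ?G ((sample x)(i := w), U x) \<partial>P) = 0" .
    qed
    finally show "(\<integral>x. v i x * v j x \<partial>M) = 0" by simp
  qed (auto intro: vsq)
qed

lemma label_count_second_moment:
  "(\<integral>\<^sup>+x. ennreal ((real (card {i. i < N \<and> L (W i x)}) - real N * lab True)\<^sup>2) \<partial>M) \<le> ennreal (real N)"
proof -
  define v where "v i x = of_bool (L (W i x)) - lab True" for i x
  have eq: "real (card {i. i < N \<and> L (W i x)}) - real N * lab True = (\<Sum>i<N. v i x)" for x
  proof -
    have "(\<Sum>i<N. of_bool (L (W i x))) = real (card {i. i < N \<and> L (W i x)})"
      by (subst of_bool_def, subst sum.inter_filter[symmetric]) auto
    then show ?thesis by (simp add: v_def sum_subtractf)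
  qed
  have [measurable]: "v i \<in> borel_measurable M" for i unfolding v_def by measurable
  have lab1: "lab True \<le> 1" by (simp add: lab_def)
  have "\<bar>v i x\<bar> \<le> 1" for i x
    using lab1 lab_nonneg[of True] by (cases "L (W i x)") (simp_all add: v_def abs_le_iff)
  then have v1: "(v i x)\<^sup>2 \<le> 1" for i x by (simp add: abs_square_le_1)
  have vsq: "integrable M (\<lambda>x. (v i x)\<^sup>2)" for i
    by (rule Bochner_Integration.integrable_bound[of _ "\<lambda>_. 1::real"]) (auto simp: v1)
  have labint: "(\<integral>w. of_bool (L w) - lab True \<partial>P) = 0"
    using label_integrable[of True] integral_label[of True] by (simp add: P.prob_space)
  have "(\<integral>\<^sup>+x. ennreal ((\<Sum>i<N. v i x)\<^sup>2) \<partial>M) \<le> ennreal (real N * 1)"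
  proof (rule orthogonal_sum)
    show "(\<integral>x. (v i x)\<^sup>2 \<partial>M) \<le> 1" for i
      using integral_mono[OF vsq[of i], of "\<lambda>_. 1"] v1 by (simp add: M.prob_space)
    fix i j :: nat assume ij: "i \<noteq> j" and int: "integrable M (\<lambda>x. v i x * v j x)"
    let ?G = "\<lambda>(d, u). (of_bool (L (d i)) - lab True) * (of_bool (L (d j)) - lab True)"
    have "(\<integral>x. v i x * v j x \<partial>M) = (\<integral>x. ?G (sample x, U x) \<partial>M)"
      by (simp add: v_def sample_apply)
    also have "\<dots> = (\<integral>x. (\<integral>w. ?G ((sample x)(i := w), U x) \<partial>P) \<partial>M)"
      by (rule resample_integral) (use int in \<open>auto simp: v_def sample_apply\<close>)
    also have "\<dots> = 0"
      using ij labint by simp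
    finally show "(\<integral>x. v i x * v j x \<partial>M) = 0" .
  qed (auto intro: vsq)
  then show ?thesis by (simp add: eq)
qed

end

text \<open>Here \<open>n\<close>, \<open>n1\<close> are the size and labelled count of a fold,
  \<open>N\<close>, \<open>N1\<close> those of the sample, \<kappa> the number of folds. The
  roundings 1 and 2 add up to 3, and the bound on \<open>1 / n\<close> turns this into 6 \<kappa> /
  N; in the sampling term \<kappa> cancels.\<close>

lemma fraction_bound:
  fixes n n1 N N1 p \<kappa> :: real
  assumes n: "0 < n" and N: "0 < N" and \<kappa>: "0 < \<kappa>" and le: "1 / n \<le> 2 * \<kappa> / N"
    and p: "0 \<le> p" "p \<le> 1" and s: "\<bar>n - N / \<kappa>\<bar> \<le> 2" "\<bar>n1 - N1 / \<kappa>\<bar> \<le> 1"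
  shows "\<bar>n1 / n - p\<bar> \<le> 6 * \<kappa> / N + \<bar>2 / N * (N1 - N * p)\<bar>"
proof -
  have tri: "\<bar>a + b - c\<bar> \<le> \<bar>a\<bar> + \<bar>b\<bar> + \<bar>c\<bar>" for a b c :: real by linarith
  have "n1 - p * n = (n1 - N1 / \<kappa>) + (N1 - N * p) / \<kappa> - p * (n - N / \<kappa>)"
    by (simp add: algebra_simps diff_divide_distrib)
  then have "\<bar>n1 - p * n\<bar> \<le> \<bar>n1 - N1 / \<kappa>\<bar> + \<bar>(N1 - N * p) / \<kappa>\<bar> + \<bar>p * (n - N / \<kappa>)\<bar>"
    by (simp only: tri)
  moreover have "\<bar>p * (n - N / \<kappa>)\<bar> \<le> 1 * 2"
    unfolding abs_mult by (rule mult_mono) (use p s in simp_all)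
  moreover have "\<bar>(N1 - N * p) / \<kappa>\<bar> = \<bar>N1 - N * p\<bar> / \<kappa>" using \<kappa> by simp
  ultimately have d: "\<bar>n1 - p * n\<bar> \<le> 3 + \<bar>N1 - N * p\<bar> / \<kappa>" using s(2) by linarith
  have "n1 / n - p = 1 / n * (n1 - p * n)" using n by (simp add: field_simps)
  then have "\<bar>n1 / n - p\<bar> = 1 / n * \<bar>n1 - p * n\<bar>" using n by (simp add: abs_mult)
  also have "\<dots> \<le> 2 * \<kappa> / N * (3 + \<bar>N1 - N * p\<bar> / \<kappa>)"
    by (rule mult_mono[OF le d]) (use \<kappa> N in simp_all)
  also have "\<dots> = 6 * \<kappa> / N + \<bar>2 / N\<bar> * \<bar>N1 - N * p\<bar>"
    using \<kappa> N by (simp add: distrib_left)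
  finally show ?thesis by (simp only: abs_mult)
qed

section \<open>Averages of a fixed function over one fold\<close>

context crossfit_sample
begin

definition mask :: "nat \<Rightarrow> nat \<Rightarrow> 'b \<Rightarrow> nat \<Rightarrow> bool" where
  "mask N k x = oof_mask N (fld N (sample x) (U x)) k"

definition in_fold :: "nat \<Rightarrow> nat \<Rightarrow> 'b \<Rightarrow> nat set" where
  "in_fold N k x = fold_set N k (sample x) (U x)"

definition fold_mean :: "nat \<Rightarrow> nat \<Rightarrow> 'b \<Rightarrow> ('w \<Rightarrow> real) \<Rightarrow> real" where
  "fold_mean N k x f = 1 / real (card (in_fold N k x)) * (\<Sum>i\<in>in_fold N k x. f (W i x))"

lemma mask_meas [measurable]: "mask N k \<in> measurable M (DM)"
  unfolding mask_def by measurable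

lemma finite_in_fold [simp]: "finite (in_fold N k x)" by (simp add: in_fold_def)

lemma eventually_large_folds:
  assumes "k < K"
  shows "\<forall>\<^sub>F N in sequentially. \<forall>x. 0 < card (in_fold N k x) \<and> 0 < N \<and> 1 / real (card (in_fold N k x)) \<le> 2 * real K / real N"
  using eventually_ge_at_top[of "4 * K"]
proof eventually_elim
  case (elim N)
  show ?case
  proof (intro allI conjI)
    fix x
    have c: "0 < card (in_fold N k x)" "real N / (2 * real K) \<le> real (card (in_fold N k x))"
      using fold_size_lower[OF assms elim] by (auto simp: in_fold_def)
    show "0 < card (in_fold N k x)" by fact
    show N: "0 < N" using elim K_pos by linarith
    show "1 / real (card (in_fold N k x)) \<le> 2 * real K / real N"
      using c N K_pos by (simp add: field_simps)
  qed
qed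

lemma fold_average_vanishes:
  fixes f0 :: "'w \<Rightarrow> real"
  assumes k: "k < K"
    and f0 [measurable]: "f0 \<in> borel_measurable S" and sq: "integrable P (\<lambda>w. (f0 w)\<^sup>2)"
  shows "vanishes M (\<lambda>N x. fold_mean N k x f0 - (\<integral>w. f0 w \<partial>P))"
proof -
  have int: "integrable P f0"
    using P.square_integrable_imp_integrable[of f0] sq by simp
  have intb: "integrable P (\<lambda>w. of_bool (L w = b) * f0 w)" for b
    by (rule Bochner_Integration.integrable_bound[OF int]) auto
  \<comment> \<open>The conditional mean of \<open>f0\<close> given label \<open>b\<close>, equal to
    0 by division by zero when that label has probability 0; \<open>g\<close> is the remainder,
    centred on each label separately.\<close>
  define m where "m b = (\<integral>w. of_bool (L w = b) * f0 w \<partial>P) / lab b" for b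
  define g where "g w = f0 w - m (L w)" for w
  have mlab: "m b * lab b = (\<integral>w. of_bool (L w = b) * f0 w \<partial>P)" for b
  proof (cases "lab b = 0")
    case True
    then have "AE w in P. (of_bool (L w = b) :: real) = 0"
      using integral_nonneg_eq_0_iff_AE[OF label_integrable[of b]] integral_label[of b] by simp
    then have "(\<integral>w. of_bool (L w = b) * f0 w \<partial>P) = (\<integral>w. 0 \<partial>P)"
      by (intro integral_cong_AE) auto
    then show ?thesis using True by simp
  qed (simp add: m_def)
  have lab_sum: "lab False = 1 - lab True"
  proof -
    have "lab True + lab False = (\<integral>w. of_bool (L w = True) + of_bool (L w = False) \<partial>P)"
      by (subst Bochner_Integration.integral_add) (auto simp only: integral_label label_integrable)
    also have "\<dots> = (\<integral>w. 1 \<partial>P)" by (intro Bochner_Integration.integral_cong) auto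
    finally show ?thesis by (simp add: P.prob_space)
  qed
  have f0_int: "(\<integral>w. f0 w \<partial>P) = m False + (m True - m False) * lab True"
  proof -
    have "(\<integral>w. f0 w \<partial>P) = (\<integral>w. of_bool (L w = True) * f0 w + of_bool (L w = False) * f0 w \<partial>P)"
      by (intro Bochner_Integration.integral_cong) auto
    also have "\<dots> = m True * lab True + m False * lab False"
      using intb by (subst Bochner_Integration.integral_add) (auto simp only: mlab)
    finally show ?thesis unfolding lab_sum by (simp add: algebra_simps)
  qed
  have mm [measurable]: "(\<lambda>w. m (L w)) \<in> borel_measurable S" by measurable
  have [measurable]: "g \<in> borel_measurable S" unfolding g_def by measurable
  have "P.sq_integrable f0" using sq by (simp add: P.sq_integrable_def)
  moreover have "P.sq_integrable (\<lambda>w. m (L w))"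
  proof (rule P.sq_integrable_bounded)
    have "\<bar>m (L w)\<bar> \<le> \<bar>m True\<bar> + \<bar>m False\<bar>" for w by (cases "L w") simp_all
    then show "AE w in P. \<bar>m (L w)\<bar> \<le> \<bar>m True\<bar> + \<bar>m False\<bar>" by simp
  qed measurable
  ultimately have "P.sq_integrable g" unfolding g_def[abs_def] by (rule P.sq_integrable_diff)
  then have gsq: "integrable P (\<lambda>w. (g w)\<^sup>2)" by (simp add: P.sq_integrable_def)
  have gc: "(\<integral>w. of_bool (L w = b) * g w \<partial>P) = 0" for b
  proof -
    have "(\<integral>w. of_bool (L w = b) * g w \<partial>P) = (\<integral>w. of_bool (L w = b) * f0 w - m b * of_bool (L w = b) \<partial>P)"
      by (intro Bochner_Integration.integral_cong) (auto simp: g_def)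
    also have "\<dots> = (\<integral>w. of_bool (L w = b) * f0 w \<partial>P) - m b * lab b"
      using intb[of b] label_integrable[of b] by (simp add: integral_label)
    finally show ?thesis by (simp add: mlab)
  qed
  have Z1: "vanishes M (\<lambda>N x. fold_mean N k x g)"
  proof (rule M.vanishes_mono)
    let ?G = "\<integral>w. (g w)\<^sup>2 \<partial>P"
    \<comment> \<open>The random divisor \<open>card (in_fold N k x)\<close> is replaced by a
      deterministic bound, so that the second moment of the sum can be used.\<close>
    show "vanishes M (\<lambda>N x. 2 * real K / real N * (\<Sum>i\<in>in_fold N k x. g (W i x)))"
    proof (rule M.vanishes_square_integral)
      show "(\<lambda>x. 2 * real K / real N * (\<Sum>i\<in>in_fold N k x. g (W i x))) \<in> borel_measurable M" for N
        unfolding in_fold_def fold_set_sum by measurable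
      show "(\<integral>\<^sup>+x. ennreal ((2 * real K / real N * (\<Sum>i\<in>in_fold N k x. g (W i x)))\<^sup>2) \<partial>M)
        \<le> ennreal (4 * (real K)\<^sup>2 * ?G / real N)" for N
      proof -
        have "(\<integral>\<^sup>+x. ennreal ((2 * real K / real N * (\<Sum>i\<in>in_fold N k x. g (W i x)))\<^sup>2) \<partial>M)
          = (\<integral>\<^sup>+x. ennreal ((2 * real K / real N)\<^sup>2) * ennreal ((\<Sum>i\<in>in_fold N k x. g (W i x))\<^sup>2) \<partial>M)"
          by (intro nn_integral_cong) (simp only: power_mult_distrib ennreal_mult zero_le_power2)
        also have "\<dots> = ennreal ((2 * real K / real N)\<^sup>2) * (\<integral>\<^sup>+x. ennreal ((\<Sum>i\<in>in_fold N k x. g (W i x))\<^sup>2) \<partial>M)"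
          unfolding in_fold_def fold_set_sum by (rule nn_integral_cmult) measurable
        also have "\<dots> \<le> ennreal ((2 * real K / real N)\<^sup>2) * ennreal (real N * ?G)"
          using fold_sum_second_moment[OF _ gsq gc, of N k] unfolding in_fold_def by (intro mult_left_mono) auto
        also have "\<dots> = ennreal (4 * (real K)\<^sup>2 * ?G / real N)"
          by (subst ennreal_mult[symmetric]) (auto simp: power2_eq_square)
        finally show ?thesis .
      qed
      show "(\<lambda>N. 4 * (real K)\<^sup>2 * ?G / real N) \<longlonglongrightarrow> 0"
        by (rule lim_const_over_n)
    qed
    show "\<forall>\<^sub>F N in sequentially. \<forall>x\<in>space M. \<bar>fold_mean N k x g\<bar>
      \<le> \<bar>2 * real K / real N * (\<Sum>i\<in>in_fold N k x. g (W i x))\<bar>"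
      using eventually_large_folds[OF k]
    proof eventually_elim
      case (elim N)
      show ?case
      proof
        fix x
        have "\<bar>1 / real (card (in_fold N k x))\<bar> \<le> \<bar>2 * real K / real N\<bar>" using elim by simp
        then show "\<bar>fold_mean N k x g\<bar>
          \<le> \<bar>2 * real K / real N * (\<Sum>i\<in>in_fold N k x. g (W i x))\<bar>"
          unfolding abs_mult fold_mean_def by (rule mult_right_mono) simp
      qed
    qed
  qed
  let ?n1 = "\<lambda>N x. real (card {i\<in>in_fold N k x. L (W i x)})"
  let ?N1 = "\<lambda>N x. real (card {i. i < N \<and> L (W i x)})"
  have Z2: "vanishes M (\<lambda>N x. ?n1 N x / real (card (in_fold N k x)) - lab True)"
  proof (rule M.vanishes_mono)
    show "vanishes M (\<lambda>N x. 6 * real K / real N + \<bar>2 / real N * (?N1 N x - real N * lab True)\<bar>)"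
    proof (intro M.vanishes_add M.vanishes_const lim_const_over_n)
      show "vanishes M (\<lambda>N x. \<bar>2 / real N * (?N1 N x - real N * lab True)\<bar>)"
      proof (rule M.vanishes_square_integral)
        have N1: "?N1 N x = (\<Sum>i<N. of_bool (L (W i x)))" for N x
          by (subst of_bool_def, subst sum.inter_filter[symmetric]) auto
        show "(\<lambda>x. \<bar>2 / real N * (?N1 N x - real N * lab True)\<bar>) \<in> borel_measurable M" for N
          unfolding N1 by measurable
        show "(\<integral>\<^sup>+x. ennreal (\<bar>2 / real N * (?N1 N x - real N * lab True)\<bar>\<^sup>2) \<partial>M) \<le> ennreal (4 / real N)" for N
        proof -
          have "(\<integral>\<^sup>+x. ennreal (\<bar>2 / real N * (?N1 N x - real N * lab True)\<bar>\<^sup>2) \<partial>M)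
            = (\<integral>\<^sup>+x. ennreal ((2 / real N)\<^sup>2) * ennreal ((?N1 N x - real N * lab True)\<^sup>2) \<partial>M)"
            by (intro nn_integral_cong) (simp only: power2_abs power_mult_distrib ennreal_mult zero_le_power2)
          also have "\<dots> = ennreal ((2 / real N)\<^sup>2) * (\<integral>\<^sup>+x. ennreal ((?N1 N x - real N * lab True)\<^sup>2) \<partial>M)"
            unfolding N1 by (rule nn_integral_cmult) measurable
          also have "\<dots> \<le> ennreal ((2 / real N)\<^sup>2) * ennreal (real N)"
            by (intro mult_left_mono label_count_second_moment) auto
          also have "\<dots> = ennreal (4 / real N)"
            by (subst ennreal_mult[symmetric]) (auto simp: power2_eq_square)
          finally show ?thesis .
        qed
      qed (rule lim_const_over_n)
    qed
    show "\<forall>\<^sub>F N in sequentially. \<forall>x\<in>space M. \<bar>?n1 N x / real (card (in_fold N k x)) - lab True\<bar>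
       \<le> \<bar>6 * real K / real N + \<bar>2 / real N * (?N1 N x - real N * lab True)\<bar>\<bar>"
      using eventually_large_folds[OF k]
    proof eventually_elim
      case (elim N)
      show ?case
      proof
        fix x
        let ?n = "real (card (in_fold N k x))" and ?p = "lab True"
        have n: "0 < ?n" and N: "0 < real N" and le: "1 / ?n \<le> 2 * real K / real N" using elim by auto
        have Kp: "0 < real K" using K_pos by simp
        have "\<bar>?n1 N x / ?n - ?p\<bar> \<le> 6 * real K / real N + \<bar>2 / real N * (?N1 N x - real N * ?p)\<bar>"
          using fold_sizes[OF k, of N "sample x" "U x"]
          by (intro fraction_bound n N Kp le) (simp_all add: in_fold_def sample_apply lab_def)
        then show "\<bar>?n1 N x / ?n - ?p\<bar> \<le> \<bar>6 * real K / real N + \<bar>2 / real N * (?N1 N x - real N * ?p)\<bar>\<bar>"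
          by (rule order_trans[OF _ abs_ge_self])
      qed
    qed
  qed
  have "vanishes M (\<lambda>N x. fold_mean N k x g
      + (m True - m False) * (?n1 N x / real (card (in_fold N k x)) - lab True))"
    by (intro M.vanishes_add M.vanishes_cmult Z1 Z2)
  then show ?thesis
  proof (rule M.vanishes_mono)
    show "\<forall>\<^sub>F N in sequentially. \<forall>x\<in>space M.
      \<bar>fold_mean N k x f0 - (\<integral>w. f0 w \<partial>P)\<bar>
      \<le> \<bar>fold_mean N k x g
        + (m True - m False) * (?n1 N x / real (card (in_fold N k x)) - lab True)\<bar>"
      using eventually_large_folds[OF k]
    proof eventually_elim
      case (elim N)
      show ?case
      proof
        fix x
        let ?n = "real (card (in_fold N k x))"
        have n: "0 < ?n" using elim by auto
        \<comment> \<open>A function of the label is affine in its indicator, so this sum depends on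
          the fold only through its size and labelled count.\<close>
        have "(\<Sum>i\<in>in_fold N k x. m (L (W i x)))
          = (\<Sum>i\<in>in_fold N k x. m False + (m True - m False) * (if L (W i x) then 1 else 0))"
          by (intro sum.cong) auto
        also have "\<dots> = ?n * m False + (m True - m False) * (\<Sum>i\<in>in_fold N k x. if L (W i x) then 1 else 0)"
          by (simp add: sum.distrib sum_distrib_left)
        also have "(\<Sum>i\<in>in_fold N k x. if L (W i x) then 1 else 0) = ?n1 N x"
          by (subst sum.inter_filter[symmetric]) auto
        finally have ms: "(\<Sum>i\<in>in_fold N k x. m (L (W i x))) = ?n * m False + (m True - m False) * ?n1 N x" .
        have "(\<Sum>i\<in>in_fold N k x. f0 (W i x)) = (\<Sum>i\<in>in_fold N k x. g (W i x)) + (\<Sum>i\<in>in_fold N k x. m (L (W i x)))"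
          by (simp add: g_def flip: sum.distrib)
        moreover have rearr: "1 / x * (s + (x * a + b * c)) - (a + b * p) = 1 / x * s + b * (c / x - p)"
          if "0 < x" for a b c s p x :: real
          using that by (simp add: field_simps)
        ultimately have "fold_mean N k x f0 - (\<integral>w. f0 w \<partial>P)
          = fold_mean N k x g + (m True - m False) * (?n1 N x / ?n - lab True)"
          unfolding ms f0_int fold_mean_def by (simp only: rearr[OF n])
        then show "\<bar>fold_mean N k x f0 - (\<integral>w. f0 w \<partial>P)\<bar>
          \<le> \<bar>fold_mean N k x g + (m True - m False) * (?n1 N x / ?n - lab True)\<bar>" by simp
      qed
    qed
  qed
qed

section \<open>The plug-in error on one fold\<close>

context
  fixes fhat :: "nat \<Rightarrow> (nat \<Rightarrow> bool) \<Rightarrow> (nat \<Rightarrow> 'w) \<Rightarrow> 'w \<Rightarrow> real" and f0 :: "'w \<Rightarrow> real" and k :: nat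
  assumes k: "k < K"
    and fhat_meas: "\<And>N. (\<lambda>(m, d, w). fhat N m d w) \<in> borel_measurable (DM \<Otimes>\<^sub>M DS \<Otimes>\<^sub>M S)"
    and fhat_oof: "\<And>N m d d'. (\<forall>i. m i \<longrightarrow> d i = d' i) \<Longrightarrow> fhat N m d = fhat N m d'"
    and f0 [measurable]: "f0 \<in> borel_measurable S"
    and close: "\<And>\<eta> \<gamma>. 0 < \<eta> \<Longrightarrow> 0 < \<gamma> \<Longrightarrow> \<forall>\<^sub>F N in sequentially. whp M \<gamma> (\<lambda>x.
       (\<integral>\<^sup>+w. ennreal \<bar>fhat N (mask N k x) (sample x) w - f0 w\<bar> \<partial>P) \<le> ennreal \<eta>)"
begin

text \<open>Decoupling bounds an expectation, while \<open>close\<close> controls the population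
  error only with high probability. A truncated error with population integral at most \<eta>
  everywhere is decoupled first; it coincides with the true error off the exceptional set.\<close>

lemma plug_in_error_vanishes:
  "vanishes M (\<lambda>N x. fold_mean N k x (\<lambda>w. fhat N (mask N k x) (sample x) w - f0 w))"
proof (rule vanishesI)
  fix e \<gamma> :: real assume pos: "0 < e" "0 < \<gamma>"
  \<comment> \<open>Chosen to make the Markov bound lab_const * \<eta> * 2K / e at most \<gamma> /
    2, the other half of \<gamma> being spent on \<open>close\<close>. The added 1 makes the
    denominator visibly positive.\<close>
  define \<eta> where "\<eta> = e * \<gamma> / (4 * real K * (lab_const + 1))"
  have lc: "0 < lab_const + 1" using lab_const_nonneg by linarith
  have Kp: "0 < real K" using K_pos by simp
  have eta: "0 < \<eta>" unfolding \<eta>_def using pos lc Kp by simp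
  have eta_le: "lab_const * \<eta> * (2 * real K) / e \<le> \<gamma> / 2"
  proof -
    have "x * (e * \<gamma> / (4 * \<kappa> * a)) * (2 * \<kappa>) / e = x / a * (\<gamma> / 2)" if "0 < a" "0 < \<kappa>" for x a \<kappa> :: real
      using pos that by (simp add: field_simps)
    from this[OF lc Kp] have "lab_const * \<eta> * (2 * real K) / e = lab_const / (lab_const + 1) * (\<gamma> / 2)"
      unfolding \<eta>_def .
    also have "\<dots> \<le> 1 * (\<gamma> / 2)"
    proof (rule mult_right_mono)
      show "lab_const / (lab_const + 1) \<le> 1" using lc by (simp only: divide_le_eq_1_pos)
    qed (use pos in simp)
    finally show ?thesis by simp
  qed
  note [measurable] = measurable_app3[OF fhat_meas]
  show "\<forall>\<^sub>F N in sequentially. whp M \<gamma> (\<lambda>x. \<bar>fold_mean N k x (\<lambda>w. fhat N (mask N k x) (sample x) w - f0 w)\<bar> \<le> e)"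
    using eventually_large_folds[OF k] close[OF eta half_gt_zero[OF pos(2)]]
  proof eventually_elim
    case (elim N)
    have N: "0 < N" using elim(1) by blast
    \<comment> \<open>The condition integrates out the point of evaluation and reads the data only
      through \<open>fhat\<close>, so \<open>h\<close> inherits the out-of-fold property.\<close>
    define h where "h m d w = (if (\<integral>\<^sup>+v. ennreal \<bar>fhat N m d v - f0 v\<bar> \<partial>P) \<le> ennreal \<eta>
        then ennreal \<bar>fhat N m d w - f0 w\<bar> else 0)" for m d w
    have hm: "(\<lambda>(m, d, w). h m d w) \<in> borel_measurable (DM \<Otimes>\<^sub>M DS \<Otimes>\<^sub>M S)"
      unfolding h_def by measurable
    note [measurable] = measurable_app3[OF hm]
    have h_oof: "h m d = h m d'" if "\<forall>i. m i \<longrightarrow> d i = d' i" for m d d'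
      unfolding h_def[abs_def] fhat_oof[OF that] ..
    have h_int: "(\<integral>\<^sup>+w. h m d w \<partial>P) \<le> ennreal \<eta>" for m d
      by (cases "(\<integral>\<^sup>+v. ennreal \<bar>fhat N m d v - f0 v\<bar> \<partial>P) \<le> ennreal \<eta>") (simp_all add: h_def)
    let ?F = "\<lambda>x i. of_bool (fld N (sample x) (U x) i = k) :: ennreal"
    let ?h = "\<lambda>x. h (mask N k x) (sample x)"
    let ?Q = "\<lambda>x. \<Sum>i<N. ?F x i * ?h x (W i x)"
    have "(\<integral>\<^sup>+x. ?Q x \<partial>M) = (\<Sum>i<N. \<integral>\<^sup>+x. ?F x i * ?h x (W i x) \<partial>M)"
      by (rule nn_integral_sum) measurable
    also have "\<dots> \<le> (\<Sum>i<N. ennreal lab_const * ennreal \<eta>)"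
    proof (rule sum_mono)
      fix i
      have "(\<integral>\<^sup>+x. ?F x i * ?h x (W i x) \<partial>M)
        \<le> ennreal lab_const * (\<integral>\<^sup>+x. ?F x i * (\<integral>\<^sup>+w. ?h x w \<partial>P) \<partial>M)"
        using decoupling[OF hm h_oof, of N i k] unfolding mask_def by simp
      also have "\<dots> \<le> ennreal lab_const * (\<integral>\<^sup>+x. 1 * ennreal \<eta> \<partial>M)"
        by (intro mult_left_mono nn_integral_mono mult_mono h_int) auto
      finally show "(\<integral>\<^sup>+x. ?F x i * ?h x (W i x) \<partial>M) \<le> ennreal lab_const * ennreal \<eta>"
        by (simp add: M.emeasure_space_1)
    qed
    also have "\<dots> = ennreal (real N * (lab_const * \<eta>))"
      using eta by (simp add: ennreal_mult ennreal_of_nat_eq_real_of_nat)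
    finally have EQ: "(\<integral>\<^sup>+x. ?Q x \<partial>M) \<le> ennreal (real N * (lab_const * \<eta>))" .
    \<comment> \<open>With \<open>1 / n\<close> at most \<open>2 * K / N\<close> for a fold of size
      \<open>n\<close>, a sum \<open>s\<close> with \<open>c * s < 1\<close> has fold mean below
      \<open>e\<close>.\<close>
    define c where "c = 2 * real K / (real N * e)"
    have c: "0 < c" unfolding c_def using Kp N pos by simp
    have "ennreal c * (\<integral>\<^sup>+x. ?Q x \<partial>M) \<le> ennreal c * ennreal (real N * (lab_const * \<eta>))"
      by (intro mult_left_mono EQ) auto
    also have "\<dots> = ennreal (lab_const * \<eta> * (2 * real K) / e)"
      using N c eta unfolding c_def by (simp add: mult_ac flip: ennreal_mult)
    also have "\<dots> \<le> ennreal (\<gamma> / 2)" by (intro ennreal_leI eta_le)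
    finally have le: "ennreal c * (\<integral>\<^sup>+x. ?Q x \<partial>M) \<le> ennreal (\<gamma> / 2)" .
    have "?Q \<in> borel_measurable M" by measurable
    then have "whp M (\<gamma> / 2) (\<lambda>x. ennreal c * ?Q x < 1)"
      by (rule M.whp_Markov[OF _ _ le]) (use c pos in simp_all)
    from M.whp_conj[OF elim(2) this] show ?case
    proof (rule whp_mono)
      fix x assume H: "(\<integral>\<^sup>+w. ennreal \<bar>fhat N (mask N k x) (sample x) w - f0 w\<bar> \<partial>P) \<le> ennreal \<eta>
        \<and> ennreal c * ?Q x < 1"
      let ?D = "\<lambda>w. fhat N (mask N k x) (sample x) w - f0 w"
      let ?s = "\<Sum>i\<in>in_fold N k x. \<bar>?D (W i x)\<bar>"
      have "?h x w = ennreal \<bar>?D w\<bar>" for w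
        using H by (simp add: h_def)
      then have Q: "?Q x = ennreal ?s"
        by (simp add: in_fold_def fold_set_sum flip: sum_ennreal)
      have "ennreal (c * ?s) < 1"
        using H c unfolding Q by (subst ennreal_mult) (auto intro: sum_nonneg)
      then have s: "c * ?s < 1" by (simp only: ennreal_less_one_iff)
      have "\<bar>fold_mean N k x ?D\<bar> \<le> 1 / real (card (in_fold N k x)) * ?s"
        unfolding fold_mean_def abs_mult by (simp add: divide_right_mono)
      also have "\<dots> \<le> 2 * real K / real N * ?s"
        using elim(1) by (intro mult_right_mono sum_nonneg) auto
      also have "\<dots> = e * (c * ?s)"
        unfolding c_def using pos by simp
      also have "\<dots> \<le> e * 1" using s pos by (intro mult_left_mono) auto
      finally show "\<bar>fold_mean N k x ?D\<bar> \<le> e" by simp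
    qed simp
  qed
qed

lemma crossfit_average_vanishes:
  assumes "integrable P (\<lambda>w. (f0 w)\<^sup>2)"
  shows "vanishes M (\<lambda>N x. fold_mean N k x (fhat N (mask N k x) (sample x)) - (\<integral>w. f0 w \<partial>P))"
  using M.vanishes_add[OF plug_in_error_vanishes fold_average_vanishes[OF k f0 assms]]
  by (simp add: fold_mean_def sum_subtractf right_diff_distrib)

end

end

section \<open>Identification and double robustness\<close>

definition armp :: "bool \<Rightarrow> ('x \<Rightarrow> real) \<Rightarrow> 'x \<Rightarrow> real" where
  "armp t e x = (if t then e x else 1 - e x)"

lemma measurable_armp [measurable]: "e \<in> borel_measurable N \<Longrightarrow> armp t e \<in> borel_measurable N"
  unfolding armp_def by simp

text \<open>Behind the indicator of \<open>t' = t\<close> the nuisances are written at the observed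
  arm \<open>t'\<close>, so they are evaluated along \<open>(T, X, S)\<close>, where the assumptions
  speak about them. Only the leading \<open>mu t x\<close> is needed in both arms.\<close>

definition arm :: "bool \<Rightarrow> ('x \<Rightarrow> real) \<Rightarrow> (bool \<Rightarrow> 'x \<Rightarrow> 's \<Rightarrow> real) \<Rightarrow> (bool \<Rightarrow> 'x \<Rightarrow> real)
    \<Rightarrow> (bool \<Rightarrow> 'x \<Rightarrow> 's \<Rightarrow> real) \<Rightarrow> ('x, 's) obs \<Rightarrow> real" where
  "arm t e r mu mut w = (case w of (x, t', s, y, rr) \<Rightarrow>
     mu t x + of_bool (t' = t) / armp t e x *
       (of_bool rr / r t' x s * (y - mut t' x s) + (mut t' x s - mu t' x)))"

lemma score_eq_arms: "score e r mu mut w = arm True e r mu mut w - arm False e r mu mut w"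
proof -
  obtain x t s y rr where w: "w = (x, t, s, y, rr)" by (cases w) auto
  show ?thesis unfolding w score_def arm_def armp_def by (cases t; cases rr) (simp_all add: add_divide_distrib mult.commute)
qed

text \<open>The population side, about a single unit. The moment bound on the outcomes enters as
  square integrability, the essential suprema as almost sure bounds.\<close>

locale surrogate_model = prob_space M for M :: "'a measure" +
  fixes MX :: "'x measure" and MSg :: "'s measure"
    and X :: "'a \<Rightarrow> 'x" and T :: "'a \<Rightarrow> bool" and S0 S1 :: "'a \<Rightarrow> 's"
    and Y0 Y1 :: "'a \<Rightarrow> real" and R :: "'a \<Rightarrow> bool"
    and estar e0 :: "'x \<Rightarrow> real"
    and rstar r0 :: "bool \<Rightarrow> 'x \<Rightarrow> 's \<Rightarrow> real"
    and mustar mu0 :: "bool \<Rightarrow> 'x \<Rightarrow> real"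
    and mutstar mut0 :: "bool \<Rightarrow> 'x \<Rightarrow> 's \<Rightarrow> real"
    and \<epsilon> C :: real
  assumes meas_X [measurable]: "X \<in> measurable M MX" and meas_T [measurable]: "T \<in> measurable M (count_space UNIV)"
    and meas_S0 [measurable]: "S0 \<in> measurable M MSg" and meas_S1 [measurable]: "S1 \<in> measurable M MSg"
    and meas_R [measurable]: "R \<in> measurable M (count_space UNIV)"
    and Y0_sq: "sq_integrable Y0" and Y1_sq: "sq_integrable Y1"
    and A1_unconf: "\<forall>t. cond_indep M (gen_alg M X MX) (space M)
                      (\<lambda>a. (pot t Y0 Y1 a, pot t S0 S1 a)) (borel \<Otimes>\<^sub>M MSg) T (count_space UNIV)"
    and A1_mar: "\<forall>t. cond_indep M
                      (gen_alg M (\<lambda>a. (X a, T a, pot t S0 S1 a)) (MX \<Otimes>\<^sub>M count_space UNIV \<Otimes>\<^sub>M MSg))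
                      {a \<in> space M. T a = t} R (count_space UNIV) (pot t Y0 Y1) borel"
    and meas_estar [measurable]: "estar \<in> borel_measurable MX"
    and meas_rstar: "(\<lambda>(t, x, s). rstar t x s) \<in> borel_measurable (count_space UNIV \<Otimes>\<^sub>M MX \<Otimes>\<^sub>M MSg)"
    and meas_mustar: "(\<lambda>(t, x). mustar t x) \<in> borel_measurable (count_space UNIV \<Otimes>\<^sub>M MX)"
    and meas_mutstar: "(\<lambda>(t, x, s). mutstar t x s) \<in> borel_measurable (count_space UNIV \<Otimes>\<^sub>M MX \<Otimes>\<^sub>M MSg)"
    and def_estar: "AE a in M. estar (X a) = real_cond_exp M (gen_alg M X MX) (\<lambda>a. of_bool (T a)) a"
    and def_rstar: "AE a in M. rstar (T a) (X a) (realised T S0 S1 a) =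
          real_cond_exp M (gen_alg M (\<lambda>a. (T a, X a, realised T S0 S1 a))
                              (count_space UNIV \<Otimes>\<^sub>M MX \<Otimes>\<^sub>M MSg)) (\<lambda>a. of_bool (R a)) a"
    and def_mutstar: "AE a in M. R a \<longrightarrow> mutstar (T a) (X a) (realised T S0 S1 a) =
          real_cond_exp M (gen_alg M (\<lambda>a. (T a, R a, X a, realised T S0 S1 a))
              (count_space UNIV \<Otimes>\<^sub>M count_space UNIV \<Otimes>\<^sub>M MX \<Otimes>\<^sub>M MSg)) (realised T Y0 Y1) a"
    and def_mustar: "AE a in M. mustar (T a) (X a) =
          real_cond_exp M (gen_alg M (\<lambda>a. (T a, X a)) (count_space UNIV \<Otimes>\<^sub>M MX))
              (\<lambda>a. mutstar (T a) (X a) (realised T S0 S1 a)) a"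
    and eps: "0 < \<epsilon>"
    and A2_e: "AE a in M. \<epsilon> \<le> estar (X a) \<and> estar (X a) \<le> 1 - \<epsilon>"
    and A2_r: "AE a in M. \<forall>t. \<epsilon> \<le> rstar t (X a) (pot t S0 S1 a) \<and> rstar t (X a) (pot t S0 S1 a) \<le> 1"
    and meas_e0 [measurable]: "e0 \<in> borel_measurable MX"
    and meas_r0: "(\<lambda>(t, x, s). r0 t x s) \<in> borel_measurable (count_space UNIV \<Otimes>\<^sub>M MX \<Otimes>\<^sub>M MSg)"
    and meas_mu0: "(\<lambda>(t, x). mu0 t x) \<in> borel_measurable (count_space UNIV \<Otimes>\<^sub>M MX)"
    and meas_mut0: "(\<lambda>(t, x, s). mut0 t x s) \<in> borel_measurable (count_space UNIV \<Otimes>\<^sub>M MX \<Otimes>\<^sub>M MSg)"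
    and bd_e0: "AE a in M. \<epsilon> \<le> e0 (X a) \<and> e0 (X a) \<le> 1 - \<epsilon>"
    and bd_r0: "AE a in M. \<epsilon> \<le> r0 (T a) (X a) (realised T S0 S1 a) \<and> r0 (T a) (X a) (realised T S0 S1 a) \<le> 1"
    and dr_1: "AE a in M. (mut0 (T a) (X a) (realised T S0 S1 a) - mutstar (T a) (X a) (realised T S0 S1 a)) *
                          (r0 (T a) (X a) (realised T S0 S1 a) - rstar (T a) (X a) (realised T S0 S1 a)) = 0"
    and dr_2: "AE a in M. (mu0 (T a) (X a) - mustar (T a) (X a)) * (e0 (X a) - estar (X a)) = 0"
    and sup_mut: "AE a in M. \<bar>mut0 (T a) (X a) (realised T S0 S1 a)
                                      - mutstar (T a) (X a) (realised T S0 S1 a)\<bar> \<le> C"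
    and sup_mu: "AE a in M. \<bar>mu0 (T a) (X a) - mustar (T a) (X a)\<bar> \<le> C"
begin

abbreviation "Sr \<equiv> realised T S0 S1"
abbreviation "Yr \<equiv> realised T Y0 Y1"
abbreviation "NTX \<equiv> count_space (UNIV :: bool set) \<Otimes>\<^sub>M MX"
abbreviation "NTXS \<equiv> count_space (UNIV :: bool set) \<Otimes>\<^sub>M MX \<Otimes>\<^sub>M MSg"

lemma Y_meas [measurable]: "Y0 \<in> borel_measurable M" "Y1 \<in> borel_measurable M"
  using Y0_sq Y1_sq by (auto dest: sq_integrable_measurable)

lemma pot_meas [measurable]: "pot t S0 S1 \<in> measurable M MSg" "pot t Y0 Y1 \<in> borel_measurable M"
  by (simp_all add: pot_def)

lemma Sr_meas [measurable]: "Sr \<in> measurable M MSg" "Yr \<in> borel_measurable M"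
  unfolding realised_def[abs_def] by measurable

lemma Sr_pot: "T a = t \<Longrightarrow> Sr a = pot t S0 S1 a" and Yr_pot: "T a = t \<Longrightarrow> Yr a = pot t Y0 Y1 a"
  by (auto simp: realised_def pot_def)

lemma TX_meas: "(\<lambda>a. (T a, X a)) \<in> measurable M NTX" and TXS_meas: "(\<lambda>a. (T a, X a, Sr a)) \<in> measurable M NTXS"
  by measurable

lemmas nuisance_meas [measurable] = measurable_app3[OF meas_rstar] measurable_app3[OF meas_mutstar] measurable_app3[OF meas_r0] measurable_app3[OF meas_mut0]
  measurable_app2[OF meas_mustar] measurable_app2[OF meas_mu0]

lemma rstar_bounds: "AE a in M. \<epsilon> \<le> rstar (T a) (X a) (Sr a) \<and> rstar (T a) (X a) (Sr a) \<le> 1"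
  using A2_r
proof eventually_elim
  case (elim a)
  then show ?case using Sr_pot[of a "T a"] by simp
qed

lemma estar_bounds: "AE a in M. \<forall>t. \<epsilon> \<le> armp t estar (X a) \<and> armp t estar (X a) \<le> 1"
  using A2_e by eventually_elim (use eps in \<open>auto simp: armp_def\<close>)

lemma e0_bounds: "AE a in M. \<forall>t. \<epsilon> \<le> armp t e0 (X a) \<and> armp t e0 (X a) \<le> 1"
  using bd_e0 by eventually_elim (use eps in \<open>auto simp: armp_def\<close>)

lemma of_bool_integrable: "P \<in> measurable M (count_space UNIV) \<Longrightarrow> integrable M (\<lambda>a. of_bool (P a) :: real)"
  by (rule integrable_const_bound[of _ 1]) auto

section \<open>Transfer from one treatment arm to the whole law of the covariates\<close>

lemma propensity: "AE a in M. armp t estar (X a) = real_cond_exp M (gen_alg M X MX) (\<lambda>a. of_bool (T a = t)) a"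
proof (cases t)
  case True
  then show ?thesis using def_estar by (simp add: armp_def)
next
  case False
  interpret G: sigma_finite_subalgebra M "gen_alg M X MX" by (rule sigma_finite_gen_alg) simp
  have 1: "AE a in M. real_cond_exp M (gen_alg M X MX) (\<lambda>a. 1 - of_bool (T a)) a
      = real_cond_exp M (gen_alg M X MX) (\<lambda>_. 1) a - real_cond_exp M (gen_alg M X MX) (\<lambda>a. of_bool (T a)) a"
    by (rule G.real_cond_exp_diff) (auto intro: of_bool_integrable)
  have 2: "AE a in M. real_cond_exp M (gen_alg M X MX) (\<lambda>_. 1) a = 1"
    by (rule G.real_cond_exp_F_meas) auto
  have eq: "(\<lambda>a. of_bool (T a = t)) = (\<lambda>a. 1 - of_bool (T a) :: real)"
    using False by (auto simp: fun_eq_iff)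
  show ?thesis unfolding eq using 1 2 def_estar
    by eventually_elim (simp add: armp_def False)
qed

lemma propensity_nn:
  assumes [measurable]: "h \<in> borel_measurable MX"
  shows "(\<integral>\<^sup>+a. h (X a) * ennreal (armp t estar (X a)) \<partial>M) = (\<integral>\<^sup>+a. h (X a) * of_bool (T a = t) \<partial>M)"
proof -
  have "ennreal (of_bool P) = of_bool P" for P by (cases P) auto
  then show ?thesis
    using cond_exp_gen_alg_nn_intg[OF meas_X measurable_armp[OF meas_estar] assms of_bool_integrable _ propensity[of t]]
    by simp
qed

text \<open>Overlap makes \<open>armp t estar (X a)\<close> over \<epsilon> at least 1, and
  conditionally on the covariates that propensity may be exchanged for the indicator of
  \<open>T a = t\<close>.\<close>

lemma overlap:
  assumes [measurable]: "h \<in> borel_measurable MX"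
  shows "(\<integral>\<^sup>+a. h (X a) \<partial>M) \<le> ennreal (1 / \<epsilon>) * (\<integral>\<^sup>+a. h (X a) * of_bool (T a = t) \<partial>M)"
proof -
  have "(\<integral>\<^sup>+a. h (X a) \<partial>M) \<le> (\<integral>\<^sup>+a. ennreal (1 / \<epsilon>) * (h (X a) * ennreal (armp t estar (X a))) \<partial>M)"
  proof (rule nn_integral_mono_AE)
    show "AE a in M. h (X a) \<le> ennreal (1 / \<epsilon>) * (h (X a) * ennreal (armp t estar (X a)))"
      using estar_bounds
    proof eventually_elim
      case (elim a)
      then have "1 \<le> 1 / \<epsilon> * armp t estar (X a)" using eps by (simp add: field_simps)
      then have "1 \<le> ennreal (1 / \<epsilon> * armp t estar (X a))" by (simp add: ennreal_ge_1)
      then have "1 \<le> ennreal (1 / \<epsilon>) * ennreal (armp t estar (X a))"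
        using elim eps by (subst ennreal_mult[symmetric]) (auto intro: order_trans[of 0 \<epsilon>])
      then have "h (X a) * 1 \<le> h (X a) * (ennreal (1 / \<epsilon>) * ennreal (armp t estar (X a)))"
        by (rule mult_left_mono) simp
      then show ?case by (simp add: mult.left_commute)
    qed
  qed
  also have "\<dots> = ennreal (1 / \<epsilon>) * (\<integral>\<^sup>+a. h (X a) * of_bool (T a = t) \<partial>M)"
    by (subst nn_integral_cmult) (auto simp: propensity_nn)
  finally show ?thesis .
qed

text \<open>The bound for the indicator of failure: a covariate event that is null on one arm is
  null.\<close>

lemma overlap_AE:
  assumes [measurable]: "Measurable.pred MX P" and ae: "AE a in M. T a = t \<longrightarrow> P (X a)"
  shows "AE a in M. P (X a)"
proof -
  have "(\<integral>\<^sup>+a. of_bool (\<not> P (X a)) \<partial>M) \<le> ennreal (1 / \<epsilon>) * (\<integral>\<^sup>+a. of_bool (\<not> P (X a)) * of_bool (T a = t) \<partial>M)"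
    by (rule overlap) simp
  also have "(\<integral>\<^sup>+a. of_bool (\<not> P (X a)) * of_bool (T a = t) \<partial>M) = (\<integral>\<^sup>+a. 0 \<partial>M)"
    by (rule nn_integral_cong_AE) (use ae in eventually_elim, auto)
  finally have "(\<integral>\<^sup>+a. of_bool (\<not> P (X a)) \<partial>M) = 0" by simp
  then have "AE a in M. (of_bool (\<not> P (X a)) :: ennreal) = 0"
    by (subst (asm) nn_integral_0_iff_AE) simp_all
  then show ?thesis by eventually_elim simp
qed

lemma overlap_sq_integrable:
  assumes [measurable]: "h \<in> borel_measurable MX" and sq: "sq_integrable (\<lambda>a. of_bool (T a = t) * h (X a))"
  shows "sq_integrable (\<lambda>a. h (X a))"
proof -
  have "(\<integral>\<^sup>+a. ennreal ((h (X a))\<^sup>2) \<partial>M) \<le> ennreal (1 / \<epsilon>) * (\<integral>\<^sup>+a. ennreal ((h (X a))\<^sup>2) * of_bool (T a = t) \<partial>M)"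
    by (rule overlap) simp
  also have "(\<integral>\<^sup>+a. ennreal ((h (X a))\<^sup>2) * of_bool (T a = t) \<partial>M) = (\<integral>\<^sup>+a. ennreal ((of_bool (T a = t) * h (X a))\<^sup>2) \<partial>M)"
    by (intro nn_integral_cong) auto
  also have "ennreal (1 / \<epsilon>) * \<dots> < \<infinity>"
    using sq by (auto simp: sq_integrable_def integrable_iff_bounded ennreal_mult_less_top)
  finally have "(\<integral>\<^sup>+a. ennreal (norm ((h (X a))\<^sup>2)) \<partial>M) < \<infinity>" by simp
  then have "integrable M (\<lambda>a. (h (X a))\<^sup>2)" by (intro integrableI_bounded) simp_all
  then show ?thesis by (simp add: sq_integrable_def)
qed

lemma sq_integrable_of_bool:
  assumes "sq_integrable f" and [measurable]: "P \<in> measurable M (count_space UNIV)"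
  shows "sq_integrable (\<lambda>a. of_bool (P a) * f a)"
  by (rule sq_integrable_mult_bounded[OF assms(1), of _ 1]) auto

lemma Yr_sq: "sq_integrable Yr"
proof -
  have "Yr = (\<lambda>a. of_bool (T a) * Y1 a + of_bool (\<not> T a) * Y0 a)"
    by (auto simp: realised_def)
  then show ?thesis
    by (simp only:) (intro sq_integrable_add sq_integrable_of_bool Y0_sq Y1_sq; measurable)
qed

lemma labelling_nn:
  assumes "h \<in> borel_measurable NTXS"
  shows "(\<integral>\<^sup>+a. h (T a, X a, Sr a) * ennreal (rstar (T a) (X a) (Sr a)) \<partial>M) = (\<integral>\<^sup>+a. h (T a, X a, Sr a) * of_bool (R a) \<partial>M)"
proof -
  have "ennreal (of_bool P) = of_bool P" for P by (cases P) auto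
  then show ?thesis
    using cond_exp_gen_alg_nn_intg[OF TXS_meas meas_rstar assms of_bool_integrable[OF meas_R]] def_rstar
    by simp
qed

lemma labelling:
  assumes h: "h \<in> borel_measurable NTXS" and int: "integrable M (\<lambda>a. h (T a, X a, Sr a) * of_bool (R a))"
  shows "integrable M (\<lambda>a. h (T a, X a, Sr a) * rstar (T a) (X a) (Sr a))"
    and "(\<integral>a. h (T a, X a, Sr a) * rstar (T a) (X a) (Sr a) \<partial>M) = (\<integral>a. h (T a, X a, Sr a) * of_bool (R a) \<partial>M)"
  using cond_exp_gen_alg_intg[OF TXS_meas meas_rstar h _ _ int] def_rstar by simp_all

section \<open>Second moments of the regressions\<close>

text \<open>Nuisances along the realised unit: the ending \<open>s\<close> marks the true ones, the
  ending \<open>0\<close> the limits of the estimators.\<close>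

definition ts where "ts a = mutstar (T a) (X a) (Sr a)"
definition ms where "ms a = mustar (T a) (X a)"
definition rs where "rs a = rstar (T a) (X a) (Sr a)"
definition t0 where "t0 a = mut0 (T a) (X a) (Sr a)"
definition m0 where "m0 a = mu0 (T a) (X a)"
definition rr0 where "rr0 a = r0 (T a) (X a) (Sr a)"

lemma ts_meas [measurable]: "ts \<in> borel_measurable M" "ms \<in> borel_measurable M" "rs \<in> borel_measurable M"
  "t0 \<in> borel_measurable M" "m0 \<in> borel_measurable M" "rr0 \<in> borel_measurable M"
  unfolding ts_def[abs_def] ms_def[abs_def] rs_def[abs_def] t0_def[abs_def] m0_def[abs_def] rr0_def[abs_def]
  by measurable

lemma R_ts_sq: "sq_integrable (\<lambda>a. of_bool (R a) * ts a)"
proof -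
  let ?f = "\<lambda>a. (T a, R a, X a, Sr a)"
  let ?N = "count_space UNIV \<Otimes>\<^sub>M count_space UNIV \<Otimes>\<^sub>M MX \<Otimes>\<^sub>M MSg"
  have "sq_integrable (real_cond_exp M (gen_alg M ?f ?N) Yr)"
    by (rule sq_integrable_cond_exp[OF subalgebra_gen_alg Yr_sq]) measurable
  then show ?thesis
  proof (rule sq_integrable_bound[where c=1])
    show "AE a in M. \<bar>of_bool (R a) * ts a\<bar> \<le> 1 * \<bar>real_cond_exp M (gen_alg M ?f ?N) Yr a\<bar>"
      using def_mutstar by eventually_elim (auto simp: ts_def)
  qed measurable
qed

text \<open>Among labelled units \<open>ts\<close> is a conditional expectation of the outcome;
  elsewhere its definition says nothing. The labelling probability is at least \<epsilon> given
  \<open>(T, X, S)\<close>, so the full second moment is at most the labelled one over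
  \<epsilon>.\<close>

lemma ts_sq: "sq_integrable ts"
proof -
  let ?g = "\<lambda>z. ennreal ((case z of (t, x, s) \<Rightarrow> mutstar t x s)\<^sup>2)"
  have gm: "?g \<in> borel_measurable NTXS" using meas_mutstar by measurable
  have "(\<integral>\<^sup>+a. ennreal ((ts a)\<^sup>2) \<partial>M) \<le> (\<integral>\<^sup>+a. ennreal (1 / \<epsilon>) * (ennreal ((ts a)\<^sup>2) * ennreal (rs a)) \<partial>M)"
  proof (rule nn_integral_mono_AE)
    show "AE a in M. ennreal ((ts a)\<^sup>2) \<le> ennreal (1 / \<epsilon>) * (ennreal ((ts a)\<^sup>2) * ennreal (rs a))"
      using rstar_bounds
    proof eventually_elim
      case (elim a)
      then have "1 \<le> 1 / \<epsilon> * rs a" using eps by (simp add: field_simps rs_def)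
      then have "(ts a)\<^sup>2 * 1 \<le> (ts a)\<^sup>2 * (1 / \<epsilon> * rs a)" by (rule mult_left_mono) simp
      then have "ennreal ((ts a)\<^sup>2) \<le> ennreal (1 / \<epsilon> * ((ts a)\<^sup>2 * rs a))" by (intro ennreal_leI) (simp add: mult_ac)
      also have "\<dots> = ennreal (1 / \<epsilon>) * (ennreal ((ts a)\<^sup>2) * ennreal (rs a))"
      proof -
        have "0 \<le> rs a" "0 \<le> 1 / \<epsilon>" using elim eps by (simp_all add: rs_def)
        then show ?thesis by (simp only: ennreal_mult mult_nonneg_nonneg zero_le_power2)
      qed
      finally show ?case .
    qed
  qed
  also have "\<dots> = ennreal (1 / \<epsilon>) * (\<integral>\<^sup>+a. ennreal ((ts a)\<^sup>2) * ennreal (rs a) \<partial>M)"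
    by (rule nn_integral_cmult) measurable
  also have "(\<integral>\<^sup>+a. ennreal ((ts a)\<^sup>2) * ennreal (rs a) \<partial>M) = (\<integral>\<^sup>+a. ennreal ((ts a)\<^sup>2) * of_bool (R a) \<partial>M)"
    using labelling_nn[OF gm] by (simp add: ts_def rs_def)
  also have "\<dots> = (\<integral>\<^sup>+a. ennreal ((of_bool (R a) * ts a)\<^sup>2) \<partial>M)"
    by (intro nn_integral_cong) auto
  also have "ennreal (1 / \<epsilon>) * \<dots> < \<infinity>"
    using R_ts_sq by (auto simp: sq_integrable_def integrable_iff_bounded ennreal_mult_less_top)
  finally have "(\<integral>\<^sup>+a. ennreal (norm ((ts a)\<^sup>2)) \<partial>M) < \<infinity>" by simp
  then have "integrable M (\<lambda>a. (ts a)\<^sup>2)" by (intro integrableI_bounded) simp_all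
  then show ?thesis by (simp add: sq_integrable_def)
qed

lemma ms_sq: "sq_integrable ms"
proof -
  have "sq_integrable (real_cond_exp M (gen_alg M (\<lambda>a. (T a, X a)) NTX) ts)"
    by (rule sq_integrable_cond_exp[OF subalgebra_gen_alg[OF TX_meas] ts_sq])
  then show ?thesis
  proof (rule sq_integrable_bound[where c=1])
    show "AE a in M. \<bar>ms a\<bar> \<le> 1 * \<bar>real_cond_exp M (gen_alg M (\<lambda>a. (T a, X a)) NTX) ts a\<bar>"
      using def_mustar unfolding ms_def[abs_def] ts_def[abs_def] by eventually_elim simp
  qed measurable
qed

lemma t0_sq: "sq_integrable t0"
proof -
  have "sq_integrable (\<lambda>a. t0 a - ts a)"
    by (rule sq_integrable_bounded[where B=C]) (use sup_mut in \<open>simp_all add: t0_def ts_def\<close>)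
  from sq_integrable_add[OF this ts_sq] show ?thesis by simp
qed

lemma m0_sq: "sq_integrable m0"
proof -
  have "sq_integrable (\<lambda>a. m0 a - ms a)"
    by (rule sq_integrable_bounded[where B=C]) (use sup_mu in \<open>simp_all add: m0_def ms_def\<close>)
  from sq_integrable_add[OF this ms_sq] show ?thesis by simp
qed

text \<open>Needed at every covariate value, although \<open>mustar t\<close> is specified only for
  units with \<open>T a = t\<close>; overlap bridges the gap.\<close>

lemma mustar_sq: "sq_integrable (\<lambda>a. mustar t (X a))"
proof (rule overlap_sq_integrable[where t=t])
  have "(\<lambda>a. of_bool (T a = t) * mustar t (X a)) = (\<lambda>a. of_bool (T a = t) * ms a)"
    by (rule ext, rename_tac a, case_tac "T a = t") (simp_all add: ms_def)
  then show "sq_integrable (\<lambda>a. of_bool (T a = t) * mustar t (X a))"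
    using sq_integrable_of_bool[OF ms_sq, of "\<lambda>a. T a = t"] by simp
qed simp

lemma mu0_sq: "sq_integrable (\<lambda>a. mu0 t (X a))"
proof (rule overlap_sq_integrable[where t=t])
  have "(\<lambda>a. of_bool (T a = t) * mu0 t (X a)) = (\<lambda>a. of_bool (T a = t) * m0 a)"
    by (rule ext, rename_tac a, case_tac "T a = t") (simp_all add: m0_def)
  then show "sq_integrable (\<lambda>a. of_bool (T a = t) * mu0 t (X a))"
    using sq_integrable_of_bool[OF m0_sq, of "\<lambda>a. T a = t"] by simp
qed simp

text \<open>Inverse-propensity weights: \<open>u\<close> with the limiting propensity occurs in the
  score, \<open>v\<close> with the true one serves identification.\<close>

definition u where "u t a = of_bool (T a = t) / armp t e0 (X a)"
definition v where "v t a = of_bool (T a = t) / armp t estar (X a)"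

lemma uv_meas [measurable]: "u t \<in> borel_measurable M" "v t \<in> borel_measurable M"
  unfolding u_def[abs_def] v_def[abs_def] by measurable

lemma inverse_bound: "\<epsilon> \<le> x \<Longrightarrow> \<bar>1 / x\<bar> \<le> 1 / \<epsilon>" for x :: real
  using eps by (simp add: frac_le)

lemma u_bound: "AE a in M. \<bar>u t a\<bar> \<le> 1 / \<epsilon>"
  using e0_bounds
proof eventually_elim
  case (elim a)
  then show ?case using inverse_bound[of "armp t e0 (X a)"] eps by (cases "T a = t") (simp_all add: u_def)
qed

lemma v_bound: "AE a in M. 0 \<le> v t a \<and> \<bar>v t a\<bar> \<le> 1 / \<epsilon>"
  using estar_bounds
proof eventually_elim
  case (elim a)
  then have "0 \<le> armp t estar (X a)" using eps by (meson less_imp_le order_trans)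
  then show ?case using elim inverse_bound[of "armp t estar (X a)"] eps
    by (cases "T a = t") (simp_all add: v_def)
qed

lemma rs_inverse_bound: "AE a in M. 0 \<le> 1 / rs a \<and> \<bar>1 / rs a\<bar> \<le> 1 / \<epsilon> \<and> rs a \<noteq> 0"
  using rstar_bounds
proof eventually_elim
  case (elim a)
  then have "\<epsilon> \<le> rs a" by (simp add: rs_def)
  then show ?case using inverse_bound[of "rs a"] eps by auto
qed

lemma rr0_inverse_bound: "AE a in M. \<bar>1 / rr0 a\<bar> \<le> 1 / \<epsilon> \<and> rr0 a \<noteq> 0"
  using bd_r0
proof eventually_elim
  case (elim a)
  then have "\<epsilon> \<le> rr0 a" by (simp add: rr0_def)
  then show ?case using inverse_bound[of "rr0 a"] eps by auto
qed

lemma bounded_integrable: "f \<in> borel_measurable M \<Longrightarrow> AE a in M. \<bar>f a\<bar> \<le> B \<Longrightarrow> integrable M f" for f :: "'a \<Rightarrow> real"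
  by (rule integrable_const_bound[of _ B]) auto

section \<open>Identification of the arm means\<close>

lemma indicator_cond_exp:
  assumes "f \<in> measurable M N" and [measurable]: "P \<in> measurable M (count_space UNIV)"
  shows "AE a in M. real_cond_exp M (gen_alg M f N) (indicator (P -` {b} \<inter> space M)) a
     = real_cond_exp M (gen_alg M f N) (\<lambda>a. of_bool (P a = b)) a"
proof -
  interpret G: sigma_finite_subalgebra M "gen_alg M f N" by (rule sigma_finite_gen_alg[OF assms(1)])
  have [measurable]: "P -` {b} \<inter> space M \<in> sets M" by (rule measurable_sets[OF assms(2)]) simp
  show ?thesis by (rule G.real_cond_exp_cong) (auto simp: indicator_def)
qed

text \<open>The Horvitz-Thompson identity: the inverse propensity times the conditional probability
  of the arm is 1, so the weighted-mean lemma applies with \<open>p\<close> constant.\<close>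

lemma unconfounded: "(\<integral>a. v t a * pot t Y0 Y1 a \<partial>M) = (\<integral>a. pot t Y0 Y1 a \<partial>M)"
proof -
  let ?G = "gen_alg M X MX" and ?Y = "pot t Y0 Y1" and ?J = "T -` {t} \<inter> space M"
  have wb: "AE a in M. \<bar>1 / armp t estar (X a)\<bar> \<le> 1 / \<epsilon> \<and> 0 \<le> 1 / armp t estar (X a) \<and> armp t estar (X a) \<noteq> 0"
    using estar_bounds
  proof eventually_elim
    case (elim a)
    then have "\<epsilon> \<le> armp t estar (X a)" by simp
    then show ?case using inverse_bound[of "armp t estar (X a)"] eps by auto
  qed
  have "(\<integral>a. v t a * ?Y a \<partial>M) = (\<integral>a. 1 / armp t estar (X a) * indicator ?J a * ?Y a \<partial>M)"
    by (intro Bochner_Integration.integral_cong) (auto simp: v_def indicator_def)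
  also have "\<dots> = (\<integral>a. 1 * ?Y a \<partial>M)"
  proof (rule cond_indep_weighted_mean[OF meas_X, where B'=1])
    show "?J \<in> sets M" by (rule measurable_sets[OF meas_T]) simp
    show "(\<lambda>a. 1 / armp t estar (X a)) \<in> borel_measurable ?G"
      by (rule measurable_gen_alg[OF meas_X, of "\<lambda>x. 1 / armp t estar x"]) measurable
    show "AE a in M. \<bar>1 / armp t estar (X a)\<bar> \<le> 1 / \<epsilon>" "AE a in M. 0 \<le> 1 / armp t estar (X a)"
      using wb by (eventually_elim, blast)+
    show "AE a in M. 1 / armp t estar (X a) * real_cond_exp M ?G (indicator ?J) a = 1"
      using propensity[of t] indicator_cond_exp[OF meas_X meas_T, of t] wb by eventually_elim simp
    fix A :: "real set" assume [measurable]: "A \<in> sets borel"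
    \<comment> \<open>Independence is stated for outcome and surrogate jointly; a rectangle with
      full surrogate side extracts the outcome.\<close>
    have P: "(\<lambda>a. (?Y a, pot t S0 S1 a)) -` (A \<times> space MSg) \<inter> space M = ?Y -` A \<inter> space M"
      using measurable_space[OF pot_meas(1)] by auto
    have Q: "(\<lambda>a. (?Y a, pot t S0 S1 a)) -` (A \<times> space MSg) \<inter> T -` {t} \<inter> space M = ?Y -` A \<inter> ?J"
      using measurable_space[OF pot_meas(1)] by auto
    have "A \<times> space MSg \<in> sets (borel \<Otimes>\<^sub>M MSg)" "{t} \<in> sets (count_space UNIV)" by auto
    with A1_unconf[unfolded cond_indep_def] have "AE a in M. a \<in> space M \<longrightarrow>
      real_cond_exp M ?G (indicator ((\<lambda>a. (?Y a, pot t S0 S1 a)) -` (A \<times> space MSg) \<inter> T -` {t} \<inter> space M)) a =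
      real_cond_exp M ?G (indicator ((\<lambda>a. (?Y a, pot t S0 S1 a)) -` (A \<times> space MSg) \<inter> space M)) a *
      real_cond_exp M ?G (indicator ?J) a"
      by blast
    with AE_space show "AE a in M. 1 / armp t estar (X a) \<noteq> 0 \<longrightarrow> real_cond_exp M ?G (indicator (?Y -` A \<inter> ?J)) a =
        real_cond_exp M ?G (indicator (?Y -` A \<inter> space M)) a * real_cond_exp M ?G (indicator ?J) a"
      unfolding P Q by eventually_elim simp
  qed simp_all
  finally show ?thesis by simp
qed

text \<open>On \<open>T = t\<close> the realised surrogate is \<open>S(t)\<close>, so there the two conditioning
  sigma-algebras of Assumption 1 and of the definition of \<open>rstar\<close> can be exchanged.\<close>
lemma labelling_given_potential:
  "AE a in M. T a = t \<longrightarrow> real_cond_exp M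
      (gen_alg M (\<lambda>a. (X a, T a, pot t S0 S1 a)) (MX \<Otimes>\<^sub>M count_space UNIV \<Otimes>\<^sub>M MSg)) (\<lambda>a. of_bool (R a)) a = rs a"
proof -
  let ?f = "\<lambda>a. (X a, T a, pot t S0 S1 a)" and ?N = "MX \<Otimes>\<^sub>M count_space (UNIV :: bool set) \<Otimes>\<^sub>M MSg"
  let ?G = "gen_alg M ?f ?N"
  have fm [measurable]: "?f \<in> measurable M ?N" by measurable
  interpret G: sigma_finite_subalgebra M ?G by (rule sigma_finite_gen_alg[OF fm])
  have fs: "?f \<in> space M \<rightarrow> space ?N" using measurable_space[OF fm] by blast
  let ?b = "\<lambda>a. of_bool (T a = t) :: real"
  have bG: "?b \<in> borel_measurable ?G"
    using measurable_gen_alg[OF fm, of "\<lambda>(x, t', s). of_bool (t' = t) :: real" borel] by simp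
  have rG: "(\<lambda>a. ?b a * rs a) \<in> borel_measurable ?G"
  proof -
    have m: "(\<lambda>z. of_bool (fst (snd z) = t) * rstar t (fst z) (snd (snd z))) \<in> borel_measurable ?N"
      by measurable
    have eq: "(\<lambda>a. ?b a * rs a) = (\<lambda>a. of_bool (fst (snd (?f a)) = t) * rstar t (fst (?f a)) (snd (snd (?f a))))"
      by (rule ext, rename_tac a, case_tac "T a = t") (simp_all add: rs_def Sr_pot)
    show ?thesis unfolding eq by (rule measurable_gen_alg[OF fm m])
  qed
  have brs: "integrable M (\<lambda>a. ?b a * rs a)"
  proof (rule bounded_integrable[of _ 1])
    show "AE a in M. \<bar>?b a * rs a\<bar> \<le> 1"
      using rstar_bounds by eventually_elim (use eps in \<open>auto simp: rs_def abs_le_iff\<close>)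
  qed measurable
  have bR: "integrable M (\<lambda>a. ?b a * of_bool (R a))"
    by (rule bounded_integrable[of _ 1]) auto
  \<comment> \<open>Multiplied by the arm indicator, \<open>rs\<close> becomes measurable with
    respect to the potential-surrogate sigma-algebra; pulling the indicator out afterwards leaves
    the claim on \<open>T a = t\<close>.\<close>
  have "AE a in M. real_cond_exp M ?G (\<lambda>a. ?b a * of_bool (R a)) a = ?b a * rs a"
  proof (rule G.real_cond_exp_charact[OF _ bR brs rG])
    fix A assume "A \<in> sets ?G"
    then obtain B where B [measurable]: "B \<in> sets ?N" and A: "A = ?f -` B \<inter> space M"
      unfolding gen_alg_def sets_vimage_algebra2[OF fs] by blast
    \<comment> \<open>The test event is rewritten in the realised coordinates, in the order
      \<open>(T, X, S)\<close>; the arm indicator is what permits replacing the potential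
      surrogate.\<close>
    define h where "h z = (indicator B (fst (snd z), fst z, snd (snd z)) * of_bool (fst z = t) :: real)" for z
    have hm: "h \<in> borel_measurable NTXS" unfolding h_def[abs_def] by measurable
    have eq: "indicator A a *\<^sub>R (?b a * y) = h (T a, X a, Sr a) * y" if "a \<in> space M" for a y
      using that by (cases "T a = t") (simp_all add: h_def A indicator_def Sr_pot)
    have int: "integrable M (\<lambda>a. h (T a, X a, Sr a) * of_bool (R a))"
      by (rule bounded_integrable[of _ 1]) (use hm in \<open>auto simp: h_def indicator_def\<close>)
    have "(\<integral>a\<in>A. ?b a * of_bool (R a) \<partial>M) = (\<integral>a. h (T a, X a, Sr a) * of_bool (R a) \<partial>M)"
      unfolding set_lebesgue_integral_def by (rule Bochner_Integration.integral_cong[OF refl]) (rule eq)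
    also have "\<dots> = (\<integral>a. h (T a, X a, Sr a) * rs a \<partial>M)"
      unfolding rs_def by (rule labelling(2)[OF hm int, symmetric])
    also have "\<dots> = (\<integral>a\<in>A. ?b a * rs a \<partial>M)"
      unfolding set_lebesgue_integral_def by (rule Bochner_Integration.integral_cong[OF refl]) (rule eq[symmetric])
    finally show "(\<integral>a\<in>A. ?b a * of_bool (R a) \<partial>M) = (\<integral>a\<in>A. ?b a * rs a \<partial>M)" .
  qed
  moreover have "AE a in M. real_cond_exp M ?G (\<lambda>a. ?b a * of_bool (R a)) a = ?b a * real_cond_exp M ?G (\<lambda>a. of_bool (R a)) a"
    by (rule G.real_cond_exp_mult[OF bG _ bR]) simp
  ultimately show ?thesis by eventually_elim auto
qed

lemma quotient_bound:
  assumes "\<bar>x\<bar> \<le> 1 / \<epsilon>" "\<bar>1 / y\<bar> \<le> 1 / \<epsilon>"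
  shows "\<bar>x / y\<bar> \<le> 1 / \<epsilon> * (1 / \<epsilon>)"
proof -
  have "\<bar>x / y\<bar> = \<bar>x\<bar> * \<bar>1 / y\<bar>" by simp
  also have "\<dots> \<le> 1 / \<epsilon> * (1 / \<epsilon>)" by (rule mult_mono[OF assms]) (use eps in simp_all)
  finally show ?thesis .
qed

lemma weight_bound:
  "AE a in M. \<bar>v t a / rs a\<bar> \<le> 1 / \<epsilon> * (1 / \<epsilon>) \<and> 0 \<le> v t a / rs a \<and> v t a / rs a * rs a = v t a"
  using v_bound[of t] rs_inverse_bound
proof eventually_elim
  case (elim a)
  then have "\<bar>v t a / rs a\<bar> \<le> 1 / \<epsilon> * (1 / \<epsilon>)" by (blast intro: quotient_bound)
  then show ?case using elim by simp
qed

text \<open>Inverse labelling weights remove the selection by \<open>R\<close>: the conditional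
  labelling probability cancels \<open>rs\<close>, leaving the weight \<open>v t\<close>.\<close>

lemma missing_at_random:
  "(\<integral>a. v t a / rs a * of_bool (R a) * pot t Y0 Y1 a \<partial>M) = (\<integral>a. v t a * pot t Y0 Y1 a \<partial>M)"
proof -
  let ?f = "\<lambda>a. (X a, T a, pot t S0 S1 a)" and ?N = "MX \<Otimes>\<^sub>M count_space (UNIV :: bool set) \<Otimes>\<^sub>M MSg"
  let ?G = "gen_alg M ?f ?N" and ?Y = "pot t Y0 Y1" and ?J = "R -` {True} \<inter> space M"
  have fm: "?f \<in> measurable M ?N" by measurable
  have "(\<integral>a. v t a / rs a * of_bool (R a) * ?Y a \<partial>M) = (\<integral>a. v t a / rs a * indicator ?J a * ?Y a \<partial>M)"
    by (intro Bochner_Integration.integral_cong) (auto simp: indicator_def)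
  also have "\<dots> = (\<integral>a. v t a * ?Y a \<partial>M)"
  proof (rule cond_indep_weighted_mean[OF fm])
    show "?J \<in> sets M" by (rule measurable_sets[OF meas_R]) simp
    have m: "(\<lambda>z. of_bool (fst (snd z) = t) / armp t estar (fst z) / rstar t (fst z) (snd (snd z))) \<in> borel_measurable ?N"
      "(\<lambda>z. of_bool (fst (snd z) = t) / armp t estar (fst z)) \<in> borel_measurable ?N"
      by measurable
    have eq: "(\<lambda>a. v t a / rs a) = (\<lambda>a. of_bool (fst (snd (?f a)) = t) / armp t estar (fst (?f a)) / rstar t (fst (?f a)) (snd (snd (?f a))))"
      by (rule ext, rename_tac a, case_tac "T a = t") (simp_all add: v_def rs_def Sr_pot)
    show "(\<lambda>a. v t a / rs a) \<in> borel_measurable ?G"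
      unfolding eq by (rule measurable_gen_alg[OF fm m(1)])
    show "(\<lambda>a. v t a) \<in> borel_measurable ?G"
      unfolding v_def using measurable_gen_alg[OF fm m(2)] by simp
    show "AE a in M. \<bar>v t a / rs a\<bar> \<le> 1 / \<epsilon> * (1 / \<epsilon>)" "AE a in M. 0 \<le> v t a / rs a"
      using weight_bound[of t] by (eventually_elim, blast)+
    show "AE a in M. \<bar>v t a\<bar> \<le> 1 / \<epsilon>" "AE a in M. 0 \<le> v t a"
      using v_bound[of t] by (eventually_elim, blast)+
    show "AE a in M. v t a / rs a * real_cond_exp M ?G (indicator ?J) a = v t a"
      using labelling_given_potential[of t] indicator_cond_exp[OF fm meas_R, of True] weight_bound[of t]
    proof eventually_elim
      case (elim a)
      then show ?case by (cases "T a = t") (simp_all add: v_def)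
    qed
    fix A :: "real set" assume A: "A \<in> sets borel"
    have "R -` {True} \<inter> ?Y -` A \<inter> space M = ?Y -` A \<inter> ?J" by blast
    then have "AE a in M. a \<in> {a \<in> space M. T a = t} \<longrightarrow> real_cond_exp M ?G (indicator (?Y -` A \<inter> ?J)) a
      = real_cond_exp M ?G (indicator ?J) a * real_cond_exp M ?G (indicator (?Y -` A \<inter> space M)) a"
      using A1_mar[unfolded cond_indep_def, rule_format, of "{True}" A t] A by simp
    \<comment> \<open>A nonzero weight forces \<open>T a = t\<close>, the event on which the
      conditional independence is assumed.\<close>
    with AE_space show "AE a in M. v t a / rs a \<noteq> 0 \<longrightarrow> real_cond_exp M ?G (indicator (?Y -` A \<inter> ?J)) a =
        real_cond_exp M ?G (indicator (?Y -` A \<inter> space M)) a * real_cond_exp M ?G (indicator ?J) a"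
    proof eventually_elim
      case (elim a)
      then show ?case by (cases "T a = t") (simp_all add: v_def)
    qed
  qed simp
  finally show ?thesis .
qed

text \<open>The factor \<open>R\<close> belongs to the conditioning sigma-algebra and confines the
  identity to labelled units, where \<open>ts\<close> is the conditional expectation.\<close>

lemma outcome_regression:
  assumes h [measurable]: "h \<in> borel_measurable NTXS" and b: "AE a in M. \<bar>h (T a, X a, Sr a)\<bar> \<le> B"
  shows "(\<integral>a. h (T a, X a, Sr a) * of_bool (R a) * Yr a \<partial>M) = (\<integral>a. h (T a, X a, Sr a) * of_bool (R a) * ts a \<partial>M)"
proof -
  let ?f = "\<lambda>a. (T a, R a, X a, Sr a)"
  let ?N = "count_space (UNIV :: bool set) \<Otimes>\<^sub>M count_space (UNIV :: bool set) \<Otimes>\<^sub>M MX \<Otimes>\<^sub>M MSg"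
  let ?G = "gen_alg M ?f ?N"
  have fm [measurable]: "?f \<in> measurable M ?N" by measurable
  interpret G: sigma_finite_subalgebra M ?G by (rule sigma_finite_gen_alg[OF fm])
  let ?h = "\<lambda>a. h (T a, X a, Sr a) * of_bool (R a)"
  have hb: "AE a in M. \<bar>?h a\<bar> \<le> B" using b by eventually_elim (auto intro: order_trans[of 0])
  have hG: "?h \<in> borel_measurable ?G"
    using measurable_gen_alg[OF fm, of "\<lambda>(t, r, x, s). h (t, x, s) * of_bool r" borel] by simp
  have "(\<integral>a. ?h a * Yr a \<partial>M) = (\<integral>a. ?h a * real_cond_exp M ?G Yr a \<partial>M)"
    by (rule G.real_cond_exp_intg(2)[symmetric, OF _ hG])
      (auto intro!: integrable_mult_bounded[OF sq_integrable_integrable[OF Yr_sq] _ hb])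
  also have "\<dots> = (\<integral>a. ?h a * ts a \<partial>M)"
    by (rule integral_cong_AE) (use def_mutstar in \<open>auto simp: ts_def borel_measurable_cond_exp2\<close>)
  finally show ?thesis .
qed

lemma surrogate_regression:
  assumes h [measurable]: "h \<in> borel_measurable NTX" and b: "AE a in M. \<bar>h (T a, X a)\<bar> \<le> B"
  shows "(\<integral>a. h (T a, X a) * ms a \<partial>M) = (\<integral>a. h (T a, X a) * ts a \<partial>M)"
proof -
  have "integrable M (\<lambda>a. h (T a, X a) * ts a)"
    by (rule integrable_mult_bounded[OF sq_integrable_integrable[OF ts_sq] _ b]) measurable
  from cond_exp_gen_alg_intg(2)[OF TX_meas meas_mustar h ts_meas(1) _ this]
  show ?thesis using def_mustar unfolding ms_def ts_def[abs_def] by simp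
qed

lemma propensity_weighting:
  assumes [measurable]: "h \<in> borel_measurable MX" and int: "integrable M (\<lambda>a. h (X a) * of_bool (T a = t))"
  shows "integrable M (\<lambda>a. h (X a) * armp t estar (X a))"
   "(\<integral>a. h (X a) * armp t estar (X a) \<partial>M) = (\<integral>a. h (X a) * of_bool (T a = t) \<partial>M)"
  using cond_exp_gen_alg_intg[OF meas_X measurable_armp[OF meas_estar] assms(1) _ propensity[of t] int] by simp_all

text \<open>From the arm mean with both inverse weights, the outcome becomes \<open>ts\<close> under
  \<open>R\<close>, then \<open>R\<close> averages to \<open>rs\<close> and cancels its weight,
  \<open>ts\<close> averages to \<open>ms\<close>, and the arm indicator averages to the propensity
  and cancels the last weight.\<close>

lemma identification: "(\<integral>a. mustar t (X a) \<partial>M) = (\<integral>a. pot t Y0 Y1 a \<partial>M)"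
proof -
  let ?h = "\<lambda>z. of_bool (fst z = t) / armp t estar (fst (snd z)) / rstar (fst z) (fst (snd z)) (snd (snd z))"
  have hm: "?h \<in> borel_measurable NTXS" by measurable
  have hw: "?h (T a, X a, Sr a) = v t a / rs a" for a by (simp add: v_def rs_def)
  have wb1: "AE a in M. \<bar>v t a / rs a\<bar> \<le> 1 / \<epsilon> * (1 / \<epsilon>)" using weight_bound[of t] by eventually_elim blast
  have "(\<integral>a. pot t Y0 Y1 a \<partial>M) = (\<integral>a. v t a / rs a * of_bool (R a) * pot t Y0 Y1 a \<partial>M)"
    using unconfounded missing_at_random by simp
  also have "\<dots> = (\<integral>a. v t a / rs a * of_bool (R a) * Yr a \<partial>M)"
    by (rule Bochner_Integration.integral_cong[OF refl], rename_tac a, case_tac "T a = t") (simp_all add: Yr_pot v_def)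
  also have "\<dots> = (\<integral>a. v t a / rs a * of_bool (R a) * ts a \<partial>M)"
    using outcome_regression[OF hm, unfolded hw, OF wb1] .
  also have "\<dots> = (\<integral>a. v t a / rs a * ts a * rs a \<partial>M)"
  proof -
    let ?k = "\<lambda>z. ?h z * mutstar (fst z) (fst (snd z)) (snd (snd z))"
    have km: "?k \<in> borel_measurable NTXS" by measurable
    have kw: "?k (T a, X a, Sr a) = v t a / rs a * ts a" for a by (simp add: v_def rs_def ts_def)
    have "integrable M (\<lambda>a. v t a / rs a * ts a)"
      by (rule integrable_mult_bounded[OF sq_integrable_integrable[OF ts_sq] _ wb1]) measurable
    then have "integrable M (\<lambda>a. of_bool (R a) * (v t a / rs a * ts a))"
      by (rule integrable_mult_bounded[where B=1]) auto
    then have "integrable M (\<lambda>a. v t a / rs a * ts a * of_bool (R a))" by (simp add: mult.commute)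
    from labelling(2)[OF km, unfolded kw, OF this] show ?thesis by (simp add: rs_def mult_ac)
  qed
  also have "\<dots> = (\<integral>a. v t a * ts a \<partial>M)"
  proof (rule integral_cong_AE)
    show "AE a in M. v t a / rs a * ts a * rs a = v t a * ts a"
      using rs_inverse_bound by eventually_elim simp
  qed measurable
  also have "\<dots> = (\<integral>a. v t a * ms a \<partial>M)"
    using surrogate_regression[of "\<lambda>z. of_bool (fst z = t) / armp t estar (snd z)" "1 / \<epsilon>"] v_bound[of t]
    by (simp add: v_def eventually_conj_iff)
  also have "\<dots> = (\<integral>a. mustar t (X a) / armp t estar (X a) * of_bool (T a = t) \<partial>M)"
    by (rule Bochner_Integration.integral_cong[OF refl], rename_tac a, case_tac "T a = t") (simp_all add: ms_def v_def)
  also have "\<dots> = (\<integral>a. mustar t (X a) / armp t estar (X a) * armp t estar (X a) \<partial>M)"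
  proof (rule propensity_weighting(2)[symmetric])
    have "integrable M (\<lambda>a. v t a * mustar t (X a))"
      by (rule integrable_mult_bounded[OF sq_integrable_integrable[OF mustar_sq], where B="1/\<epsilon>"])
        (use v_bound[of t] in \<open>simp_all add: eventually_conj_iff\<close>)
    then show "integrable M (\<lambda>a. mustar t (X a) / armp t estar (X a) * of_bool (T a = t))"
      by (simp add: v_def mult.commute)
  qed measurable
  also have "\<dots> = (\<integral>a. mustar t (X a) \<partial>M)"
  proof (rule integral_cong_AE)
    show "AE a in M. mustar t (X a) / armp t estar (X a) * armp t estar (X a) = mustar t (X a)"
      using estar_bounds
    proof eventually_elim
      case (elim a)
      then have "armp t estar (X a) \<noteq> 0" using eps by (metis not_less)
      then show ?case by simp
    qed
  qed measurable
  finally show ?thesis by simp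
qed

section \<open>Moments of the limiting score\<close>

abbreviation "obs \<equiv> obs_of X T S0 S1 Y0 Y1 R"

text \<open>The recorded outcome carries the factor \<open>R\<close>, so its default value 0 for
  unlabelled units may be replaced by the true outcome.\<close>

lemma arm_obs: "arm t e r mu mut (obs a) = mu t (X a) + of_bool (T a = t) / armp t e (X a) *
     (of_bool (R a) / r (T a) (X a) (Sr a) * (Yr a - mut (T a) (X a) (Sr a))
       + (mut (T a) (X a) (Sr a) - mu (T a) (X a)))"
  by (cases "R a") (simp_all add: arm_def obs_of_def)

lemma arm_limit: "arm t e0 r0 mu0 mut0 (obs a) = mu0 t (X a) + u t a *
     (of_bool (R a) / rr0 a * (Yr a - t0 a) + (t0 a - m0 a))"
  unfolding arm_obs u_def rr0_def t0_def m0_def ..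

lemma R_rr0_bound: "AE a in M. \<bar>of_bool (R a) / rr0 a\<bar> \<le> 1 / \<epsilon>"
  using rr0_inverse_bound by eventually_elim (use eps in auto)

lemma arm_limit_sq: "sq_integrable (\<lambda>a. arm t e0 r0 mu0 mut0 (obs a))"
  unfolding arm_limit
  by (intro sq_integrable_add sq_integrable_diff mu0_sq sq_integrable_mult_bounded[OF _ _ u_bound]
    sq_integrable_mult_bounded[OF _ _ R_rr0_bound] Yr_sq t0_sq m0_sq) measurable

lemma score_limit_sq: "sq_integrable (\<lambda>a. score e0 r0 mu0 mut0 (obs a))"
  unfolding score_eq_arms by (intro sq_integrable_diff arm_limit_sq)

text \<open>On \<open>T a = t\<close> this is the assumption along the realised arm; being a
  covariate event, it extends by overlap.\<close>

lemma dr_2_pot: "AE a in M. (mu0 t (X a) - mustar t (X a)) * (armp t e0 (X a) - armp t estar (X a)) = 0"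
proof (rule overlap_AE)
  show "AE a in M. T a = t \<longrightarrow> (mu0 t (X a) - mustar t (X a)) * (armp t e0 (X a) - armp t estar (X a)) = 0"
    using dr_2
  proof eventually_elim
    case (elim a)
    show ?case
    proof
      assume "T a = t"
      with elim have "mu0 t (X a) = mustar t (X a) \<or> e0 (X a) = estar (X a)" by simp
      then show "(mu0 t (X a) - mustar t (X a)) * (armp t e0 (X a) - armp t estar (X a)) = 0"
        by (auto simp: armp_def)
    qed
  qed
qed measurable

text \<open>Inserting \<open>ts\<close> and \<open>ms\<close> leaves two terms that vanish by the
  definition of the regressions (\<open>e1\<close>, \<open>e2\<close>) and two pairs in which a
  regression error meets a weighting error (\<open>e3\<close>, \<open>e4\<close>); in each pair at
  least one error is 0 almost surely.\<close>

lemma arm_limit_integral: "(\<integral>a. arm t e0 r0 mu0 mut0 (obs a) \<partial>M) = (\<integral>a. pot t Y0 Y1 a \<partial>M)"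
proof -
  let ?RR = "\<lambda>a. of_bool (R a) / rr0 a"
  note sqi = sq_integrable_integrable
  note um = integrable_mult_bounded[OF _ _ u_bound]
  note rm = integrable_mult_bounded[OF _ _ R_rr0_bound]
  have urb: "AE a in M. \<bar>u t a / rr0 a\<bar> \<le> 1 / \<epsilon> * (1 / \<epsilon>)"
    using u_bound[of t] rr0_inverse_bound by eventually_elim (blast intro: quotient_bound)
  have i: "integrable M (\<lambda>a. mu0 t (X a))" "integrable M (\<lambda>a. mustar t (X a))"
    "integrable M Yr" "integrable M ts" "integrable M t0" "integrable M ms" "integrable M m0"
    using mu0_sq mustar_sq Yr_sq ts_sq t0_sq ms_sq m0_sq by (auto dest: sqi)
  have i1: "integrable M (\<lambda>a. u t a * (?RR a * Yr a))" "integrable M (\<lambda>a. u t a * (?RR a * ts a))"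
    "integrable M (\<lambda>a. u t a * (?RR a * (ts a - t0 a)))"
    by (intro um rm i Bochner_Integration.integrable_diff; measurable)+
  have i2: "integrable M (\<lambda>a. u t a * ts a)" "integrable M (\<lambda>a. u t a * ms a)"
    "integrable M (\<lambda>a. u t a * (t0 a - ts a))" "integrable M (\<lambda>a. u t a * (ms a - m0 a))"
    by (intro um i Bochner_Integration.integrable_diff; measurable)+
  have e1: "(\<integral>a. u t a * (?RR a * Yr a) \<partial>M) = (\<integral>a. u t a * (?RR a * ts a) \<partial>M)"
  proof -
    let ?h = "\<lambda>z. of_bool (fst z = t) / armp t e0 (fst (snd z)) / r0 (fst z) (fst (snd z)) (snd (snd z))"
    have hm: "?h \<in> borel_measurable NTXS" by measurable
    have hw: "?h (T a, X a, Sr a) = u t a / rr0 a" for a by (simp add: u_def rr0_def)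
    show ?thesis using outcome_regression[OF hm, unfolded hw, OF urb] by (simp add: mult_ac)
  qed
  have e2: "(\<integral>a. u t a * ts a \<partial>M) = (\<integral>a. u t a * ms a \<partial>M)"
    using surrogate_regression[of "\<lambda>z. of_bool (fst z = t) / armp t e0 (snd z)" "1 / \<epsilon>"] u_bound[of t]
    by (simp add: u_def)
  \<comment> \<open>After \<open>R\<close> is averaged to \<open>rs\<close>, either
    \<open>t0\<close> equals \<open>ts\<close> and both integrands vanish, or \<open>rs\<close>
    cancels \<open>rr0\<close> and they are opposite.\<close>
  have e3: "(\<integral>a. u t a * (?RR a * (ts a - t0 a)) \<partial>M) + (\<integral>a. u t a * (t0 a - ts a) \<partial>M) = 0"
  proof -
    let ?k = "\<lambda>z. of_bool (fst z = t) / armp t e0 (fst (snd z)) / r0 (fst z) (fst (snd z)) (snd (snd z))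
       * (mutstar (fst z) (fst (snd z)) (snd (snd z)) - mut0 (fst z) (fst (snd z)) (snd (snd z)))"
    have km: "?k \<in> borel_measurable NTXS" by measurable
    have kw: "?k (T a, X a, Sr a) = u t a / rr0 a * (ts a - t0 a)" for a by (simp add: u_def rr0_def ts_def t0_def)
    have int: "integrable M (\<lambda>a. u t a / rr0 a * (ts a - t0 a) * of_bool (R a))"
      using i1(3) by (simp add: mult_ac)
    have "(\<integral>a. u t a * (?RR a * (ts a - t0 a)) \<partial>M) = (\<integral>a. u t a / rr0 a * (ts a - t0 a) * of_bool (R a) \<partial>M)"
      by (simp add: mult_ac)
    also have "\<dots> = (\<integral>a. u t a / rr0 a * (ts a - t0 a) * rs a \<partial>M)"
      using labelling(2)[OF km, unfolded kw, OF int] by (simp add: rs_def)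
    also have "\<dots> = (\<integral>a. - (u t a * (t0 a - ts a)) \<partial>M)"
    proof (rule integral_cong_AE)
      show "AE a in M. u t a / rr0 a * (ts a - t0 a) * rs a = - (u t a * (t0 a - ts a))"
        using dr_1 rr0_inverse_bound
      proof eventually_elim
        case (elim a)
        then have "t0 a = ts a \<or> rr0 a = rs a" by (simp add: t0_def ts_def rr0_def rs_def)
        then show ?case using elim by (auto simp: algebra_simps)
      qed
    qed measurable
    finally show ?thesis by simp
  qed
  have e4: "(\<integral>a. mu0 t (X a) \<partial>M) + (\<integral>a. u t a * (ms a - m0 a) \<partial>M) = (\<integral>a. mustar t (X a) \<partial>M)"
  proof -
    have "(\<integral>a. u t a * (ms a - m0 a) \<partial>M) = (\<integral>a. (mustar t (X a) - mu0 t (X a)) / armp t e0 (X a) * of_bool (T a = t) \<partial>M)"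
      by (rule Bochner_Integration.integral_cong[OF refl], rename_tac a, case_tac "T a = t") (simp_all add: ms_def m0_def u_def)
    also have "\<dots> = (\<integral>a. (mustar t (X a) - mu0 t (X a)) / armp t e0 (X a) * armp t estar (X a) \<partial>M)"
    proof (rule propensity_weighting(2)[symmetric])
      have "integrable M (\<lambda>a. u t a * (mustar t (X a) - mu0 t (X a)))"
        by (intro um i Bochner_Integration.integrable_diff) measurable
      then show "integrable M (\<lambda>a. (mustar t (X a) - mu0 t (X a)) / armp t e0 (X a) * of_bool (T a = t))"
        by (simp add: u_def mult.commute)
    qed measurable
    also have "\<dots> = (\<integral>a. mustar t (X a) - mu0 t (X a) \<partial>M)"
    proof (rule integral_cong_AE)
      show "AE a in M. (mustar t (X a) - mu0 t (X a)) / armp t e0 (X a) * armp t estar (X a) = mustar t (X a) - mu0 t (X a)"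
        using dr_2_pot[of t] e0_bounds
      proof eventually_elim
        case (elim a)
        then have "armp t e0 (X a) \<noteq> 0" using eps by (metis not_less)
        moreover have "mu0 t (X a) = mustar t (X a) \<or> armp t e0 (X a) = armp t estar (X a)" using elim by simp
        ultimately show ?case by auto
      qed
    qed measurable
    finally show ?thesis using i by simp
  qed
  have "(\<integral>a. arm t e0 r0 mu0 mut0 (obs a) \<partial>M) = (\<integral>a. mu0 t (X a) + (u t a * (?RR a * Yr a) - u t a * (?RR a * ts a))
     + u t a * (?RR a * (ts a - t0 a)) + u t a * (t0 a - ts a) + (u t a * ts a - u t a * ms a) + u t a * (ms a - m0 a) \<partial>M)"
    unfolding arm_limit by (intro Bochner_Integration.integral_cong) (simp_all add: algebra_simps diff_divide_distrib)
  also have "\<dots> = (\<integral>a. mu0 t (X a) \<partial>M) + ((\<integral>a. u t a * (?RR a * Yr a) \<partial>M) - (\<integral>a. u t a * (?RR a * ts a) \<partial>M))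
     + (\<integral>a. u t a * (?RR a * (ts a - t0 a)) \<partial>M) + (\<integral>a. u t a * (t0 a - ts a) \<partial>M)
     + ((\<integral>a. u t a * ts a \<partial>M) - (\<integral>a. u t a * ms a \<partial>M)) + (\<integral>a. u t a * (ms a - m0 a) \<partial>M)"
    using i i1 i2 by (simp only: Bochner_Integration.integral_add Bochner_Integration.integral_diff
       Bochner_Integration.integrable_add Bochner_Integration.integrable_diff)
  also have "\<dots> = (\<integral>a. mustar t (X a) \<partial>M)" using e1 e2 e3 e4 by linarith
  finally show ?thesis using identification by simp
qed

lemma score_limit_integral:
  "(\<integral>a. score e0 r0 mu0 mut0 (obs a) \<partial>M) = (\<integral>a. Y1 a \<partial>M) - (\<integral>a. Y0 a \<partial>M)"
  unfolding score_eq_arms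
  by (subst Bochner_Integration.integral_diff)
    (auto intro: sq_integrable_integrable[OF arm_limit_sq] simp: arm_limit_integral pot_def)

end

section \<open>Perturbation of the score\<close>

lemma abs_inverse_diff:
  fixes a b c :: real
  assumes "0 < c" "c \<le> a" "c \<le> b"
  shows "\<bar>1 / a - 1 / b\<bar> \<le> \<bar>a - b\<bar> / c\<^sup>2"
proof -
  have "0 < a" "0 < b" using assms by linarith+
  then have "1 / a - 1 / b = (b - a) / (a * b)" by (simp add: field_simps)
  then have "\<bar>1 / a - 1 / b\<bar> = \<bar>a - b\<bar> / (a * b)" using \<open>0 < a\<close> \<open>0 < b\<close> by (simp add: abs_mult abs_minus_commute)
  also have "\<dots> \<le> \<bar>a - b\<bar> / c\<^sup>2"
    unfolding power2_eq_square using assms \<open>0 < a\<close> by (intro divide_left_mono mult_mono mult_pos_pos) auto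
  finally show ?thesis .
qed

text \<open>The power \<open>c ^ 4\<close> comes from differences of \<open>1 / (p * r)\<close>,
  whose denominators are at least \<open>c\<^sup>2\<close>; lower powers are absorbed since
  \<open>c\<close> is at most 1. The factor 2 arises because \<open>m - m'\<close> occurs in both
  \<open>?B\<close> and \<open>?E\<close>.\<close>

lemma weighted_residual_diff:
  fixes p p' r r' y m m' n n' b c :: real
  assumes c: "0 < c" "c \<le> 1" and p: "c \<le> p" "p \<le> 1" "c \<le> p'" "p' \<le> 1"
    and r: "c \<le> r" "r \<le> 1" "c \<le> r'" "r' \<le> 1" and b: "0 \<le> b" "b \<le> 1"
  shows "\<bar>1 / p * (b / r * (y - m) + (m - n)) - 1 / p' * (b / r' * (y - m') + (m' - n'))\<bar>
    \<le> 2 / c ^ 4 * ((\<bar>p - p'\<bar> + \<bar>r - r'\<bar>) * (\<bar>y - m'\<bar> + \<bar>m' - n'\<bar>) + \<bar>m - m'\<bar> + \<bar>n - n'\<bar>)"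
proof -
  have pos: "0 < p" "0 < p'" "0 < r" "0 < r'" using c p r by linarith+
  have c24: "1 / c\<^sup>2 \<le> 1 / c ^ 4" "1 / c \<le> 1 / c ^ 4"
    using c power_decreasing[of 2 4 c] power_decreasing[of 1 4 c] by (auto intro!: divide_left_mono)
  have ip: "\<bar>1 / p - 1 / p'\<bar> \<le> \<bar>p - p'\<bar> / c ^ 4"
    using abs_inverse_diff[OF c(1) p(1,3)] mult_left_mono[OF c24(1), of "\<bar>p - p'\<bar>"] by simp
  have ipr: "\<bar>1 / (p * r) - 1 / (p' * r')\<bar> \<le> (\<bar>p - p'\<bar> + \<bar>r - r'\<bar>) / c ^ 4"
  proof -
    have "c * c \<le> p * r" "c * c \<le> p' * r'" using c p r by (auto intro!: mult_mono)
    then have "\<bar>1 / (p * r) - 1 / (p' * r')\<bar> \<le> \<bar>p * r - p' * r'\<bar> / (c * c)\<^sup>2"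
      using c by (intro abs_inverse_diff) auto
    moreover have "(c * c)\<^sup>2 = c ^ 4" by (simp add: power2_eq_square power4_eq_xxxx)
    moreover have "\<bar>p * r - p' * r'\<bar> \<le> \<bar>p - p'\<bar> + \<bar>r - r'\<bar>"
    proof -
      have "p * r - p' * r' = (p - p') * r + p' * (r - r')" by (simp add: algebra_simps)
      then have "\<bar>p * r - p' * r'\<bar> \<le> \<bar>p - p'\<bar> * r + p' * \<bar>r - r'\<bar>"
        using pos abs_triangle_ineq[of "(p - p') * r" "p' * (r - r')"] by (simp add: abs_mult)
      also have "\<dots> \<le> \<bar>p - p'\<bar> * 1 + 1 * \<bar>r - r'\<bar>"
        using p r by (intro add_mono mult_left_mono mult_right_mono) auto
      finally show ?thesis by simp
    qed
    ultimately show ?thesis using c by (auto intro: order_trans[OF _ divide_right_mono])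
  qed
  have pr: "1 / (p * r) \<le> 1 / c ^ 4" "1 / p \<le> 1 / c ^ 4"
  proof -
    have "c * c \<le> p * r" using c p r by (auto intro!: mult_mono)
    then have "1 / (p * r) \<le> 1 / c\<^sup>2" unfolding power2_eq_square using c pos by (intro divide_left_mono) auto
    then show "1 / (p * r) \<le> 1 / c ^ 4" using c24 by linarith
    have "1 / p \<le> 1 / c" using c p by (intro divide_left_mono) auto
    then show "1 / p \<le> 1 / c ^ 4" using c24 by linarith
  qed
  \<comment> \<open>Weight errors multiply residuals at the primed, limiting values only, so no
    product of an unbounded weight error with an estimated regression arises.\<close>
  let ?A = "b * (1 / (p * r) - 1 / (p' * r')) * (y - m')" and ?B = "b * (1 / (p * r)) * (m' - m)"
    and ?D = "(1 / p - 1 / p') * (m' - n')" and ?E = "1 / p * ((m - m') + (n' - n))"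
  have eq: "1 / p * (b / r * (y - m) + (m - n)) - 1 / p' * (b / r' * (y - m') + (m' - n')) = ?A + ?B + ?D + ?E"
    using pos by (simp add: field_simps)
  have A: "\<bar>?A\<bar> \<le> (\<bar>p - p'\<bar> + \<bar>r - r'\<bar>) / c ^ 4 * \<bar>y - m'\<bar>"
  proof -
    have "\<bar>?A\<bar> = b * \<bar>1 / (p * r) - 1 / (p' * r')\<bar> * \<bar>y - m'\<bar>" using b by (simp add: abs_mult)
    also have "\<dots> \<le> 1 * ((\<bar>p - p'\<bar> + \<bar>r - r'\<bar>) / c ^ 4) * \<bar>y - m'\<bar>"
      by (rule mult_right_mono[OF mult_mono[OF b(2) ipr]]) auto
    finally show ?thesis by simp
  qed
  have B: "\<bar>?B\<bar> \<le> 1 / c ^ 4 * \<bar>m - m'\<bar>"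
  proof -
    have "\<bar>?B\<bar> = b * (1 / (p * r)) * \<bar>m - m'\<bar>" using b pos by (simp add: abs_mult abs_minus_commute)
    also have "\<dots> \<le> 1 * (1 / c ^ 4) * \<bar>m - m'\<bar>"
      by (rule mult_right_mono[OF mult_mono[OF b(2) pr(1)]]) (use pos in auto)
    finally show ?thesis by simp
  qed
  have D: "\<bar>?D\<bar> \<le> \<bar>p - p'\<bar> / c ^ 4 * \<bar>m' - n'\<bar>"
    unfolding abs_mult by (rule mult_right_mono[OF ip]) simp
  have E: "\<bar>?E\<bar> \<le> 1 / c ^ 4 * (\<bar>m - m'\<bar> + \<bar>n - n'\<bar>)"
  proof -
    have "\<bar>?E\<bar> = 1 / p * \<bar>(m - m') + (n' - n)\<bar>" using pos by (simp add: abs_mult)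
    also have "\<dots> \<le> 1 / c ^ 4 * (\<bar>m - m'\<bar> + \<bar>n - n'\<bar>)"
      by (rule mult_mono[OF pr(2)]) (use c in auto)
    finally show ?thesis .
  qed
  define k where "k = 1 / c ^ 4"
  define P where "P = \<bar>p - p'\<bar>" define Q where "Q = \<bar>r - r'\<bar>"
  define Y where "Y = \<bar>y - m'\<bar>" define Z where "Z = \<bar>m' - n'\<bar>"
  have nn: "0 \<le> k" "0 \<le> P" "0 \<le> Q" "0 \<le> Y" "0 \<le> Z" using c by (simp_all add: k_def P_def Q_def Y_def Z_def)
  have "\<bar>?A + ?B + ?D + ?E\<bar> \<le> \<bar>?A\<bar> + \<bar>?B\<bar> + \<bar>?D\<bar> + \<bar>?E\<bar>" by linarith
  also have "\<dots> \<le> k * ((P + Q) * Y) + k * \<bar>m - m'\<bar> + k * (P * Z) + k * (\<bar>m - m'\<bar> + \<bar>n - n'\<bar>)"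
    using A B D E unfolding k_def P_def Q_def Y_def Z_def by simp
  also have "\<dots> \<le> 2 * k * ((P + Q) * (Y + Z) + \<bar>m - m'\<bar> + \<bar>n - n'\<bar>)"
  proof -
    have "0 \<le> k * (P * Z)" "0 \<le> k * (Q * Z)" "0 \<le> k * (P * Y)" "0 \<le> k * (Q * Y)" "0 \<le> k * \<bar>n - n'\<bar>"
      using nn by auto
    then show ?thesis by (simp add: algebra_simps)
  qed
  finally show ?thesis unfolding eq k_def P_def Q_def Y_def Z_def by simp
qed

lemma ennreal_le_of_square_le:
  assumes "x\<^sup>2 \<le> ennreal (c\<^sup>2)" "0 \<le> c"
  shows "x \<le> ennreal c"
proof (cases x)
  case (real z)
  then have "ennreal (z\<^sup>2) \<le> ennreal (c\<^sup>2)" using assms by (simp add: ennreal_power)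
  then have "z\<^sup>2 \<le> c\<^sup>2" by (simp add: ennreal_le_iff)
  then have "z \<le> c" using assms(2) by (rule power2_le_imp_le)
  then show ?thesis using real by (simp add: ennreal_leI)
next
  case top
  then show ?thesis using assms by (simp add: power2_eq_square ennreal_top_mult top_unique)
qed

lemma nn_integral_abs_mult_le:
  fixes f g :: "_ \<Rightarrow> real"
  assumes [measurable]: "f \<in> borel_measurable M" "g \<in> borel_measurable M"
    and f: "(\<integral>\<^sup>+a. ennreal ((f a)\<^sup>2) \<partial>M) \<le> ennreal (b\<^sup>2)" and g: "(\<integral>\<^sup>+a. ennreal ((g a)\<^sup>2) \<partial>M) \<le> ennreal (c\<^sup>2)"
    and pos: "0 \<le> b" "0 \<le> c"
  shows "(\<integral>\<^sup>+a. ennreal (\<bar>f a\<bar> * \<bar>g a\<bar>) \<partial>M) \<le> ennreal (b * c)"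
proof (rule ennreal_le_of_square_le)
  have "(\<integral>\<^sup>+a. ennreal (\<bar>f a\<bar> * \<bar>g a\<bar>) \<partial>M)\<^sup>2 = (\<integral>\<^sup>+a. ennreal \<bar>f a\<bar> * ennreal \<bar>g a\<bar> \<partial>M)\<^sup>2"
    by (simp add: ennreal_mult)
  also have "\<dots> \<le> (\<integral>\<^sup>+a. (ennreal \<bar>f a\<bar>)\<^sup>2 \<partial>M) * (\<integral>\<^sup>+a. (ennreal \<bar>g a\<bar>)\<^sup>2 \<partial>M)"
    by (rule Cauchy_Schwarz_nn_integral) simp_all
  also have "\<dots> = (\<integral>\<^sup>+a. ennreal ((f a)\<^sup>2) \<partial>M) * (\<integral>\<^sup>+a. ennreal ((g a)\<^sup>2) \<partial>M)"
    by (simp add: ennreal_power)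
  also have "\<dots> \<le> ennreal (b\<^sup>2) * ennreal (c\<^sup>2)" by (intro mult_mono f g) auto
  also have "\<dots> = ennreal ((b * c)\<^sup>2)" by (simp add: power_mult_distrib ennreal_mult)
  finally show "(\<integral>\<^sup>+a. ennreal (\<bar>f a\<bar> * \<bar>g a\<bar>) \<partial>M)\<^sup>2 \<le> ennreal ((b * c)\<^sup>2)" .
qed (use pos in simp)

lemma abs_powr_2: "\<bar>x\<bar> powr 2 = x\<^sup>2" for x :: real
  by simp

lemma Lp_norm_2_le:
  assumes "Lp_norm M 2 f \<le> ereal \<eta>" "0 \<le> \<eta>"
  shows "(\<integral>\<^sup>+a. ennreal ((f a)\<^sup>2) \<partial>M) \<le> ennreal (\<eta>\<^sup>2)"
proof -
  have i: "integrable M (\<lambda>a. (f a)\<^sup>2)" and le: "(\<integral>a. (f a)\<^sup>2 \<partial>M) powr (1/2) \<le> \<eta>"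
    using assms(1) unfolding Lp_norm_def abs_powr_2 by (auto split: if_splits)
  have nn: "0 \<le> (\<integral>a. (f a)\<^sup>2 \<partial>M)" by simp
  from le have "sqrt (\<integral>a. (f a)\<^sup>2 \<partial>M) \<le> \<eta>" using nn by (simp add: powr_half_sqrt)
  then have "(\<integral>a. (f a)\<^sup>2 \<partial>M) \<le> \<eta>\<^sup>2" using nn by (metis real_sqrt_le_iff real_sqrt_abs abs_of_nonneg assms(2))
  then show ?thesis using i by (subst nn_integral_eq_integral) (auto intro: ennreal_leI)
qed

text \<open>Integrability is finiteness of a nonnegative integral, which is measurable in the
  parameter by Tonelli; so both branches of \<open>Lp_norm\<close> fit together measurably.\<close>

lemma Lp_norm_measurable:
  fixes f :: "'b \<Rightarrow> 'a \<Rightarrow> real"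
  assumes "sigma_finite_measure M" and f: "(\<lambda>(\<omega>, a). f \<omega> a) \<in> borel_measurable (\<Omega> \<Otimes>\<^sub>M M)"
  shows "(\<lambda>\<omega>. Lp_norm M p (f \<omega>)) \<in> borel_measurable \<Omega>"
proof -
  interpret sigma_finite_measure M by fact
  note [measurable] = f
  define I where "I \<omega> = (\<integral>\<^sup>+a. ennreal (\<bar>f \<omega> a\<bar> powr p) \<partial>M)" for \<omega>
  have [measurable]: "I \<in> borel_measurable \<Omega>" unfolding I_def[abs_def] by measurable
  have "(\<lambda>\<omega>. Lp_norm M p (f \<omega>)) \<in> borel_measurable \<Omega>
    \<longleftrightarrow> (\<lambda>\<omega>. if I \<omega> < \<infinity> then ereal (enn2real (I \<omega>) powr (1 / p)) else \<infinity>) \<in> borel_measurable \<Omega>"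
  proof (rule measurable_cong)
    fix \<omega> assume w: "\<omega> \<in> space \<Omega>"
    have m [measurable]: "f \<omega> \<in> borel_measurable M"
      using measurable_Pair2[OF f w] by simp
    have 1: "integrable M (\<lambda>a. \<bar>f \<omega> a\<bar> powr p) \<longleftrightarrow> I \<omega> < \<infinity>"
      unfolding I_def integrable_iff_bounded by simp
    have 2: "(\<integral>a. \<bar>f \<omega> a\<bar> powr p \<partial>M) = enn2real (I \<omega>)"
      unfolding I_def by (rule integral_eq_nn_integral) simp_all
    show "Lp_norm M p (f \<omega>) = (if I \<omega> < \<infinity> then ereal (enn2real (I \<omega>) powr (1 / p)) else \<infinity>)"
      unfolding Lp_norm_def 1 2 ..
  qed
  also have "\<dots>" by measurable
  finally show ?thesis .
qed

text \<open>For fixed \<open>B\<close> the threshold \<open>B * \<bar>\<rho> N\<bar>\<close>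
  eventually falls below \<eta>. Measurability matters: a non-measurable exceptional set has measure
  0 by convention, so its bound would carry no information.\<close>

lemma bigOp_eventually_small:
  assumes op: "bigOp \<Omega> Z \<rho>" and \<rho>: "\<rho> \<longlonglongrightarrow> 0" and [measurable]: "\<And>N. Z N \<in> borel_measurable \<Omega>"
    and pos: "0 < \<eta>" "0 < \<gamma>"
  shows "\<forall>\<^sub>F N in sequentially. whp \<Omega> \<gamma> (\<lambda>\<omega>. Z N \<omega> \<le> ereal \<eta>)"
proof -
  from op pos(2) obtain B N0 where B: "0 < B"
    and N0: "\<And>N. N \<ge> N0 \<Longrightarrow> measure \<Omega> {\<omega>\<in>space \<Omega>. \<bar>Z N \<omega>\<bar> > ereal (B * \<bar>\<rho> N\<bar>)} < \<gamma>"
    unfolding bigOp_def by blast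
  have "0 < \<eta> / B" using pos B by simp
  from tendstoD[OF \<rho> this] eventually_ge_at_top[of N0]
  show ?thesis
  proof eventually_elim
    case (elim N)
    let ?A = "{\<omega>\<in>space \<Omega>. \<bar>Z N \<omega>\<bar> > ereal (B * \<bar>\<rho> N\<bar>)}"
    have le: "B * \<bar>\<rho> N\<bar> \<le> \<eta>" using elim(1) B by (simp add: field_simps)
    have "Z N \<omega> \<le> ereal \<eta>" if "\<omega> \<in> space \<Omega> - ?A" for \<omega>
    proof -
      have "Z N \<omega> \<le> \<bar>Z N \<omega>\<bar>" by (cases "Z N \<omega>") auto
      also have "\<dots> \<le> ereal (B * \<bar>\<rho> N\<bar>)" using that by (auto simp: not_less)
      also have "\<dots> \<le> ereal \<eta>" using le by simp
      finally show ?thesis .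
    qed
    moreover have "?A \<in> sets \<Omega>" by measurable
    moreover have "measure \<Omega> ?A \<le> \<gamma>" using N0[OF elim(2)] by simp
    ultimately show ?case unfolding whp_def by blast
  qed
qed

context surrogate_model
begin

text \<open>The square-integrable factor by which errors of the propensity and of the labelling
  probability are multiplied.\<close>

definition res where "res a = \<bar>Yr a - t0 a\<bar> + \<bar>t0 a - m0 a\<bar>"

lemma res_meas [measurable]: "res \<in> borel_measurable M"
  unfolding res_def[abs_def] by measurable

lemma sq_integrable_abs: "sq_integrable f \<Longrightarrow> sq_integrable (\<lambda>a. \<bar>f a\<bar>)"
  by (auto simp: sq_integrable_def)

lemma res_sq: "sq_integrable res"
  unfolding res_def[abs_def]
  by (intro sq_integrable_add sq_integrable_abs sq_integrable_diff Yr_sq t0_sq m0_sq)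

definition res_norm where "res_norm = sqrt (\<integral>a. (res a)\<^sup>2 \<partial>M)"

text \<open>The first term pays for \<open>mu\<close> in the two arms through overlap. The second is
  2 / \<epsilon> ^ 4 times two errors weighted by \<open>res_norm\<close> and two unweighted
  ones.\<close>

definition pert_const where "pert_const = 2 / \<epsilon> + 4 / \<epsilon> ^ 4 * (res_norm + 1)"

lemma res_norm_nonneg: "0 \<le> res_norm" by (simp add: res_norm_def)

lemma pert_const_pos: "0 < pert_const"
proof -
  have "0 < 2 / \<epsilon>" "0 \<le> 4 / \<epsilon> ^ 4 * (res_norm + 1)" using eps res_norm_nonneg by simp_all
  then show ?thesis unfolding pert_const_def by linarith
qed

lemma res_nn: "(\<integral>\<^sup>+a. ennreal ((res a)\<^sup>2) \<partial>M) \<le> ennreal (res_norm\<^sup>2)"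
proof -
  have "(\<integral>\<^sup>+a. ennreal ((res a)\<^sup>2) \<partial>M) = ennreal (\<integral>a. (res a)\<^sup>2 \<partial>M)"
    using res_sq unfolding sq_integrable_def by (intro nn_integral_eq_integral) auto
  then show ?thesis by (simp add: res_norm_def)
qed

text \<open>Cauchy-Schwarz pairs the propensity and labelling errors with \<open>res\<close>; the
  regression errors enter linearly. Hence the mean absolute error of the score is linear in the
  common bound \<eta> on the root mean squares.\<close>

lemma score_perturbation:
  assumes e [measurable]: "e \<in> borel_measurable MX"
    and r: "(\<lambda>(t, x, s). r t x s) \<in> borel_measurable NTXS"
    and mu: "(\<lambda>(t, x). mu t x) \<in> borel_measurable NTX"
    and mut: "(\<lambda>(t, x, s). mut t x s) \<in> borel_measurable NTXS"
    and be: "AE a in M. \<epsilon> \<le> e (X a) \<and> e (X a) \<le> 1 - \<epsilon>"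
    and br: "AE a in M. \<epsilon> \<le> r (T a) (X a) (Sr a) \<and> r (T a) (X a) (Sr a) \<le> 1"
    and \<eta>: "0 \<le> \<eta>"
    and ne: "Lp_norm M 2 (\<lambda>a. e (X a) - e0 (X a)) \<le> ereal \<eta>"
    and nr: "Lp_norm M 2 (\<lambda>a. r (T a) (X a) (Sr a) - r0 (T a) (X a) (Sr a)) \<le> ereal \<eta>"
    and nmu: "Lp_norm M 2 (\<lambda>a. mu (T a) (X a) - mu0 (T a) (X a)) \<le> ereal \<eta>"
    and nmut: "Lp_norm M 2 (\<lambda>a. mut (T a) (X a) (Sr a) - mut0 (T a) (X a) (Sr a)) \<le> ereal \<eta>"
  shows "(\<integral>\<^sup>+a. ennreal \<bar>score e r mu mut (obs a) - score e0 r0 mu0 mut0 (obs a)\<bar> \<partial>M) \<le> ennreal (pert_const * \<eta>)"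
proof -
  note [measurable] = measurable_app3[OF r] measurable_app3[OF mut] measurable_app2[OF mu]
  define de where "de a = e (X a) - e0 (X a)" for a
  define dr where "dr a = r (T a) (X a) (Sr a) - r0 (T a) (X a) (Sr a)" for a
  define dmu where "dmu a = mu (T a) (X a) - mu0 (T a) (X a)" for a
  define dmut where "dmut a = mut (T a) (X a) (Sr a) - mut0 (T a) (X a) (Sr a)" for a
  define dm where "dm t a = mu t (X a) - mu0 t (X a)" for t a
  have [measurable]: "de \<in> borel_measurable M" "dr \<in> borel_measurable M" "dmu \<in> borel_measurable M"
    "dmut \<in> borel_measurable M" "\<And>t. dm t \<in> borel_measurable M"
    unfolding de_def[abs_def] dr_def[abs_def] dmu_def[abs_def] dmut_def[abs_def] dm_def[abs_def] by measurable
  have n: "(\<integral>\<^sup>+a. ennreal ((de a)\<^sup>2) \<partial>M) \<le> ennreal (\<eta>\<^sup>2)" "(\<integral>\<^sup>+a. ennreal ((dr a)\<^sup>2) \<partial>M) \<le> ennreal (\<eta>\<^sup>2)"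
    "(\<integral>\<^sup>+a. ennreal ((dmu a)\<^sup>2) \<partial>M) \<le> ennreal (\<eta>\<^sup>2)" "(\<integral>\<^sup>+a. ennreal ((dmut a)\<^sup>2) \<partial>M) \<le> ennreal (\<eta>\<^sup>2)"
    unfolding de_def dr_def dmu_def dmut_def using ne nr nmu nmut \<eta> by (auto intro: Lp_norm_2_le)
  have L1: "(\<integral>\<^sup>+a. ennreal \<bar>f a\<bar> \<partial>M) \<le> ennreal \<eta>"
    if [measurable]: "f \<in> borel_measurable M" and "(\<integral>\<^sup>+a. ennreal ((f a)\<^sup>2) \<partial>M) \<le> ennreal (\<eta>\<^sup>2)" for f
    using nn_integral_abs_mult_le[of f M "\<lambda>_. 1" \<eta> 1] that \<eta> by (simp add: emeasure_space_1)
  have V: "(\<integral>\<^sup>+a. ennreal (\<bar>f a\<bar> * \<bar>res a\<bar>) \<partial>M) \<le> ennreal (\<eta> * res_norm)"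
    if [measurable]: "f \<in> borel_measurable M" and "(\<integral>\<^sup>+a. ennreal ((f a)\<^sup>2) \<partial>M) \<le> ennreal (\<eta>\<^sup>2)" for f
    by (rule nn_integral_abs_mult_le[OF _ _ that(2) res_nn]) (use \<eta> res_norm_nonneg in simp_all)
  have dm: "(\<integral>\<^sup>+a. ennreal \<bar>dm t a\<bar> \<partial>M) \<le> ennreal (1 / \<epsilon> * \<eta>)" for t
  proof -
    have "(\<integral>\<^sup>+a. ennreal \<bar>dm t a\<bar> \<partial>M) \<le> ennreal (1 / \<epsilon>) * (\<integral>\<^sup>+a. ennreal \<bar>dm t a\<bar> * of_bool (T a = t) \<partial>M)"
      unfolding dm_def by (rule overlap[of "\<lambda>x. ennreal \<bar>mu t x - mu0 t x\<bar>"]) measurable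
    also have "\<dots> \<le> ennreal (1 / \<epsilon>) * (\<integral>\<^sup>+a. ennreal \<bar>dmu a\<bar> \<partial>M)"
    proof (intro mult_left_mono nn_integral_mono)
      show "ennreal \<bar>dm t a\<bar> * of_bool (T a = t) \<le> ennreal \<bar>dmu a\<bar>" for a
        by (cases "T a = t") (simp_all add: dm_def dmu_def)
    qed simp
    also have "\<dots> \<le> ennreal (1 / \<epsilon>) * ennreal \<eta>" by (intro mult_left_mono L1 n) simp_all
    also have "\<dots> = ennreal (1 / \<epsilon> * \<eta>)" by (rule ennreal_mult[symmetric]) (use eps \<eta> in simp_all)
    finally show ?thesis .
  qed
  define k where "k = 2 / \<epsilon> ^ 4"
  have k: "0 \<le> k" using eps by (simp add: k_def)
  let ?dsc = "\<lambda>a. \<bar>score e r mu mut (obs a) - score e0 r0 mu0 mut0 (obs a)\<bar>"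
  let ?big = "\<lambda>a. (ennreal \<bar>dm True a\<bar> + ennreal \<bar>dm False a\<bar>) + ennreal k * (ennreal (\<bar>de a\<bar> * \<bar>res a\<bar>) + ennreal (\<bar>dr a\<bar> * \<bar>res a\<bar>)
      + ennreal \<bar>dmut a\<bar> + ennreal \<bar>dmu a\<bar>)"
  have point: "AE a in M. ?dsc a
    \<le> \<bar>dm True a\<bar> + \<bar>dm False a\<bar> + k * ((\<bar>de a\<bar> + \<bar>dr a\<bar>) * res a + \<bar>dmut a\<bar> + \<bar>dmu a\<bar>)"
    using be br bd_e0 bd_r0
  proof eventually_elim
    case (elim a)
    let ?W = "\<lambda>t e r mu mut. 1 / armp t e (X a) * (of_bool (R a) / r (T a) (X a) (Sr a) * (Yr a - mut (T a) (X a) (Sr a))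
       + (mut (T a) (X a) (Sr a) - mu (T a) (X a)))"
    have W: "\<bar>?W t e r mu mut - ?W t e0 r0 mu0 mut0\<bar> \<le> k * ((\<bar>de a\<bar> + \<bar>dr a\<bar>) * res a + \<bar>dmut a\<bar> + \<bar>dmu a\<bar>)" for t
    proof -
      have de: "\<bar>armp t e (X a) - armp t e0 (X a)\<bar> = \<bar>de a\<bar>" by (cases t) (auto simp: armp_def de_def)
      have "\<bar>?W t e r mu mut - ?W t e0 r0 mu0 mut0\<bar> \<le> 2 / \<epsilon> ^ 4 *
         ((\<bar>armp t e (X a) - armp t e0 (X a)\<bar> + \<bar>r (T a) (X a) (Sr a) - r0 (T a) (X a) (Sr a)\<bar>) *
          (\<bar>Yr a - mut0 (T a) (X a) (Sr a)\<bar> + \<bar>mut0 (T a) (X a) (Sr a) - mu0 (T a) (X a)\<bar>)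
          + \<bar>mut (T a) (X a) (Sr a) - mut0 (T a) (X a) (Sr a)\<bar> + \<bar>mu (T a) (X a) - mu0 (T a) (X a)\<bar>)"
        by (rule weighted_residual_diff) (use elim eps in \<open>auto simp: armp_def\<close>)
      then show ?thesis unfolding de k_def dr_def dmut_def dmu_def res_def t0_def m0_def .
    qed
    have arm: "arm t e r mu mut (obs a) - arm t e0 r0 mu0 mut0 (obs a)
       = dm t a + of_bool (T a = t) * (?W t e r mu mut - ?W t e0 r0 mu0 mut0)" for t
      unfolding arm_obs dm_def by (cases "T a = t") (simp_all del: of_bool_eq_1_iff)
    let ?w = "\<lambda>t. ?W t e r mu mut - ?W t e0 r0 mu0 mut0"
    have "score e r mu mut (obs a) - score e0 r0 mu0 mut0 (obs a)
       = dm True a + of_bool (T a = True) * ?w True - (dm False a + of_bool (T a = False) * ?w False)"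
      unfolding score_eq_arms using arm[of True] arm[of False] by linarith
    \<comment> \<open>Only the observed arm contributes its weighted residual, so one
      \<open>z\<close> suffices for both.\<close>
    moreover have "\<bar>dm True a + of_bool (T a = True) * x - (dm False a + of_bool (T a = False) * y)\<bar>
       \<le> \<bar>dm True a\<bar> + \<bar>dm False a\<bar> + z" if "\<bar>x\<bar> \<le> z" "\<bar>y\<bar> \<le> z" for x y z :: real
    proof -
      have tri: "\<bar>p + x' - q\<bar> \<le> \<bar>p\<bar> + \<bar>q\<bar> + z" "\<bar>p - (q + x')\<bar> \<le> \<bar>p\<bar> + \<bar>q\<bar> + z" if "\<bar>x'\<bar> \<le> z" for p q x' :: real
        using that by linarith+
      show ?thesis using tri[OF that(1)] tri[OF that(2)] by (cases "T a") simp_all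
    qed
    ultimately show ?case using W[of True] W[of False] by metis
  qed
  have "(\<integral>\<^sup>+a. ennreal (?dsc a) \<partial>M)
    \<le> (\<integral>\<^sup>+a. ?big a \<partial>M)"
  proof (rule nn_integral_mono_AE)
    show "AE a in M. ennreal (?dsc a)
      \<le> ?big a"
      using point
    proof eventually_elim
      case (elim a)
      have r0: "res a = \<bar>res a\<bar>" by (simp add: res_def)
      have "ennreal (?dsc a)
        \<le> ennreal ((\<bar>dm True a\<bar> + \<bar>dm False a\<bar>) + k * (\<bar>de a\<bar> * \<bar>res a\<bar> + \<bar>dr a\<bar> * \<bar>res a\<bar> + \<bar>dmut a\<bar> + \<bar>dmu a\<bar>))"
        using elim r0 by (intro ennreal_leI) (simp add: distrib_right)
      also have "\<dots> = ?big a"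
        using k by (simp only: ennreal_plus ennreal_mult add_nonneg_nonneg mult_nonneg_nonneg abs_ge_zero)
      finally show ?case .
    qed
  qed
  also have "\<dots> = ((\<integral>\<^sup>+a. ennreal \<bar>dm True a\<bar> \<partial>M) + (\<integral>\<^sup>+a. ennreal \<bar>dm False a\<bar> \<partial>M))
      + ennreal k * ((\<integral>\<^sup>+a. ennreal (\<bar>de a\<bar> * \<bar>res a\<bar>) \<partial>M) + (\<integral>\<^sup>+a. ennreal (\<bar>dr a\<bar> * \<bar>res a\<bar>) \<partial>M)
         + (\<integral>\<^sup>+a. ennreal \<bar>dmut a\<bar> \<partial>M) + (\<integral>\<^sup>+a. ennreal \<bar>dmu a\<bar> \<partial>M))"
    by (simp add: nn_integral_add nn_integral_cmult)
  also have "\<dots> \<le> (ennreal (1 / \<epsilon> * \<eta>) + ennreal (1 / \<epsilon> * \<eta>))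
      + ennreal k * (ennreal (\<eta> * res_norm) + ennreal (\<eta> * res_norm) + ennreal \<eta> + ennreal \<eta>)"
    by (intro add_mono mult_left_mono dm V L1 n) simp_all
  also have "\<dots> = ennreal ((1 / \<epsilon> * \<eta> + 1 / \<epsilon> * \<eta>) + k * (\<eta> * res_norm + \<eta> * res_norm + \<eta> + \<eta>))"
  proof -
    have "0 \<le> 1 / \<epsilon> * \<eta>" "0 \<le> \<eta> * res_norm" using eps \<eta> res_norm_nonneg by simp_all
    then show ?thesis using k \<eta> by (simp only: ennreal_plus ennreal_mult add_nonneg_nonneg mult_nonneg_nonneg)
  qed
  also have "(1 / \<epsilon> * \<eta> + 1 / \<epsilon> * \<eta>) + k * (\<eta> * res_norm + \<eta> * res_norm + \<eta> + \<eta>) = pert_const * \<eta>"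
    unfolding pert_const_def k_def by (simp add: algebra_simps)
  finally show ?thesis .
qed

end

section \<open>Assembly: from the data-dependent nuisances to consistency\<close>

text \<open>The parameter \<open>c\<close> will be the pair of mask and sample; joint measurability
  in \<open>c\<close> and the point \<open>w\<close> is what redrawing requires.\<close>

lemma measurable_score:
  fixes e :: "'c \<Rightarrow> 'x \<Rightarrow> real" and r mut :: "'c \<Rightarrow> bool \<Rightarrow> 'x \<Rightarrow> 's \<Rightarrow> real" and mu :: "'c \<Rightarrow> bool \<Rightarrow> 'x \<Rightarrow> real"
  assumes e: "(\<lambda>(c, x). e c x) \<in> borel_measurable (Q \<Otimes>\<^sub>M MX)"
    and r: "(\<lambda>(c, t, x, s). r c t x s) \<in> borel_measurable (Q \<Otimes>\<^sub>M count_space UNIV \<Otimes>\<^sub>M MX \<Otimes>\<^sub>M MSg)"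
    and mu: "(\<lambda>(c, t, x). mu c t x) \<in> borel_measurable (Q \<Otimes>\<^sub>M count_space UNIV \<Otimes>\<^sub>M MX)"
    and mut: "(\<lambda>(c, t, x, s). mut c t x s) \<in> borel_measurable (Q \<Otimes>\<^sub>M count_space UNIV \<Otimes>\<^sub>M MX \<Otimes>\<^sub>M MSg)"
  shows "(\<lambda>(c, w). score (e c) (r c) (mu c) (mut c) w) \<in> borel_measurable (Q \<Otimes>\<^sub>M obs_meas MX MSg)"
proof -
  note [measurable] = measurable_app2[OF e] measurable_app4[OF r] measurable_app4[OF mut] measurable_app3[OF mu]
  show ?thesis
    unfolding score_def obs_meas_def case_prod_beta' by measurable
qed

theorem theorem3:
  fixes M :: "'a measure" and \<Omega> :: "'b measure"
    and MX :: "'x measure" and MSg :: "'s measure" and MU :: "'u measure"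
    and X :: "'a \<Rightarrow> 'x" and T :: "'a \<Rightarrow> bool" and S0 S1 :: "'a \<Rightarrow> 's"
    and Y0 Y1 :: "'a \<Rightarrow> real" and R :: "'a \<Rightarrow> bool"
    and estar e0 :: "'x \<Rightarrow> real"
    and rstar r0 :: "bool \<Rightarrow> 'x \<Rightarrow> 's \<Rightarrow> real"
    and mustar mu0 :: "bool \<Rightarrow> 'x \<Rightarrow> real"
    and mutstar mut0 :: "bool \<Rightarrow> 'x \<Rightarrow> 's \<Rightarrow> real"
    and W :: "nat \<Rightarrow> 'b \<Rightarrow> ('x, 's) obs" and U :: "'b \<Rightarrow> 'u"
    and F :: "nat \<Rightarrow> (nat \<Rightarrow> bool) \<Rightarrow> 'u \<Rightarrow> nat \<Rightarrow> nat"
    and K :: nat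
    and Ge :: "nat \<Rightarrow> nat \<Rightarrow> (nat \<Rightarrow> bool) \<Rightarrow> (nat \<Rightarrow> ('x, 's) obs) \<Rightarrow> 'x \<Rightarrow> real"
    and Gr :: "nat \<Rightarrow> nat \<Rightarrow> (nat \<Rightarrow> bool) \<Rightarrow> (nat \<Rightarrow> ('x, 's) obs) \<Rightarrow> bool \<Rightarrow> 'x \<Rightarrow> 's \<Rightarrow> real"
    and Gmu :: "nat \<Rightarrow> nat \<Rightarrow> (nat \<Rightarrow> bool) \<Rightarrow> (nat \<Rightarrow> ('x, 's) obs) \<Rightarrow> bool \<Rightarrow> 'x \<Rightarrow> real"
    and Gmut :: "nat \<Rightarrow> nat \<Rightarrow> (nat \<Rightarrow> bool) \<Rightarrow> (nat \<Rightarrow> ('x, 's) obs) \<Rightarrow> bool \<Rightarrow> 'x \<Rightarrow> 's \<Rightarrow> real"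
    and rho_e rho_r rho_mu rho_mut :: "nat \<Rightarrow> real"
    and \<epsilon> C q :: real
  assumes M: "prob_space M"
    and meas_X: "X \<in> measurable M MX" and meas_T: "T \<in> measurable M (count_space UNIV)"
    and meas_S0: "S0 \<in> measurable M MSg" and meas_S1: "S1 \<in> measurable M MSg"
    and meas_Y0: "Y0 \<in> borel_measurable M" and meas_Y1: "Y1 \<in> borel_measurable M"
    and meas_R: "R \<in> measurable M (count_space UNIV)"
    \<comment> \<open>Assumption 1\<close>
    and A1_unconf: "\<forall>t. cond_indep M (gen_alg M X MX) (space M)
                      (\<lambda>a. (pot t Y0 Y1 a, pot t S0 S1 a)) (borel \<Otimes>\<^sub>M MSg) T (count_space UNIV)"
    and A1_mar: "\<forall>t. cond_indep M
                      (gen_alg M (\<lambda>a. (X a, T a, pot t S0 S1 a)) (MX \<Otimes>\<^sub>M count_space UNIV \<Otimes>\<^sub>M MSg))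
                      {a \<in> space M. T a = t} R (count_space UNIV) (pot t Y0 Y1) borel"
    \<comment> \<open>true nuisance functions\<close>
    and meas_estar: "estar \<in> borel_measurable MX"
    and meas_rstar: "(\<lambda>(t, x, s). rstar t x s) \<in> borel_measurable (count_space UNIV \<Otimes>\<^sub>M MX \<Otimes>\<^sub>M MSg)"
    and meas_mustar: "(\<lambda>(t, x). mustar t x) \<in> borel_measurable (count_space UNIV \<Otimes>\<^sub>M MX)"
    and meas_mutstar: "(\<lambda>(t, x, s). mutstar t x s) \<in> borel_measurable (count_space UNIV \<Otimes>\<^sub>M MX \<Otimes>\<^sub>M MSg)"
    and def_estar: "AE a in M. estar (X a) = real_cond_exp M (gen_alg M X MX) (\<lambda>a. of_bool (T a)) a"
    and def_rstar: "AE a in M. rstar (T a) (X a) (realised T S0 S1 a) =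
          real_cond_exp M (gen_alg M (\<lambda>a. (T a, X a, realised T S0 S1 a))
                              (count_space UNIV \<Otimes>\<^sub>M MX \<Otimes>\<^sub>M MSg)) (\<lambda>a. of_bool (R a)) a"
    and def_mutstar: "AE a in M. R a \<longrightarrow> mutstar (T a) (X a) (realised T S0 S1 a) =
          real_cond_exp M (gen_alg M (\<lambda>a. (T a, R a, X a, realised T S0 S1 a))
              (count_space UNIV \<Otimes>\<^sub>M count_space UNIV \<Otimes>\<^sub>M MX \<Otimes>\<^sub>M MSg)) (realised T Y0 Y1) a"
    and def_mustar: "AE a in M. mustar (T a) (X a) =
          real_cond_exp M (gen_alg M (\<lambda>a. (T a, X a)) (count_space UNIV \<Otimes>\<^sub>M MX))
              (\<lambda>a. mutstar (T a) (X a) (realised T S0 S1 a)) a"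
    \<comment> \<open>Assumption 2\<close>
    and eps: "0 < \<epsilon>" "\<epsilon> < 1 / 2"
    and A2_e: "AE a in M. \<epsilon> \<le> estar (X a) \<and> estar (X a) \<le> 1 - \<epsilon>"
    and A2_r: "AE a in M. \<forall>t. \<epsilon> \<le> rstar t (X a) (pot t S0 S1 a) \<and> rstar t (X a) (pot t S0 S1 a) \<le> 1"
    \<comment> \<open>Assumption 5\<close>
    and C_pos: "0 < C" and q: "2 < q"
    and A5_1: "esssup M (\<lambda>a. ereal \<bar>cond_var M (gen_alg M (\<lambda>a. (T a, X a, realised T S0 S1 a))
                   (count_space UNIV \<Otimes>\<^sub>M MX \<Otimes>\<^sub>M MSg)) (realised T Y0 Y1) a\<bar>) \<le> ereal C"
    and A5_2: "esssup M (\<lambda>a. ereal \<bar>cond_var M (gen_alg M (\<lambda>a. (T a, X a)) (count_space UNIV \<Otimes>\<^sub>M MX))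
                   (realised T Y0 Y1) a\<bar>) \<le> ereal C"
    and A5_3: "esssup M (\<lambda>a. ereal \<bar>cond_var M (gen_alg M (\<lambda>a. (T a, X a)) (count_space UNIV \<Otimes>\<^sub>M MX))
                   (\<lambda>a. mutstar (T a) (X a) (realised T S0 S1 a)) a\<bar>) \<le> ereal C"
    and A5_Y: "Lp_norm M q Y1 \<le> ereal C" "Lp_norm M q Y0 \<le> ereal C"
    \<comment> \<open>the data: i.i.d. copies of the observation, and an independent randomisation for the folds\<close>
    and Omega: "prob_space \<Omega>"
    and meas_W: "\<forall>i. W i \<in> measurable \<Omega> (obs_meas MX MSg)"
    and meas_U: "U \<in> measurable \<Omega> MU"
    and iid_indep: "prob_space.indep_vars \<Omega> (\<lambda>_. obs_meas MX MSg) W UNIV"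
    and iid_law: "\<forall>i. distr \<Omega> (obs_meas MX MSg) (W i) = distr M (obs_meas MX MSg) (obs_of X T S0 S1 Y0 Y1 R)"
    and U_indep: "prob_space.indep_set \<Omega> (sets (gen_alg \<Omega> U MU))
          (sets (gen_alg \<Omega> (\<lambda>\<omega> i. W i \<omega>) (PiM UNIV (\<lambda>_. obs_meas MX MSg))))"
    \<comment> \<open>the fold rule: labelled and unlabelled indices are each split into K balanced folds\<close>
    and K: "1 \<le> K"
    and F_range: "\<forall>N r u i. i < N \<longrightarrow> F N r u i < K"
    and F_local: "\<forall>N r r' u. (\<forall>i<N. r i = r' i) \<longrightarrow> F N r u = F N r' u"
    and F_meas: "\<forall>N r i. (\<lambda>u. F N r u i) \<in> measurable MU (count_space UNIV)"
    and F_bal_lab: "\<forall>N r u k. k < K \<longrightarrow>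
          card {i. i < N \<and> r i} div K \<le> card {i. i < N \<and> r i \<and> F N r u i = k} \<and>
          card {i. i < N \<and> r i \<and> F N r u i = k} \<le> (card {i. i < N \<and> r i} + K - 1) div K"
    and F_bal_unlab: "\<forall>N r u k. k < K \<longrightarrow>
          card {i. i < N \<and> \<not> r i} div K \<le> card {i. i < N \<and> \<not> r i \<and> F N r u i = k} \<and>
          card {i. i < N \<and> \<not> r i \<and> F N r u i = k} \<le> (card {i. i < N \<and> \<not> r i} + K - 1) div K"
    \<comment> \<open>nuisance estimators: measurable functions of the out-of-fold data only
        (of the labelled out-of-fold data only, for the outcome regressions)\<close>
    and Ge_meas: "\<forall>N k. (\<lambda>(m, d, x). Ge N k m d x) \<in> borel_measurable
          (PiM UNIV (\<lambda>_. count_space UNIV) \<Otimes>\<^sub>M PiM UNIV (\<lambda>_. obs_meas MX MSg) \<Otimes>\<^sub>M MX)"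
    and Gr_meas: "\<forall>N k. (\<lambda>(m, d, t, x, s). Gr N k m d t x s) \<in> borel_measurable
          (PiM UNIV (\<lambda>_. count_space UNIV) \<Otimes>\<^sub>M PiM UNIV (\<lambda>_. obs_meas MX MSg) \<Otimes>\<^sub>M
           count_space UNIV \<Otimes>\<^sub>M MX \<Otimes>\<^sub>M MSg)"
    and Gmu_meas: "\<forall>N k. (\<lambda>(m, d, t, x). Gmu N k m d t x) \<in> borel_measurable
          (PiM UNIV (\<lambda>_. count_space UNIV) \<Otimes>\<^sub>M PiM UNIV (\<lambda>_. obs_meas MX MSg) \<Otimes>\<^sub>M
           count_space UNIV \<Otimes>\<^sub>M MX)"
    and Gmut_meas: "\<forall>N k. (\<lambda>(m, d, t, x, s). Gmut N k m d t x s) \<in> borel_measurable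
          (PiM UNIV (\<lambda>_. count_space UNIV) \<Otimes>\<^sub>M PiM UNIV (\<lambda>_. obs_meas MX MSg) \<Otimes>\<^sub>M
           count_space UNIV \<Otimes>\<^sub>M MX \<Otimes>\<^sub>M MSg)"
    and Ge_oof: "\<forall>N k m d d'. (\<forall>i. m i \<longrightarrow> d i = d' i) \<longrightarrow> Ge N k m d = Ge N k m d'"
    and Gr_oof: "\<forall>N k m d d'. (\<forall>i. m i \<longrightarrow> d i = d' i) \<longrightarrow> Gr N k m d = Gr N k m d'"
    and Gmu_oof: "\<forall>N k m d d'. (\<forall>i. m i \<longrightarrow> obs_R (d i) = obs_R (d' i) \<and> (obs_R (d i) \<longrightarrow> d i = d' i))
          \<longrightarrow> Gmu N k m d = Gmu N k m d'"
    and Gmut_oof: "\<forall>N k m d d'. (\<forall>i. m i \<longrightarrow> obs_R (d i) = obs_R (d' i) \<and> (obs_R (d i) \<longrightarrow> d i = d' i))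
          \<longrightarrow> Gmut N k m d = Gmut N k m d'"
    \<comment> \<open>Assumption 4: limits and rates\<close>
    and meas_e0: "e0 \<in> borel_measurable MX"
    and meas_r0: "(\<lambda>(t, x, s). r0 t x s) \<in> borel_measurable (count_space UNIV \<Otimes>\<^sub>M MX \<Otimes>\<^sub>M MSg)"
    and meas_mu0: "(\<lambda>(t, x). mu0 t x) \<in> borel_measurable (count_space UNIV \<Otimes>\<^sub>M MX)"
    and meas_mut0: "(\<lambda>(t, x, s). mut0 t x s) \<in> borel_measurable (count_space UNIV \<Otimes>\<^sub>M MX \<Otimes>\<^sub>M MSg)"
    and rate_e: "\<forall>k<K. bigOp \<Omega> (\<lambda>N \<omega>. Lp_norm M 2 (\<lambda>a.
          Ge N k (oof_mask N (fold_assign F W U N \<omega>) k) (\<lambda>i. W i \<omega>) (X a) - e0 (X a))) rho_e"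
    and rate_r: "\<forall>k<K. bigOp \<Omega> (\<lambda>N \<omega>. Lp_norm M 2 (\<lambda>a.
          Gr N k (oof_mask N (fold_assign F W U N \<omega>) k) (\<lambda>i. W i \<omega>) (T a) (X a) (realised T S0 S1 a)
          - r0 (T a) (X a) (realised T S0 S1 a))) rho_r"
    and rate_mu: "\<forall>k<K. bigOp \<Omega> (\<lambda>N \<omega>. Lp_norm M 2 (\<lambda>a.
          Gmu N k (oof_mask N (fold_assign F W U N \<omega>) k) (\<lambda>i. W i \<omega>) (T a) (X a)
          - mu0 (T a) (X a))) rho_mu"
    and rate_mut: "\<forall>k<K. bigOp \<Omega> (\<lambda>N \<omega>. Lp_norm M 2 (\<lambda>a.
          Gmut N k (oof_mask N (fold_assign F W U N \<omega>) k) (\<lambda>i. W i \<omega>) (T a) (X a) (realised T S0 S1 a)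
          - mut0 (T a) (X a) (realised T S0 S1 a))) rho_mut"
    and bd_e_hat: "\<forall>N k. k < K \<longrightarrow> (AE \<omega> in \<Omega>. AE a in M.
          \<epsilon> \<le> Ge N k (oof_mask N (fold_assign F W U N \<omega>) k) (\<lambda>i. W i \<omega>) (X a) \<and>
          Ge N k (oof_mask N (fold_assign F W U N \<omega>) k) (\<lambda>i. W i \<omega>) (X a) \<le> 1 - \<epsilon>)"
    and bd_r_hat: "\<forall>N k. k < K \<longrightarrow> (AE \<omega> in \<Omega>. AE a in M.
          \<epsilon> \<le> Gr N k (oof_mask N (fold_assign F W U N \<omega>) k) (\<lambda>i. W i \<omega>) (T a) (X a) (realised T S0 S1 a) \<and>
          Gr N k (oof_mask N (fold_assign F W U N \<omega>) k) (\<lambda>i. W i \<omega>) (T a) (X a) (realised T S0 S1 a) \<le> 1)"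
    and bd_e0: "AE a in M. \<epsilon> \<le> e0 (X a) \<and> e0 (X a) \<le> 1 - \<epsilon>"
    and bd_r0: "AE a in M. \<epsilon> \<le> r0 (T a) (X a) (realised T S0 S1 a) \<and> r0 (T a) (X a) (realised T S0 S1 a) \<le> 1"
    \<comment> \<open>hypotheses of the theorem\<close>
    and rho_lim: "rho_e \<longlonglongrightarrow> 0" "rho_r \<longlonglongrightarrow> 0" "rho_mu \<longlonglongrightarrow> 0" "rho_mut \<longlonglongrightarrow> 0"
    and dr_1: "AE a in M. (mut0 (T a) (X a) (realised T S0 S1 a) - mutstar (T a) (X a) (realised T S0 S1 a)) *
                          (r0 (T a) (X a) (realised T S0 S1 a) - rstar (T a) (X a) (realised T S0 S1 a)) = 0"
    and dr_2: "AE a in M. (mu0 (T a) (X a) - mustar (T a) (X a)) * (e0 (X a) - estar (X a)) = 0"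
    and sup_mut: "esssup M (\<lambda>a. ereal \<bar>mut0 (T a) (X a) (realised T S0 S1 a)
                                      - mutstar (T a) (X a) (realised T S0 S1 a)\<bar>) \<le> ereal C"
    and sup_mu: "esssup M (\<lambda>a. ereal \<bar>mu0 (T a) (X a) - mustar (T a) (X a)\<bar>) \<le> ereal C"
  shows "conv_in_prob \<Omega>
     (\<lambda>N \<omega>. crossfit_est K N (fold_assign F W U N \<omega>) (\<lambda>i. W i \<omega>)
        (\<lambda>k. Ge N k (oof_mask N (fold_assign F W U N \<omega>) k) (\<lambda>i. W i \<omega>))
        (\<lambda>k. Gr N k (oof_mask N (fold_assign F W U N \<omega>) k) (\<lambda>i. W i \<omega>))
        (\<lambda>k. Gmu N k (oof_mask N (fold_assign F W U N \<omega>) k) (\<lambda>i. W i \<omega>))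
        (\<lambda>k. Gmut N k (oof_mask N (fold_assign F W U N \<omega>) k) (\<lambda>i. W i \<omega>)))
     ((\<integral>a. Y1 a \<partial>M) - (\<integral>a. Y0 a \<partial>M))"
proof -
  let ?S = "obs_meas MX MSg" and ?PM = "PiM UNIV (\<lambda>_::nat. count_space (UNIV :: bool set))"
  let ?SD = "PiM UNIV (\<lambda>_::nat. obs_meas MX MSg)"
  interpret M: prob_space M by (rule M)
  interpret \<Omega>: prob_space \<Omega> by (rule Omega)
  have sq0: "M.sq_integrable Y0" and sq1: "M.sq_integrable Y1"
    using M.sq_integrable_Lp_norm[OF meas_Y0 q A5_Y(2)] M.sq_integrable_Lp_norm[OF meas_Y1 q A5_Y(1)] by auto
  have esssup_le: "AE a in M. f a \<le> C" if "esssup M (\<lambda>a. ereal (f a)) \<le> ereal C" for f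
    using esssup_AE[of "\<lambda>a. ereal (f a)" M] that
    by (auto elim!: eventually_mono dest: order_trans)
  interpret sm: surrogate_model M MX MSg X T S0 S1 Y0 Y1 R estar e0 rstar r0 mustar mu0 mutstar mut0 \<epsilon> C
    by unfold_locales (fact meas_X meas_T meas_S0 meas_S1 meas_R sq0 sq1 A1_unconf A1_mar meas_estar meas_rstar
      meas_mustar meas_mutstar def_estar def_rstar def_mutstar def_mustar eps(1) A2_e A2_r meas_e0 meas_r0 meas_mu0
      meas_mut0 bd_e0 bd_r0 dr_1 dr_2 esssup_le[OF sup_mut] esssup_le[OF sup_mu])+
  have obs_m [measurable]: "sm.obs \<in> measurable M ?S"
    unfolding obs_of_def[abs_def] obs_meas_def
    using meas_X meas_T meas_R sm.Sr_meas by measurable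
  have R_m: "obs_R \<in> measurable ?S (count_space UNIV)"
    unfolding obs_R_def[abs_def] obs_meas_def by measurable
  interpret cs: crossfit_sample \<Omega> ?S "distr M ?S sm.obs" W MU U obs_R F K
  proof (unfold_locales, goal_cases)
    case (1 i) show ?case using meas_W by blast
  next case 2 show ?case by (rule meas_U)
  next case 3 show ?case by (rule iid_indep)
  next case (4 i) show ?case using iid_law by blast
  next case 5 show ?case by (rule U_indep)
  next case 6 show ?case by (rule R_m)
  next case 7 show ?case by (rule K)
  next case (8 N r r' u) then show ?case using F_local by blast
  next case (9 N r i) show ?case using F_meas by blast
  next case (10 k N r u) then show ?case using F_bal_lab by blast
  next case (11 k N r u) then show ?case using F_bal_unlab by blast
  qed
  have fold_eq: "fold_assign F W U N \<omega> = cs.fld N (cs.sample \<omega>) (U \<omega>)" for N \<omega>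
    by (simp add: fold_assign_def cs.fld_def cs.sample_apply)
  have mask_eq: "oof_mask N (fold_assign F W U N \<omega>) k = cs.mask N k \<omega>" for N k \<omega>
    by (simp add: fold_eq cs.mask_def)
  have samp: "(\<lambda>i. W i \<omega>) = cs.sample \<omega>" for \<omega> by (simp add: cs.sample_def)
  let ?e = "\<lambda>N k \<omega>. Ge N k (cs.mask N k \<omega>) (cs.sample \<omega>)"
  let ?r = "\<lambda>N k \<omega>. Gr N k (cs.mask N k \<omega>) (cs.sample \<omega>)"
  let ?mu = "\<lambda>N k \<omega>. Gmu N k (cs.mask N k \<omega>) (cs.sample \<omega>)"
  let ?mut = "\<lambda>N k \<omega>. Gmut N k (cs.mask N k \<omega>) (cs.sample \<omega>)"
  let ?f = "\<lambda>k N m d. score (Ge N k m d) (Gr N k m d) (Gmu N k m d) (Gmut N k m d)"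
  let ?lim = "score e0 r0 mu0 mut0"
  note Ge1 = measurable_app3[OF Ge_meas[rule_format]] and Gr1 = measurable_app5[OF Gr_meas[rule_format]]
    and Gmu1 = measurable_app4[OF Gmu_meas[rule_format]] and Gmut1 = measurable_app5[OF Gmut_meas[rule_format]]
  have f_meas: "(\<lambda>(m, d, w). ?f k N m d w) \<in> borel_measurable (?PM \<Otimes>\<^sub>M ?SD \<Otimes>\<^sub>M ?S)" for k N
  proof -
    have "(\<lambda>(c, w). ?f k N (fst c) (snd c) w) \<in> borel_measurable ((?PM \<Otimes>\<^sub>M ?SD) \<Otimes>\<^sub>M ?S)"
      unfolding case_prod_beta'
      by (rule measurable_score[where e="\<lambda>c. Ge N k (fst c) (snd c)" and r="\<lambda>c. Gr N k (fst c) (snd c)"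
            and mu="\<lambda>c. Gmu N k (fst c) (snd c)" and mut="\<lambda>c. Gmut N k (fst c) (snd c)", unfolded case_prod_beta'])
        (intro Ge1 Gr1 Gmu1 Gmut1; measurable)+
    from measurable_compose[OF _ this, of "\<lambda>z. ((fst z, fst (snd z)), snd (snd z))" "?PM \<Otimes>\<^sub>M ?SD \<Otimes>\<^sub>M ?S"]
    show ?thesis by (simp add: case_prod_beta')
  qed
  have f0_meas [measurable]: "?lim \<in> borel_measurable ?S"
  proof -
    \<comment> \<open>A trivial parameter space makes the limiting score an instance of the
      parametrised lemma.\<close>
    let ?Q = "count_space (UNIV :: unit set)"
    have "(\<lambda>(c, w). ?lim w) \<in> borel_measurable (?Q \<Otimes>\<^sub>M ?S)"
    proof (rule measurable_score)
      show "(\<lambda>(c, x). e0 x) \<in> borel_measurable (?Q \<Otimes>\<^sub>M MX)" by measurable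
      show "(\<lambda>(c, t, x, s). r0 t x s) \<in> borel_measurable (?Q \<Otimes>\<^sub>M count_space UNIV \<Otimes>\<^sub>M MX \<Otimes>\<^sub>M MSg)"
        unfolding case_prod_beta' by measurable
      show "(\<lambda>(c, t, x). mu0 t x) \<in> borel_measurable (?Q \<Otimes>\<^sub>M count_space UNIV \<Otimes>\<^sub>M MX)"
        unfolding case_prod_beta' by measurable
      show "(\<lambda>(c, t, x, s). mut0 t x s) \<in> borel_measurable (?Q \<Otimes>\<^sub>M count_space UNIV \<Otimes>\<^sub>M MX \<Otimes>\<^sub>M MSg)"
        unfolding case_prod_beta' by measurable
    qed
    from measurable_compose[OF _ this, of "\<lambda>w. ((), w)" ?S] show ?thesis by simp
  qed
  have mask_sp: "cs.mask N k \<omega> \<in> space ?PM" for N k \<omega> by (simp add: space_PiM)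
  have samp_sp: "cs.sample \<omega> \<in> space ?SD" if "\<omega> \<in> space \<Omega>" for \<omega>
    using measurable_space[OF cs.sample_meas that] .
  have f_fix: "(\<lambda>w. ?f k N (cs.mask N k \<omega>) (cs.sample \<omega>) w) \<in> borel_measurable ?S" if "\<omega> \<in> space \<Omega>" for k N \<omega>
    using measurable_compose[OF _ f_meas[of N k], of "\<lambda>w. (cs.mask N k \<omega>, cs.sample \<omega>, w)" ?S]
      mask_sp samp_sp[OF that] by simp
  have small: "\<forall>\<^sub>F N in sequentially. whp \<Omega> \<gamma> (\<lambda>\<omega>.
       (\<integral>\<^sup>+w. ennreal \<bar>?f k N (cs.mask N k \<omega>) (cs.sample \<omega>) w - ?lim w\<bar> \<partial>distr M ?S sm.obs) \<le> ennreal \<eta>)"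
    if k: "k < K" and pos: "0 < \<eta>" "0 < \<gamma>" for k \<eta> \<gamma>
  proof -
    \<comment> \<open>The scale at which the perturbation bound equals \<eta>. Each of the four
      rates may fail with probability \<gamma> / 4, and the almost sure bounds cost nothing.\<close>
    define h where "h = \<eta> / sm.pert_const"
    have h: "0 < h" using pos sm.pert_const_pos by (simp add: h_def)
    have g4: "0 < \<gamma> / 4" using pos by simp
    note rates = rate_e rate_r rate_mu rate_mut
    note rates = rates[rule_format, OF k, unfolded mask_eq samp]
    let ?Ne = "\<lambda>N \<omega>. Lp_norm M 2 (\<lambda>a. ?e N k \<omega> (X a) - e0 (X a))"
    let ?Nr = "\<lambda>N \<omega>. Lp_norm M 2 (\<lambda>a. ?r N k \<omega> (T a) (X a) (sm.Sr a) - r0 (T a) (X a) (sm.Sr a))"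
    let ?Nmu = "\<lambda>N \<omega>. Lp_norm M 2 (\<lambda>a. ?mu N k \<omega> (T a) (X a) - mu0 (T a) (X a))"
    let ?Nmut = "\<lambda>N \<omega>. Lp_norm M 2 (\<lambda>a. ?mut N k \<omega> (T a) (X a) (sm.Sr a) - mut0 (T a) (X a) (sm.Sr a))"
    let ?Be = "\<lambda>N \<omega>. AE a in M. \<epsilon> \<le> ?e N k \<omega> (X a) \<and> ?e N k \<omega> (X a) \<le> 1 - \<epsilon>"
    let ?Br = "\<lambda>N \<omega>. AE a in M. \<epsilon> \<le> ?r N k \<omega> (T a) (X a) (sm.Sr a) \<and> ?r N k \<omega> (T a) (X a) (sm.Sr a) \<le> 1"
    note Lp = Lp_norm_measurable[OF M.sigma_finite_measure_axioms]
    have m: "?Ne N \<in> borel_measurable \<Omega>" "?Nr N \<in> borel_measurable \<Omega>"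
      "?Nmu N \<in> borel_measurable \<Omega>" "?Nmut N \<in> borel_measurable \<Omega>" for N
      by (rule Lp, unfold case_prod_beta', intro borel_measurable_diff Ge1 Gr1 Gmu1 Gmut1; measurable)+
    show ?thesis
      using bigOp_eventually_small[OF rates(1) rho_lim(1) m(1) h g4] bigOp_eventually_small[OF rates(2) rho_lim(2) m(2) h g4]
        bigOp_eventually_small[OF rates(3) rho_lim(3) m(3) h g4] bigOp_eventually_small[OF rates(4) rho_lim(4) m(4) h g4]
    proof eventually_elim
      case (elim N)
      have "AE \<omega> in \<Omega>. ?Be N \<omega> \<and> ?Br N \<omega>"
        using bd_e_hat[rule_format, OF k, of N] bd_r_hat[rule_format, OF k, of N] unfolding mask_eq samp
        by (rule eventually_conj)
      note \<Omega>.whp_conj[OF \<Omega>.whp_conj[OF \<Omega>.whp_conj[OF elim(1,2)] \<Omega>.whp_conj[OF elim(3,4)]] \<Omega>.whp_AE[OF this]]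
      then show ?case
      proof (rule whp_mono)
        fix \<omega> assume w: "\<omega> \<in> space \<Omega>"
          and H: "((?Ne N \<omega> \<le> ereal h \<and> ?Nr N \<omega> \<le> ereal h) \<and> ?Nmu N \<omega> \<le> ereal h \<and> ?Nmut N \<omega> \<le> ereal h) \<and> ?Be N \<omega> \<and> ?Br N \<omega>"
        note c = measurable_const[OF mask_sp[of N k \<omega>]] measurable_const[OF samp_sp[OF w]]
        have [measurable]: "(\<lambda>w. ?f k N (cs.mask N k \<omega>) (cs.sample \<omega>) w) \<in> borel_measurable ?S" by (rule f_fix[OF w])
        have "(\<integral>\<^sup>+w. ennreal \<bar>?f k N (cs.mask N k \<omega>) (cs.sample \<omega>) w - ?lim w\<bar> \<partial>distr M ?S sm.obs)
          = (\<integral>\<^sup>+a. ennreal \<bar>?f k N (cs.mask N k \<omega>) (cs.sample \<omega>) (sm.obs a) - ?lim (sm.obs a)\<bar> \<partial>M)"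
          by (rule nn_integral_distr) measurable
        also have "\<dots> \<le> ennreal (sm.pert_const * h)"
        proof (rule sm.score_perturbation)
          show "?e N k \<omega> \<in> borel_measurable MX" by (rule Ge1[OF c]) simp
          show "(\<lambda>(t, x, s). ?r N k \<omega> t x s) \<in> borel_measurable sm.NTXS"
            unfolding case_prod_beta' by (rule Gr1[OF c]) measurable
          show "(\<lambda>(t, x). ?mu N k \<omega> t x) \<in> borel_measurable sm.NTX"
            unfolding case_prod_beta' by (rule Gmu1[OF c]) measurable
          show "(\<lambda>(t, x, s). ?mut N k \<omega> t x s) \<in> borel_measurable sm.NTXS"
            unfolding case_prod_beta' by (rule Gmut1[OF c]) measurable
        qed (use H h in blast | use h in simp)+
        also have "sm.pert_const * h = \<eta>" using sm.pert_const_pos by (simp add: h_def)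
        finally show "(\<integral>\<^sup>+w. ennreal \<bar>?f k N (cs.mask N k \<omega>) (cs.sample \<omega>) w - ?lim w\<bar> \<partial>distr M ?S sm.obs) \<le> ennreal \<eta>" .
      qed simp
    qed
  qed
  have f0_sq: "integrable (distr M ?S sm.obs) (\<lambda>w. (?lim w)\<^sup>2)"
    using sm.score_limit_sq unfolding M.sq_integrable_def by (subst integrable_distr_eq) auto
  let ?\<delta> = "(\<integral>a. Y1 a \<partial>M) - (\<integral>a. Y0 a \<partial>M)"
  have f0_int: "(\<integral>w. ?lim w \<partial>distr M ?S sm.obs) = ?\<delta>"
    by (subst integral_distr) (auto simp: sm.score_limit_integral)
  have oof: "?f k N m d = ?f k N m d'" if "\<forall>i. m i \<longrightarrow> d i = d' i" for k N m d d'
  proof -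
    \<comment> \<open>Reading only labelled out-of-fold data is the stronger restriction, so
      agreement on all masked observations also fixes the outcome regressions.\<close>
    have 1: "\<forall>i. m i \<longrightarrow> obs_R (d i) = obs_R (d' i) \<and> (obs_R (d i) \<longrightarrow> d i = d' i)" using that by simp
    show ?thesis
      using Ge_oof[rule_format, of m d d' N k] Gr_oof[rule_format, of m d d' N k] that
        Gmu_oof[rule_format, of m d d' N k] Gmut_oof[rule_format, of m d d' N k] 1 by metis
  qed
  have van: "vanishes \<Omega> (\<lambda>N \<omega>. 1 / real K * (\<Sum>k<K. cs.fold_mean N k \<omega> (?f k N (cs.mask N k \<omega>) (cs.sample \<omega>)) - ?\<delta>))"
  proof (intro \<Omega>.vanishes_cmult \<Omega>.vanishes_sum)
    fix k assume "k \<in> {..<K}"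
    then have k: "k < K" by simp
    show "vanishes \<Omega> (\<lambda>N \<omega>. cs.fold_mean N k \<omega> (?f k N (cs.mask N k \<omega>) (cs.sample \<omega>)) - ?\<delta>)"
      using cs.crossfit_average_vanishes[OF k f_meas[of _ k] oof f0_meas small[OF k] f0_sq] unfolding f0_int .
  qed simp
  have est: "crossfit_est K N (fold_assign F W U N \<omega>) (\<lambda>i. W i \<omega>) (\<lambda>k. ?e N k \<omega>) (\<lambda>k. ?r N k \<omega>) (\<lambda>k. ?mu N k \<omega>) (\<lambda>k. ?mut N k \<omega>) - ?\<delta>
    = 1 / real K * (\<Sum>k<K. cs.fold_mean N k \<omega> (?f k N (cs.mask N k \<omega>) (cs.sample \<omega>)) - ?\<delta>)" for N \<omega>
  proof -
    have I: "{i. i < N \<and> fold_assign F W U N \<omega> i = k} = cs.in_fold N k \<omega>" for k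
      by (simp add: cs.in_fold_def cs.fold_set_def fold_eq)
    show ?thesis
      unfolding crossfit_est_def I sum_subtractf cs.fold_mean_def using K by (simp add: right_diff_distrib)
  qed
  show ?thesis
    unfolding mask_eq samp
    by (rule \<Omega>.vanishes_conv_in_prob) (use van in \<open>simp only: est[unfolded samp]\<close>)
qed

end
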